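(* Let $(A,W)$ be a 1-Schur pair and $S$ a Sato operator of $W$. Then: (1) for every $f\in A$ there is a unique operator $\mathtt L_S(f)\in\hat D_n^{sym}$ with $S\circ f=\mathtt L_S(f)\circ S$, and $\mathbf{ord}(\mathtt L_S(f))=\mathbf{ord}(f)$; (2) the map $A\to\hat D_n^{sym}$, $f\mapsto\mathtt L_S(f)$, is an injective homomorphism of $K$-algebras.
   Context: Let $K$ be a field of characteristic $0$, $n\ge1$, $m\ge0$, $K_y:=K[[y_1,\dots,y_m]]$ ($K_y=K$ if $m=0$), $\hat R_y:=K_y[[x_1,\dots,x_n]]$ with maximal ideal $\mathfrak m=(y_1,\dots,y_m,x_1,\dots,x_n)$ and $\mathfrak m$-adic order $\upsilon$. For a formal series $P=\sum_{\underline k}a_{\underline k}\underline\partial^{\underline k}$ ($a_{\underline k}\in\hat R_y$) put $\mathbf{ord}(P)=\sup_{\underline k}(|\underline k|-\upsilon(a_{\underline k}))$; $\hat D_n^{sym}$ is the ring of such series with $\mathbf{ord}<\infty$ (Leibniz rule, $\partial_i=\partial/\partial x_i$, $y_j$ central). Highest symbol $\sigma(P)$: sum of the terms $\alpha\,\underline z^{\underline i}\underline\partial^{\underline k}$ ($\underline z^{\underline i}$ monomial in $x$'s and $y$'s) with $|\underline k|-|\underline i|=\mathbf{ord}(P)$. $\bar a:=a|_{y=0}$. $\hat D_n^n$: operators not involving $\partial_n$; $\hat E_n:=\hat D_n^n((\partial_n^{-1}))$ (multiplication $\partial_n^s a=\sum_{j\ge0}\binom{s}{j}\partial_n^j(a)\partial_n^{s-j}$),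 $\Pi_n=\{P\in\hat E_n:\mathbf{ord}(P)<\infty\}$. $\hat\Pi_n$: series $\sum_{i\in\mathbb Z}a_i\partial_n^i$ ($a_i\in\hat D_n^n$) with $\mathbf{ord}<\infty$; a $(\hat D_n^{sym},\Pi_n)$-bimodule with products $\circ$ (associative). $V_n:=K_y\{\{\partial_1,\dots,\partial_{n-1}\}\}((\partial_n^{-1}))$ with $K_y\{\{\partial_1,\dots,\partial_{n-1}\}\}=K_y[[\partial_1,\dots,\partial_{n-1}]]\cap\hat D_n^n$ (a commutative ring); $F:=K_y[[\partial_1,\dots,\partial_n]]\cap\Pi_n$. Each $P\in\hat\Pi_n$ has a unique slice decomposition $P=\sum_{\underline i\in\mathbb N_0^n}\frac{\underline x^{\underline i}}{\underline i!}P_{(\underline i)}$, $P_{(\underline i)}\in V_n$; for $\underline k\in\mathbb N_0^{n-1}\times\mathbb Z$, $\underline\partial^{\underline k}\diamond P:=\sum_{\underline i}\binom{\underline k}{\underline i}\underline\partial^{\underline k-\underline i}P_{(\underline i)}$ (i.e. $\underline\partial^{\underline k}\circ P$ modulo $(x_1,\dots,x_n)$), extended $K_y$-linearly and continuously to $f\diamond P$, $f\in V_n$. $P$ is regular if $f\mapsto f\diamond\sigma(P)$, $F\to V_n$, is injective. For $0\neq a=\sum a_{\underline i}\underline\partial^{\underline i}\in V_n$, $\mathrm{ord}_\Gamma(a)$ is the anti-lexicographically largest $\underline i$ with $a_{\underline i}\neq0$ and $LT(a)=\bar a_{\mathrm{ord}_\Gamma(a)}\underline\partial^{\mathrm{ord}_\Gamma(a)}$;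 $\mathrm{Supp}(W)$ is the $K_y$-span of $LT(a)$, $a\in W$. $W\subseteq V_n\cap\Pi_n$ is a 1-space if it has a basis $\{w_k\}$ with $\{\bar w_k\}$ a basis of $\mathrm{Supp}(W)$. $W_k=\{w\in W:\mathbf{ord}(w)\le k\}$, $H_W(k)=\dim_K\bar W_k$; $\mathrm{Gr}_\mu(V_n)$: 1-spaces with $H_W(\mu+k)=\binom{n+k}{n}$ for all $k\in\mathbb Z$. A Sato operator of $W\in\mathrm{Gr}_\mu(V_n)$ is a regular $S\in\hat\Pi_n$ with $\mathbf{ord}(S)=\mu$ and $W=F\diamond S$. A 1-Schur pair is a pair $(A,W)$ of 1-spaces in $V_n$ with $A$ a $K$-subalgebra with $1$, $W\cdot A\subseteq W$, and $W\in\mathrm{Gr}_\mu(V_n)$ for some $\mu\in\mathbb Z$. *)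

theory Defs
  imports Main "HOL-Library.Function_Algebras" "HOL-Library.Extended_Real"
begin

(* ---------------------------------------------------------------------
   Encoding.  Variables y_1..y_m are indexed 0..m-1, x_1..x_n and
   \<partial>_1..\<partial>_n are indexed 0..n-1 (so \<partial>_n has index n-1).
   An operator  P = \<Sum> c y^\<beta> x^\<delta> \<partial>^k  (coefficients written to the LEFT
   of the \<partial>'s, the normal form a_k \<partial>^k) is stored as its coefficient
   function  P \<beta> \<delta> k \<in> K.
   --------------------------------------------------------------------- *)

type_synonym mexp = "nat \<Rightarrow> nat"   (* exponent of y's or of x's *)
type_synonym dexp = "nat \<Rightarrow> int"   (* exponent of \<partial>'s (\<partial>_n may be negative) *)
type_synonym 'k op = "mexp \<Rightarrow> mexp \<Rightarrow> dexp \<Rightarrow> 'k"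

definition mdeg :: "mexp \<Rightarrow> nat" where
  "mdeg b = sum b {i. b i \<noteq> 0}"

definition ddeg :: "dexp \<Rightarrow> int" where
  "ddeg k = sum k {i. k i \<noteq> 0}"

definition wf_op :: "nat \<Rightarrow> nat \<Rightarrow> 'k::zero op \<Rightarrow> bool" where
  "wf_op m n P \<longleftrightarrow> (\<forall>b d k. P b d k \<noteq> 0 \<longrightarrow>
      (\<forall>i\<ge>m. b i = 0) \<and> (\<forall>i\<ge>n. d i = 0) \<and> (\<forall>i\<ge>n. k i = 0) \<and>
      (\<forall>i. i + 1 < n \<longrightarrow> k i \<ge> 0))"

(* ord(P) = sup (|k| - \<upsilon>(a_k)) = sup over nonzero terms of |k| - |\<beta>| - |\<delta>| ;
   Sup of the empty set is -\<infinity> *)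
definition op_ord :: "'k::zero op \<Rightarrow> ereal" where
  "op_ord P = Sup {ereal (of_int (ddeg k - int (mdeg b) - int (mdeg d))) | b d k. P b d k \<noteq> 0}"

definition gbin :: "dexp \<Rightarrow> mexp \<Rightarrow> 'k::field_char_0" where
  "gbin k j = (\<Prod>i\<in>{i. j i \<noteq> 0}. (of_int (k i) gchoose (j i)))"

(* \<partial>^j (x^d) = dfac d j * x^(d-j),  dfac d j = \<Prod>_i d_i!/(d_i-j_i)! *)
definition dfac :: "mexp \<Rightarrow> mexp \<Rightarrow> 'k::field_char_0" where
  "dfac d j = (\<Prod>i\<in>{i. j i \<noteq> 0}. (of_nat (d i) gchoose (j i)) * fact (j i))"

definition mfact :: "mexp \<Rightarrow> 'k::field_char_0" where
  "mfact j = (\<Prod>i\<in>{i. j i \<noteq> 0}. fact (j i))"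

(* composition \<circ>:  (a \<partial>^k)(b \<partial>^l) = \<Sum>_j binom(k,j) a \<partial>^j(b) \<partial>^(k-j+l)
   (Leibniz rule, and  \<partial>_n^s b = \<Sum>_j binom(s,j) \<partial>_n^j(b) \<partial>_n^(s-j) for s<0).
   Each coefficient is the (finite, in all uses below) sum of the contributions. *)
definition op_term :: "'k::field_char_0 op \<Rightarrow> 'k op \<Rightarrow> mexp \<Rightarrow> mexp \<Rightarrow> dexp
     \<Rightarrow> mexp \<times> mexp \<times> dexp \<times> mexp \<Rightarrow> 'k" where
  "op_term P Q b d g = (\<lambda>(b1, d1, k, j).
      P b1 d1 k * gbin k j * Q (b - b1) (d - d1 + j) (\<lambda>i. g i - k i + int (j i))
        * dfac (d - d1 + j) j)"

definition op_comp :: "'k::field_char_0 op \<Rightarrow> 'k op \<Rightarrow> 'k op" where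
  "op_comp P Q = (\<lambda>b d g. sum (op_term P Q b d g)
      {(b1, d1, k, j). b1 \<le> b \<and> d1 \<le> d \<and> op_term P Q b d g (b1, d1, k, j) \<noteq> 0})"

definition one_op :: "'k::{zero,one} op" where
  "one_op = (\<lambda>b d k. if b = 0 \<and> d = 0 \<and> k = 0 then 1 else 0)"

definition scaleK :: "'k::times \<Rightarrow> 'k op \<Rightarrow> 'k op" where
  "scaleK c P = (\<lambda>b d k. c * P b d k)"

definition bar :: "'k::zero op \<Rightarrow> 'k op" where
  "bar P = (\<lambda>b d k. if b = 0 then P b d k else 0)"

definition nslice :: "nat \<Rightarrow> 'k::zero op \<Rightarrow> int \<Rightarrow> 'k op" where
  "nslice n P i = (\<lambda>b d k. if k (n - 1) = i then P b d k else 0)"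

definition Dsym :: "nat \<Rightarrow> nat \<Rightarrow> 'k::zero op set" where
  "Dsym m n = {P. wf_op m n P \<and> (\<forall>b d k. P b d k \<noteq> 0 \<longrightarrow> k (n - 1) \<ge> 0) \<and> op_ord P < \<infinity>}"

definition Pihat :: "nat \<Rightarrow> nat \<Rightarrow> 'k::zero op set" where
  "Pihat m n = {P. wf_op m n P \<and> op_ord P < \<infinity>}"

(* \<Pi>_n = {P \<in> D^n_n((\<partial>_n^{-1})) : ord P < \<infinity>} *)
definition Pin :: "nat \<Rightarrow> nat \<Rightarrow> 'k::zero op set" where
  "Pin m n = {P. P \<in> Pihat m n \<and> (\<exists>N. \<forall>b d k. P b d k \<noteq> 0 \<longrightarrow> k (n - 1) \<le> N)}"

(* V_n = K_y{{\<partial>_1..\<partial>_{n-1}}}((\<partial>_n^{-1})) : constant coefficients (in K_y),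
   bounded above in \<partial>_n, each \<partial>_n-coefficient of finite ord *)
definition Vn :: "nat \<Rightarrow> nat \<Rightarrow> 'k::zero op set" where
  "Vn m n = {P. wf_op m n P \<and> (\<forall>b d k. P b d k \<noteq> 0 \<longrightarrow> d = 0) \<and>
       (\<exists>N. \<forall>b d k. P b d k \<noteq> 0 \<longrightarrow> k (n - 1) \<le> N) \<and>
       (\<forall>i. op_ord (nslice n P i) < \<infinity>)}"

(* F = K_y[[\<partial>_1..\<partial>_n]] \<inter> \<Pi>_n *)
definition Fn :: "nat \<Rightarrow> nat \<Rightarrow> 'k::zero op set" where
  "Fn m n = {P. P \<in> Pin m n \<and> (\<forall>b d k. P b d k \<noteq> 0 \<longrightarrow> d = 0 \<and> (\<forall>i. k i \<ge> 0))}"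

definition sigma :: "'k::zero op \<Rightarrow> 'k op" where
  "sigma P = (\<lambda>b d k. if ereal (of_int (ddeg k - int (mdeg b) - int (mdeg d))) = op_ord P
                        then P b d k else 0)"

(* f \<diamond> P = \<Sum>_k f_k \<Sum>_i binom(k,i) \<partial>^(k-i) P_(i),  P_(i) = i! * (x^i-coefficient of P) *)
definition dia_term :: "'k::field_char_0 op \<Rightarrow> 'k op \<Rightarrow> mexp \<Rightarrow> dexp
     \<Rightarrow> mexp \<times> dexp \<times> mexp \<Rightarrow> 'k" where
  "dia_term f P b g = (\<lambda>(b1, k, i).
      f b1 0 k * gbin k i * mfact i * P (b - b1) i (\<lambda>t. g t - k t + int (i t)))"

definition diamond :: "'k::field_char_0 op \<Rightarrow> 'k op \<Rightarrow> 'k op" where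
  "diamond f P = (\<lambda>b d g. if d = 0 then
      sum (dia_term f P b g) {(b1, k, i). b1 \<le> b \<and> dia_term f P b g (b1, k, i) \<noteq> 0}
      else 0)"

definition regular :: "nat \<Rightarrow> nat \<Rightarrow> 'k::field_char_0 op \<Rightarrow> bool" where
  "regular m n P \<longleftrightarrow> inj_on (\<lambda>f. diamond f (sigma P)) (Fn m n)"

definition is_Ky :: "nat \<Rightarrow> (mexp \<Rightarrow> 'k::zero) \<Rightarrow> bool" where
  "is_Ky m c \<longleftrightarrow> (\<forall>b. c b \<noteq> 0 \<longrightarrow> (\<forall>i\<ge>m. b i = 0))"

definition Ky_smult :: "(mexp \<Rightarrow> 'k::comm_ring_1) \<Rightarrow> 'k op \<Rightarrow> 'k op" where
  "Ky_smult c P = (\<lambda>b d k. sum (\<lambda>b1. c b1 * P (b - b1) d k)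
                        {b1. b1 \<le> b \<and> c b1 * P (b - b1) d k \<noteq> 0})"

definition Ky_span :: "nat \<Rightarrow> 'k::comm_ring_1 op set \<Rightarrow> 'k op set" where
  "Ky_span m X = {P. \<exists>F c. finite F \<and> F \<subseteq> X \<and> (\<forall>x\<in>F. is_Ky m (c x)) \<and>
                          P = (\<Sum>x\<in>F. Ky_smult (c x) x)}"

(* formally convergent K_y-combinations \<Sum>_{w\<in>B} c_w w (coefficientwise finite) *)
definition fcomb_set :: "'k::comm_ring_1 op set \<Rightarrow> ('k op \<Rightarrow> mexp \<Rightarrow> 'k)
     \<Rightarrow> mexp \<Rightarrow> mexp \<Rightarrow> dexp \<Rightarrow> ('k op \<times> mexp) set" where
  "fcomb_set B c b d k = {(w, b1). w \<in> B \<and> b1 \<le> b \<and> c w b1 * w (b - b1) d k \<noteq> 0}"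

definition fconv :: "'k::comm_ring_1 op set \<Rightarrow> ('k op \<Rightarrow> mexp \<Rightarrow> 'k) \<Rightarrow> bool" where
  "fconv B c \<longleftrightarrow> (\<forall>b d k. finite (fcomb_set B c b d k))"

definition fcomb :: "'k::comm_ring_1 op set \<Rightarrow> ('k op \<Rightarrow> mexp \<Rightarrow> 'k) \<Rightarrow> 'k op" where
  "fcomb B c = (\<lambda>b d k. sum (\<lambda>(w, b1). c w b1 * w (b - b1) d k) (fcomb_set B c b d k))"

definition admissible_coeffs :: "nat \<Rightarrow> 'k::comm_ring_1 op set \<Rightarrow> ('k op \<Rightarrow> mexp \<Rightarrow> 'k) \<Rightarrow> bool" where
  "admissible_coeffs m B c \<longleftrightarrow> (\<forall>w. is_Ky m (c w)) \<and> (\<forall>w. w \<notin> B \<longrightarrow> c w = (\<lambda>_. 0)) \<and> fconv B c"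

definition formal_basis :: "nat \<Rightarrow> 'k::comm_ring_1 op set \<Rightarrow> 'k op set \<Rightarrow> bool" where
  "formal_basis m B X \<longleftrightarrow> B \<subseteq> X \<and>
     (\<forall>c. admissible_coeffs m B c \<and> fcomb B c = 0 \<longrightarrow> (\<forall>w\<in>B. c w = (\<lambda>_. 0))) \<and>
     (\<forall>x\<in>X. \<exists>c. admissible_coeffs m B c \<and> x = fcomb B c)"

definition antilex_less :: "nat \<Rightarrow> dexp \<Rightarrow> dexp \<Rightarrow> bool" where
  "antilex_less n k k' \<longleftrightarrow> (\<exists>i<n. k i < k' i \<and> (\<forall>t. i < t \<and> t < n \<longrightarrow> k t = k' t))"

(* for a \<in> V_n (so a = \<Sum> a_k \<partial>^k, a_k \<in> K_y), a_k \<noteq> 0 iff some y-coefficient is nonzero *)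
definition ord_Gamma :: "nat \<Rightarrow> 'k::zero op \<Rightarrow> dexp" where
  "ord_Gamma n a = (THE k. (\<exists>b. a b 0 k \<noteq> 0) \<and>
       (\<forall>k'. (\<exists>b. a b 0 k' \<noteq> 0) \<longrightarrow> k' = k \<or> antilex_less n k' k))"

definition LT :: "nat \<Rightarrow> 'k::zero op \<Rightarrow> 'k op" where
  "LT n a = (\<lambda>b d k. if b = 0 \<and> d = 0 \<and> k = ord_Gamma n a then a 0 0 (ord_Gamma n a) else 0)"

definition Supp :: "nat \<Rightarrow> nat \<Rightarrow> 'k::comm_ring_1 op set \<Rightarrow> 'k op set" where
  "Supp m n W = Ky_span m {LT n a | a. a \<in> W \<and> a \<noteq> 0}"

definition one_space :: "nat \<Rightarrow> nat \<Rightarrow> 'k::field_char_0 op set \<Rightarrow> bool" where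
  "one_space m n W \<longleftrightarrow> W \<subseteq> Vn m n \<inter> Pin m n \<and>
     (\<exists>B. formal_basis m B W \<and> inj_on bar B \<and> formal_basis m (bar ` B) (Supp m n W))"

definition Wk :: "'k::zero op set \<Rightarrow> int \<Rightarrow> 'k op set" where
  "Wk W k = {w \<in> W. op_ord w \<le> ereal (of_int k)}"

definition HW :: "'k::field op set \<Rightarrow> int \<Rightarrow> nat" where
  "HW W k = vector_space.dim (scaleK :: 'k \<Rightarrow> 'k op \<Rightarrow> 'k op) (bar ` Wk W k)"

definition binomZ :: "nat \<Rightarrow> int \<Rightarrow> nat" where
  "binomZ n k = (if k < 0 then 0 else (n + nat k) choose n)"

definition Gr :: "nat \<Rightarrow> nat \<Rightarrow> int \<Rightarrow> 'k::field_char_0 op set set" where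
  "Gr m n \<mu> = {W. one_space m n W \<and> (\<forall>k::int. HW W (\<mu> + k) = binomZ n k)}"

definition is_sato :: "nat \<Rightarrow> nat \<Rightarrow> int \<Rightarrow> 'k::field_char_0 op set \<Rightarrow> 'k op \<Rightarrow> bool" where
  "is_sato m n \<mu> W S \<longleftrightarrow> W \<in> Gr m n \<mu> \<and> S \<in> Pihat m n \<and> regular m n S \<and>
      op_ord S = ereal (of_int \<mu>) \<and> W = (\<lambda>f. diamond f S) ` Fn m n"

definition one_schur_pair :: "nat \<Rightarrow> nat \<Rightarrow> 'k::field_char_0 op set \<Rightarrow> 'k op set \<Rightarrow> bool" where
  "one_schur_pair m n A W \<longleftrightarrow> one_space m n A \<and> one_space m n W \<and>
     one_op \<in> A \<and> (\<forall>f\<in>A. \<forall>g\<in>A. f + g \<in> A \<and> op_comp f g \<in> A) \<and>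
     (\<forall>c. \<forall>f\<in>A. scaleK c f \<in> A) \<and>
     (\<forall>w\<in>W. \<forall>a\<in>A. op_comp w a \<in> W) \<and>
     (\<exists>\<mu>. W \<in> Gr m n \<mu>)"

definition L_S :: "nat \<Rightarrow> nat \<Rightarrow> 'k::field_char_0 op \<Rightarrow> 'k op \<Rightarrow> 'k op" where
  "L_S m n S f = (THE L. L \<in> Dsym m n \<and> op_comp S f = op_comp L S)"

end

theory Submission
  imports Defs
begin

text \<open>
  An operator \<open>P\<close> is determined by the slices \<open>\<partial>\<^sup>k \<diamond> P\<close>, \<open>k \<in> \<nat>\<^sup>n\<close>, which can be prescribed
  arbitrarily (binomial inversion), and \<open>f \<diamond> P\<close> is \<open>f \<circ> P\<close> at \<open>x = 0\<close>. For \<open>f \<in> A\<close> the elements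
  \<open>\<partial>\<^sup>k \<diamond> (S \<circ> f) = (\<partial>\<^sup>k \<diamond> S) f\<close> lie in \<open>W = F \<diamond> S\<close>, hence equal \<open>h\<^sub>k \<diamond> S\<close> with \<open>h\<^sub>k \<in> F\<close>; the
  operator \<open>L\<close> with \<open>\<partial>\<^sup>k \<diamond> L = h\<^sub>k\<close> satisfies \<open>L \<circ> S = S \<circ> f\<close>. Regularity bounds the order of \<open>h\<^sub>k\<close>,
  hence of \<open>L\<close>, by that of \<open>f\<close>. The Hilbert function of \<open>W\<close> forces polynomials in \<open>\<partial>\<close> to act
  injectively on \<open>S\<close> modulo \<open>y\<close>, which makes \<open>L\<close> unique. The homomorphism property follows from
  uniqueness and associativity, the inequality \<open>ord f \<le> ord L\<close> and injectivity from the absence of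
  zero divisors among top-degree parts.
\<close>

section \<open>Multi-indices\<close>

text \<open>The obstacle is finiteness. \<open>op_comp\<close> adds up the nonzero contributions,
  and a sum over an infinite set is 0 by convention, so a product can be rearranged only where
  finitely many terms contribute. Two situations suffice. If the left factor lies in
  \<open>Dsym\<close> and has order at most \<open>c\<close>, its terms with y- and x-exponents at
  most \<open>b\<close> and \<open>d\<close> have \<open>|k| \<le> c + |b| + |d|\<close>, so
  finitely many \<open>k\<close> occur. If the right factor has coefficients free of x, no
  derivation hits it and the product is a convolution, which is finite because the exponent of
  \<open>\<partial>_n\<close> is bounded above in each factor once the y- and x-exponents are
  bounded. Accordingly associativity is proved for three kinds of triples:
  \<open>L \<circ> (M \<circ> P)\<close>, \<open>L \<circ> (P \<circ> f)\<close> and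
  \<open>(P \<circ> f) \<circ> h\<close>, with \<open>L\<close>, \<open>M\<close> in
  \<open>Dsym\<close> and \<open>f\<close>, \<open>h\<close> free of x. The first and second give
  the homomorphism property together with the third; the case \<open>L = \<partial>^k\<close> is
  what carries slices through a product.\<close>

definition supp_below :: "nat \<Rightarrow> (nat \<Rightarrow> 'a::zero) \<Rightarrow> bool" where
  "supp_below n v \<longleftrightarrow> (\<forall>i\<ge>n. v i = 0)"

text \<open>Integer bounds keep the estimates inside integer arithmetic. The zero operator, whose
  order is -\<infinity>, satisfies every one of them.\<close>

definition ordle :: "'k::zero op \<Rightarrow> int \<Rightarrow> bool" where
  "ordle P c \<longleftrightarrow> (\<forall>b d k. P b d k \<noteq> 0 \<longrightarrow> ddeg k - int (mdeg b) - int (mdeg d) \<le> c)"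

definition unit_vec :: "nat \<Rightarrow> mexp" where
  "unit_vec t = (\<lambda>i. if i = t then 1 else 0)"

text \<open>A cube rather than a simplex, because an interval of the componentwise order is a
  convenient range of summation: it contains every exponent of degree at most \<open>r\<close>, and
  its shift by \<open>unit_vec t\<close> is easy to control.\<close>

definition box :: "nat \<Rightarrow> nat \<Rightarrow> mexp" where
  "box n r = (\<lambda>i. if i < n then r else 0)"

abbreviation ints :: "mexp \<Rightarrow> dexp" where
  "ints l \<equiv> (\<lambda>i. int (l i))"

lemma mdeg_eq: assumes "supp_below n v" shows "mdeg v = (\<Sum>i<n. v i)"
  unfolding mdeg_def using assms
  by (intro sum.mono_neutral_left) (auto simp: supp_below_def not_less[symmetric])

lemma ddeg_eq: assumes "supp_below n v" shows "ddeg v = (\<Sum>i<n. v i)"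
  unfolding ddeg_def using assms
  by (intro sum.mono_neutral_left) (auto simp: supp_below_def not_less[symmetric])

lemma supp_below_zero [simp]: "supp_below n 0"
  by (simp add: supp_below_def)

lemma supp_below_box [simp]: "supp_below n (box n r)"
  by (simp add: supp_below_def box_def)

lemma supp_below_unit [simp]: "t < n \<Longrightarrow> supp_below n (unit_vec t)"
  by (simp add: supp_below_def unit_vec_def)

lemma supp_below_add [simp]:
  fixes u v :: "nat \<Rightarrow> 'a::monoid_add"
  shows "supp_below n u \<Longrightarrow> supp_below n v \<Longrightarrow> supp_below n (u + v)"
  by (simp add: supp_below_def)

lemma supp_below_minus [simp]: "supp_below n (u::mexp) \<Longrightarrow> supp_below n (u - v)"
  by (simp add: supp_below_def)

lemma supp_below_mono: "supp_below n (v::mexp) \<Longrightarrow> u \<le> v \<Longrightarrow> supp_below n u"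
  by (auto simp: supp_below_def le_fun_def) (metis le_zero_eq)

lemma supp_below_ints [simp]: "supp_below n (ints l) = supp_below n l"
  by (simp add: supp_below_def)

lemma zero_mexp_fold [simp]: "(\<lambda>i. 0) = (0::mexp)"
  by (simp add: fun_eq_iff)

lemma mdeg_zero [simp]: "mdeg 0 = 0"
  by (simp add: mdeg_def)

lemma mdeg_add: "supp_below n u \<Longrightarrow> supp_below n v \<Longrightarrow> mdeg (u + v) = mdeg u + mdeg v"
  by (simp add: mdeg_eq[of n] sum.distrib)

lemma mdeg_unit [simp]: "mdeg (unit_vec t) = 1"
proof -
  have "{i. unit_vec t i \<noteq> 0} = {t}" by (auto simp: unit_vec_def)
  thus ?thesis by (simp add: mdeg_def unit_vec_def)
qed

lemma mdeg_minus: "supp_below n v \<Longrightarrow> u \<le> v \<Longrightarrow> mdeg (v - u) = mdeg v - mdeg u"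
  using supp_below_mono[of n v u]
  by (simp add: mdeg_eq[of n] sum_subtractf_nat le_fun_def)

lemma mdeg_mono: "supp_below n v \<Longrightarrow> u \<le> v \<Longrightarrow> mdeg u \<le> mdeg v"
  using supp_below_mono[of n v u]
  by (simp add: mdeg_eq[of n] sum_mono le_fun_def)

lemma mdeg_strict_mono:
  assumes "supp_below n v" "u \<le> v" "u \<noteq> v" shows "mdeg u < mdeg v"
proof -
  have u: "supp_below n u" using assms supp_below_mono by blast
  obtain t where t: "u t \<noteq> v t" using assms by blast
  hence "u t < v t" using assms(2) by (meson le_fun_def le_neq_implies_less)
  moreover have "t < n" using t u assms(1) by (auto simp: supp_below_def not_less[symmetric]) (metis linorder_not_less)
  ultimately show ?thesis
    unfolding mdeg_eq[OF u] mdeg_eq[OF assms(1)]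
    by (intro sum_strict_mono_ex1) (use assms in \<open>auto simp: le_fun_def\<close>)
qed

lemma ddeg_ints: "supp_below n l \<Longrightarrow> ddeg (ints l) = int (mdeg l)"
  by (simp add: mdeg_eq[of n] ddeg_eq[of n])

lemma le_box_mdeg:
  assumes "supp_below n l" "mdeg l \<le> r" shows "l \<le> box n r"
proof (rule le_funI)
  fix i show "l i \<le> box n r i"
  proof (cases "i < n")
    case True
    hence "l i \<le> mdeg l" unfolding mdeg_eq[OF assms(1)] by (intro member_le_sum) auto
    thus ?thesis using True assms(2) by (simp add: box_def)
  qed (use assms in \<open>auto simp: supp_below_def\<close>)
qed

lemma finite_below: assumes "supp_below n (v::mexp)" shows "finite {..v}"
proof -
  have "{..v} \<subseteq> {f. \<forall>x. (x \<in> {..<n} \<longrightarrow> f x \<in> {..sum v {..<n}}) \<and> (x \<notin> {..<n} \<longrightarrow> f x = 0)}"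
  proof (intro subsetI CollectI allI conjI impI)
    fix u x assume u: "u \<in> {..v}"
    { assume x: "x \<in> {..<n}"
      have "u x \<le> v x" using u by (simp add: le_fun_def)
      also have "\<dots> \<le> sum v {..<n}" using x by (intro member_le_sum) auto
      finally show "u x \<in> {..sum v {..<n}}" by simp }
    { assume x: "x \<notin> {..<n}"
      show "u x = 0" using supp_below_mono[OF assms, of u] u x by (simp add: supp_below_def) }
  qed
  thus ?thesis by (rule finite_subset) (intro finite_set_of_finite_funs finite_lessThan finite_atMost)
qed

lemma unit_vec_le_iff: "unit_vec t \<le> j \<longleftrightarrow> 0 < j t"
  by (auto simp: unit_vec_def le_fun_def)

lemma mexp_induct [consumes 1, case_names zero step]:
  assumes "supp_below n k" "Q 0"
    and "\<And>k t. supp_below n k \<Longrightarrow> t < n \<Longrightarrow> Q k \<Longrightarrow> Q (k + unit_vec t)"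
  shows "Q k"
  using assms(1)
proof (induction "mdeg k" arbitrary: k)
  case 0
  have "k = 0" using mdeg_strict_mono[OF 0(2), of 0] 0 by (metis le_fun_def le0 mdeg_zero less_irrefl zero_fun_def)
  thus ?case using assms(2) by (simp only:)
next
  case (Suc x)
  then obtain t where t: "k t \<noteq> 0" by (metis mdeg_zero nat.distinct(1) ext zero_fun_def)
  have tn: "t < n" using t Suc(3) unfolding supp_below_def by (meson linorder_not_less)
  have le: "unit_vec t \<le> k" using t by (simp add: unit_vec_le_iff)
  have e: "k = (k - unit_vec t) + unit_vec t"
    using le by (auto simp: le_fun_def fun_eq_iff)
  have s: "supp_below n (k - unit_vec t)" using Suc by simp
  have "mdeg (k - unit_vec t) = x"
    using mdeg_minus[OF Suc(3) le] Suc(2) by simp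
  thus ?case using Suc(1)[OF _ s] assms(3)[OF s tn] e by simp
qed

section \<open>Binomial coefficients of multi-indices\<close>

lemma gbin_eq: assumes "supp_below n j"
  shows "gbin k j = (\<Prod>i<n. of_int (k i) gchoose j i :: 'k::field_char_0)"
  unfolding gbin_def using assms
  by (intro prod.mono_neutral_left) (auto simp: supp_below_def not_less[symmetric])

lemma gbin_ints: assumes "supp_below n j"
  shows "(gbin (ints l) j :: 'k::field_char_0) = (\<Prod>i<n. of_nat (l i choose j i))"
  by (simp add: gbin_eq[OF assms] binomial_gbinomial)

lemma gbin_zero [simp]: "gbin k 0 = 1"
  by (simp add: gbin_def)

text \<open>At a nonnegative exponent the binomial coefficient cuts the Leibniz sum off. At a
  negative one, which in a well-formed operator only \<open>\<partial>_n\<close> can have, it never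
  vanishes; hence the sign condition on the single coordinate.\<close>

lemma gbin_nonzeroD:
  assumes "(gbin k j :: 'k::field_char_0) \<noteq> 0" "supp_below n j" "0 \<le> k i" shows "int (j i) \<le> k i"
proof (cases "i < n")
  case True
  have "(of_int (k i) gchoose j i :: 'k) \<noteq> 0"
    using assms(1) True unfolding gbin_eq[OF assms(2)] by (simp add: prod_zero_iff)
  moreover have "(of_int (k i) :: 'k) = of_nat (nat (k i))" using assms(3) by simp
  ultimately have "(of_nat (nat (k i) choose j i) :: 'k) \<noteq> 0"
    by (metis binomial_gbinomial)
  hence "j i \<le> nat (k i)" by (metis binomial_eq_0 linorder_not_less of_nat_0)
  thus ?thesis using assms(3) by linarith
qed (use assms in \<open>auto simp: supp_below_def\<close>)

lemma gbin_ints_nonzeroD: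
  assumes "(gbin (ints l) j :: 'k::field_char_0) \<noteq> 0" "supp_below n j"
  shows "j \<le> l"
  using gbin_nonzeroD[OF assms] by (auto simp: le_fun_def)

section \<open>Powers of the derivations\<close>

lemma prod_split_at:
  fixes f :: "nat \<Rightarrow> 'a::comm_monoid_mult"
  assumes "t < n" shows "(\<Prod>i<n. f i) = f t * (\<Prod>i\<in>{..<n} - {t}. f i)"
  using assms by (simp add: prod.remove)

text \<open>Only the factor at \<open>t\<close> changes, and there the ordinary Pascal rule applies.
  The case \<open>j t = 0\<close> is kept apart because truncated subtraction would give
  \<open>j - unit_vec t = j\<close>.\<close>

lemma gbin_Pascal:
  assumes "t < n" "supp_below n j"
  shows "(gbin (ints (l + unit_vec t)) j :: 'k::field_char_0) =
    gbin (ints l) j + (if 0 < j t then gbin (ints l) (j - unit_vec t) else 0)"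
proof -
  define C where "C = (\<Prod>i\<in>{..<n}-{t}. of_nat (l i choose j i) :: 'k)"
  have C1: "(\<Prod>i\<in>{..<n}-{t}. of_nat ((l + unit_vec t) i choose j i)) = C"
    unfolding C_def by (intro prod.cong) (auto simp: unit_vec_def)
  have C2: "(\<Prod>i\<in>{..<n}-{t}. of_nat (l i choose (j - unit_vec t) i)) = C"
    unfolding C_def by (intro prod.cong) (auto simp: unit_vec_def)
  have s: "supp_below n (j - unit_vec t)" using assms by simp
  show ?thesis
    unfolding gbin_ints[OF assms(2)] gbin_ints[OF s] prod_split_at[OF assms(1)] C1 C2 C_def[symmetric]
    by (cases "j t") (auto simp: unit_vec_def algebra_simps)
qed

lemma mfact_eq: assumes "supp_below n j" shows "mfact j = (\<Prod>i<n. fact (j i) :: 'k::field_char_0)"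
  unfolding mfact_def using assms
  by (intro prod.mono_neutral_left) (auto simp: supp_below_def not_less[symmetric])

lemma mfact_nonzero [simp]: "mfact j \<noteq> (0::'k::field_char_0)"
proof (cases "finite {i. j i \<noteq> 0}")
  case True thus ?thesis by (simp add: mfact_def prod_zero_iff)
next
  case False thus ?thesis by (simp add: mfact_def)
qed

lemma mfact_zero [simp]: "mfact 0 = 1"
  by (simp add: mfact_def)

lemma mfact_add_unit:
  assumes "t < n" "supp_below n j"
  shows "mfact (j + unit_vec t) = (of_nat (j t) + 1) * (mfact j :: 'k::field_char_0)"
proof -
  have "supp_below n (j + unit_vec t)" using assms by simp
  moreover have "(\<Prod>i\<in>{..<n}-{t}. fact ((j + unit_vec t) i)) = (\<Prod>i\<in>{..<n}-{t}. fact (j i) :: 'k)"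
    by (intro prod.cong) (auto simp: unit_vec_def)
  ultimately show ?thesis
    using assms by (simp add: mfact_eq[of n] prod_split_at unit_vec_def algebra_simps)
qed

text \<open>This quotient is the reason for multiplying coefficients by \<open>d!\<close>: after
  that, differentiation is a pure shift of exponents.\<close>

lemma dfac_add:
  assumes "supp_below n d" "supp_below n j"
  shows "dfac (d + j) j = (mfact (d + j) / mfact d :: 'k::field_char_0)"
proof -
  have *: "(of_nat (a + c) gchoose c) * fact c = (fact (a + c) / fact a :: 'k)" for a c
    unfolding binomial_gbinomial[symmetric] by (simp add: binomial_fact)
  have "dfac (d + j) j = (\<Prod>i<n. (of_nat ((d + j) i) gchoose (j i)) * fact (j i) :: 'k)"
    unfolding dfac_def using assms
    by (intro prod.mono_neutral_left) (auto simp: supp_below_def not_less[symmetric])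
  also have "\<dots> = (\<Prod>i<n. fact ((d + j) i) / fact (d i))"
    by (intro prod.cong) (simp_all only: plus_fun_apply *)
  finally show ?thesis using assms by (simp add: mfact_eq[of n] prod_dividef)
qed

lemma dfac_self: "dfac j j = (mfact j :: 'k::field_char_0)"
  unfolding dfac_def mfact_def
  by (intro prod.cong) (auto simp: binomial_gbinomial[symmetric])

lemma sum_below_shift:
  fixes l :: mexp
  shows "(\<Sum>j\<in>{j\<in>{..l + unit_vec t}. 0 < j t}. F j) = (\<Sum>j\<in>{..l}. F (j + unit_vec t))"
proof (rule sum.reindex_bij_witness[of _ "\<lambda>j. j + unit_vec t" "\<lambda>j. j - unit_vec t"], goal_cases)
  case (1 a)
  hence "unit_vec t \<le> a" by (simp add: unit_vec_le_iff)
  thus ?case by (auto simp: fun_eq_iff le_fun_def)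
next
  case (2 a) thus ?case by (auto simp: le_fun_def le_diff_conv)
next
  case (3 a) thus ?case by (auto simp: fun_eq_iff)
next
  case (4 a) thus ?case by (auto simp: le_fun_def unit_vec_def)
next
  case (5 a)
  hence "unit_vec t \<le> a" by (simp add: unit_vec_le_iff)
  hence "a - unit_vec t + unit_vec t = a" by (auto simp: fun_eq_iff le_fun_def)
  thus ?case by simp
qed

text \<open>For the commuting shifts \<open>T\<^sub>t : k \<mapsto> k + e\<^sub>t\<close> and \<open>G\<^sub>t : g \<mapsto> g - e\<^sub>t\<close> this is the operator
  \<open>\<Prod>\<^sub>t (T\<^sub>t + e G\<^sub>t)\<close> to the power \<open>l\<close>, applied to \<open>H\<close>.\<close>

definition shiftsum :: "'k::field_char_0 \<Rightarrow> mexp \<Rightarrow> (mexp \<Rightarrow> dexp \<Rightarrow> 'k) \<Rightarrow> mexp \<Rightarrow> dexp \<Rightarrow> 'k" where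
  "shiftsum e l H k g = (\<Sum>j\<in>{..l}. e ^ mdeg (l - j) * gbin (ints l) j
      * H (k + j) (\<lambda>i. g i - int (l i) + int (j i)))"

lemma atMost_zero_mexp: "{..(0::mexp)} = {0}"
  by (auto simp: le_fun_def fun_eq_iff)

lemma shiftsum_zero [simp]: "shiftsum e 0 H k g = H k g"
proof -
  have "(k :: mexp) + 0 = k" by (rule ext) simp
  moreover have "(0::mexp) - 0 = 0" by (rule ext) simp
  moreover have "(\<lambda>i. g i - int ((0::mexp) i) + int ((0::mexp) i)) = g" by (rule ext) simp
  moreover have "gbin (ints 0) 0 = (1::'a)" by (rule gbin_zero)
  ultimately show ?thesis unfolding shiftsum_def atMost_zero_mexp by simp
qed

text \<open>Pascal's rule splits the coefficient of each \<open>j\<close>. The part with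
  \<open>j - unit_vec t\<close> is reindexed and gives the summand with \<open>T_t\<close>. The
  other part vanishes unless \<open>j \<le> l\<close>, and then its power of \<open>e\<close> is one
  higher, which gives the summand with \<open>e G_t\<close>.\<close>

lemma shiftsum_step:
  assumes t: "t < n" and l: "supp_below n l"
  shows "shiftsum e (l + unit_vec t) H k g =
    shiftsum e l H (k + unit_vec t) g + e * shiftsum e l H k (\<lambda>i. g i - int (unit_vec t i))"
proof -
  let ?u = "unit_vec t"
  have l': "supp_below n (l + ?u)" using assms by simp
  define X where "X = (\<lambda>j. e ^ mdeg (l + ?u - j) * H (k + j) (\<lambda>i. g i - int ((l + ?u) i) + int (j i)))"
  have fin: "finite {..l + ?u}" by (rule finite_below[OF l'])
  have "shiftsum e (l + ?u) H k g = (\<Sum>j\<in>{..l + ?u}. gbin (ints l) j * X j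
     + (if 0 < j t then gbin (ints l) (j - ?u) * X j else 0))"
    unfolding shiftsum_def X_def
  proof (intro sum.cong refl, goal_cases)
    case (1 j)
    hence "supp_below n j" using supp_below_mono[OF l'] by simp
    from gbin_Pascal[OF t this, of l, where 'k='a] show ?case by (simp add: algebra_simps)
  qed
  also have "\<dots> = (\<Sum>j\<in>{..l + ?u}. gbin (ints l) j * X j)
       + (\<Sum>j\<in>{..l + ?u}. if 0 < j t then gbin (ints l) (j - ?u) * X j else 0)"
    by (rule sum.distrib)
  also have "(\<Sum>j\<in>{..l + ?u}. gbin (ints l) j * X j) = (\<Sum>j\<in>{..l}. gbin (ints l) j * X j)"
  proof (rule sum.mono_neutral_right[OF fin])
    show "{..l} \<subseteq> {..l + ?u}" by (auto simp: le_fun_def intro: trans_le_add1)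
    show "\<forall>j\<in>{..l + ?u} - {..l}. gbin (ints l) j * X j = 0"
    proof
      fix j assume j: "j \<in> {..l + ?u} - {..l}"
      hence "supp_below n j" using supp_below_mono[OF l'] by simp
      thus "gbin (ints l) j * X j = 0" using gbin_ints_nonzeroD[of l j n] j by auto
    qed
  qed
  also have "(\<Sum>j\<in>{..l}. gbin (ints l) j * X j) = e * shiftsum e l H k (\<lambda>i. g i - int (?u i))"
    unfolding shiftsum_def sum_distrib_left
  proof (intro sum.cong refl, goal_cases)
    case (1 j)
    hence jl: "j \<le> l" by simp
    have j: "supp_below n (l - j)" using l by simp
    have "l + ?u - j = (l - j) + ?u" using jl by (auto simp: fun_eq_iff le_fun_def)
    hence "mdeg (l + ?u - j) = Suc (mdeg (l - j))" using mdeg_add[OF j, of ?u] t by simp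
    moreover have "(\<lambda>i. g i - int ((l + ?u) i) + int (j i)) = (\<lambda>i. g i - int (?u i) - int (l i) + int (j i))"
      by (rule ext) simp
    ultimately show ?case by (simp add: X_def algebra_simps)
  qed
  also have "(\<Sum>j\<in>{..l + ?u}. if 0 < j t then gbin (ints l) (j - ?u) * X j else 0)
      = (\<Sum>j\<in>{j\<in>{..l + ?u}. 0 < j t}. gbin (ints l) (j - ?u) * X j)"
    using fin by (rule sum.inter_filter[symmetric])
  also have "\<dots> = (\<Sum>j\<in>{..l}. gbin (ints l) j * X (j + ?u))"
  proof -
    have "j + ?u - ?u = j" for j by (rule ext) simp
    thus ?thesis by (simp only: sum_below_shift)
  qed
  also have "\<dots> = shiftsum e l H (k + ?u) g"
    unfolding shiftsum_def
  proof (intro sum.cong refl, goal_cases)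
    case (1 j)
    have "l + ?u - (j + ?u) = l - j" by (rule ext) simp
    moreover have "k + ?u + j = k + (j + ?u)" by (rule ext) simp
    moreover have "(\<lambda>i. g i - int ((l + ?u) i) + int ((j + ?u) i)) = (\<lambda>i. g i - int (l i) + int (j i))"
      by (rule ext) simp
    ultimately show ?case by (simp add: X_def algebra_simps)
  qed
  finally show ?thesis by (rule trans[OF _ add.commute])
qed

text \<open>Binomial inversion: \<open>T\<^sub>t = (T\<^sub>t + e G\<^sub>t) - e G\<^sub>t\<close>.\<close>

lemma shiftsum_inversion:
  assumes "supp_below n k" "supp_below n d"
  shows "shiftsum e k (\<lambda>d. shiftsum (- e) d H 0) d g = shiftsum (- e) d H k (g::dexp)"
  using assms
proof (induction k arbitrary: d g rule: mexp_induct)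
  case zero show ?case by (rule shiftsum_zero)
next
  case (step k t)
  have s: "supp_below n (d + unit_vec t)" using step by simp
  have "shiftsum e (k + unit_vec t) (\<lambda>d. shiftsum (- e) d H 0) d g =
     shiftsum (- e) (d + unit_vec t) H k g + e * shiftsum (- e) d H k (\<lambda>i. g i - int (unit_vec t i))"
    unfolding shiftsum_step[OF step(2,1)] step.IH[OF s] step.IH[OF step(4)] by simp
  also have "\<dots> = shiftsum (- e) d H (k + unit_vec t) g"
    by (simp add: shiftsum_step[OF step(2) step(4)])
  finally show ?case .
qed

text \<open>\<open>Dpow l P\<close> is \<open>\<partial>\<^sup>l \<circ> P\<close> and \<open>Dstep t P\<close> is \<open>\<partial>\<^sub>t \<circ> P\<close>; on the coefficients multiplied by \<open>d!\<close> the
  latter acts as \<open>T\<^sub>t + G\<^sub>t\<close>.\<close>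

definition Dpow :: "mexp \<Rightarrow> 'k::field_char_0 op \<Rightarrow> 'k op" where
  "Dpow l P b d g = shiftsum 1 l (\<lambda>d g. mfact d * P b d g) d g / mfact d"

lemma Dpow_zero [simp]: "Dpow 0 P = P"
  by (intro ext) (simp add: Dpow_def)

definition Dstep :: "nat \<Rightarrow> 'k::field_char_0 op \<Rightarrow> 'k op" where
  "Dstep t P b d g = (of_nat (d t) + 1) * P b (d + unit_vec t) g + P b d (\<lambda>i. g i - int (unit_vec t i))"

lemma Dpow_step:
  assumes "t < n" "supp_below n l" "supp_below n d"
  shows "Dpow (l + unit_vec t) P b d g = Dstep t (Dpow l P) b d g"
proof -
  have "mfact (d + unit_vec t) = (of_nat (d t) + 1) * (mfact d :: 'a)"
    by (rule mfact_add_unit[OF assms(1,3)])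
  moreover have "(of_nat (d t) + 1 :: 'a) \<noteq> 0"
    using of_nat_neq_0[of "d t", where 'a='a] by (simp add: add.commute)
  ultimately show ?thesis
    by (simp add: Dpow_def Dstep_def shiftsum_step[OF assms(1,2)] add_divide_distrib)
qed

text \<open>Undoing the normalisation by \<open>d!\<close> turns the shifts back into the Leibniz
  formula, in the shape used by \<open>op_term\<close>.\<close>

lemma Dpow_eq:
  assumes "supp_below n l" "supp_below n d"
  shows "Dpow l P b d g = (\<Sum>j\<in>{..l}. gbin (ints l) j * P b (d + j) (\<lambda>i. g i - int (l i) + int (j i)) * dfac (d + j) j)"
  unfolding Dpow_def shiftsum_def sum_divide_distrib
proof (intro sum.cong refl, goal_cases)
  case (1 j)
  hence "supp_below n j" using assms supp_below_mono by auto
  thus ?case using assms by (simp add: dfac_add[of n])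
qed

section \<open>Orders and composition\<close>

abbreviation tdeg :: "mexp \<Rightarrow> mexp \<Rightarrow> dexp \<Rightarrow> int" where
  "tdeg b d k \<equiv> ddeg k - int (mdeg b) - int (mdeg d)"

lemma op_ord_le_iff: "op_ord P \<le> ereal (of_int c) \<longleftrightarrow> ordle P c"
proof -
  have "op_ord P \<le> ereal (of_int c) \<longleftrightarrow>
     (\<forall>b d k. P b d k \<noteq> 0 \<longrightarrow> ereal (of_int (tdeg b d k)) \<le> ereal (of_int c))"
    unfolding op_ord_def Sup_le_iff by blast
  thus ?thesis unfolding ordle_def by (simp del: of_int_diff)
qed

lemma op_ord_finite_iff: "op_ord P < \<infinity> \<longleftrightarrow> (\<exists>c. ordle P c)"
proof
  assume "op_ord P < \<infinity>"
  hence "\<exists>x::real. op_ord P \<le> ereal x"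
    by (cases "op_ord P") (auto intro: exI[of _ 0])
  then obtain x where x: "op_ord P \<le> ereal x" ..
  have "ereal x \<le> ereal (of_int \<lceil>x\<rceil>)" by simp
  hence "op_ord P \<le> ereal (of_int \<lceil>x\<rceil>)" using x by (rule order_trans[rotated])
  thus "\<exists>c. ordle P c" unfolding op_ord_le_iff by blast
next
  assume "\<exists>c. ordle P c"
  then obtain c where "op_ord P \<le> ereal (of_int c)" unfolding op_ord_le_iff[symmetric] by blast
  thus "op_ord P < \<infinity>" by (rule le_less_trans) simp
qed

lemma ordle_mono: "ordle P c \<Longrightarrow> c \<le> c' \<Longrightarrow> ordle P c'"
  unfolding ordle_def by (meson order_trans)

lemma ordleD: "ordle P c \<Longrightarrow> P b d k \<noteq> 0 \<Longrightarrow> tdeg b d k \<le> c"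
  unfolding ordle_def by blast

text \<open>The gap between \<open>c\<close> and a degree is a natural number, so some term has the
  least gap: the supremum in the order is a maximum.\<close>

lemma ordle_max_attained:
  assumes "ordle P c" "P b d k \<noteq> 0"
  shows "\<exists>b d k r. ordle P r \<and> P b d k \<noteq> 0 \<and> tdeg b d k = r"
proof -
  define X where "X = {(b, d, k). P b d k \<noteq> 0}"
  define f where "f = (\<lambda>(b, d, k). nat (c - tdeg b d k))"
  have "(b, d, k) \<in> X" using assms(2) by (simp add: X_def)
  from ex_has_least_nat[of "\<lambda>z. z \<in> X", OF this, of f]
  obtain z where z: "z \<in> X" "\<And>y. y \<in> X \<Longrightarrow> f z \<le> f y" by blast
  obtain b0 d0 k0 where z0: "z = (b0, d0, k0)" by (cases z)
  have nz: "P b0 d0 k0 \<noteq> 0" using z(1) by (simp add: X_def z0)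
  have "ordle P (tdeg b0 d0 k0)" unfolding ordle_def
  proof (intro allI impI)
    fix b' d' k' assume p: "P b' d' k' \<noteq> 0"
    hence "f z \<le> f (b', d', k')" by (intro z(2)) (simp add: X_def)
    thus "tdeg b' d' k' \<le> tdeg b0 d0 k0"
      using ordleD[OF assms(1), OF nz] ordleD[OF assms(1), OF p] unfolding f_def z0 by simp
  qed
  thus ?thesis using nz by blast
qed

text \<open>The way back from integer bounds to \<open>op_ord\<close>. The bound \<open>c0\<close>
  rules out order \<infinity> for \<open>Q\<close>. If \<open>Q\<close> vanishes, \<open>P\<close>
  obeys every integer bound and must vanish as well.\<close>

lemma op_ord_mono:
  assumes "ordle Q c0" "\<And>c. ordle Q c \<Longrightarrow> ordle P c" shows "op_ord P \<le> op_ord Q"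
proof (cases "\<exists>b d k. Q b d k \<noteq> 0")
  case True
  then obtain r b d k where r: "ordle Q r" "Q b d k \<noteq> 0" "tdeg b d k = r"
    using ordle_max_attained[OF assms(1)] by blast
  have "op_ord P \<le> ereal (of_int r)" unfolding op_ord_le_iff using assms r by blast
  also have "\<dots> \<le> op_ord Q" unfolding op_ord_def using r(2,3) by (intro Sup_upper) blast
  finally show ?thesis .
next
  case False
  hence *: "ordle P c" for c using assms(2)[of c] by (auto simp: ordle_def)
  have "P b d k = 0" for b d k
  proof (rule ccontr)
    assume "P b d k \<noteq> 0"
    from ordleD[OF *[of "tdeg b d k - 1"], OF this] show False by linarith
  qed
  thus ?thesis by (simp add: op_ord_def)
qed

lemma wf_opD:
  assumes "wf_op m n P" "P b d k \<noteq> 0"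
  shows "supp_below m b" "supp_below n d" "supp_below n k" "i + 1 < n \<Longrightarrow> 0 \<le> k i"
  using assms unfolding wf_op_def supp_below_def by simp_all

text \<open>This covers infinite contribution sets too, where the sum is 0 by convention, so
  supports and orders of products can be estimated before convergence is discussed.\<close>

lemma op_comp_nonzero:
  assumes P: "wf_op m n P" and Q: "wf_op m n Q" and nz: "op_comp P Q b d g \<noteq> 0"
  obtains b1 d1 k j where "b1 \<le> b" "d1 \<le> d" "P b1 d1 k \<noteq> 0" "gbin k j \<noteq> (0::'k::field_char_0)"
    "Q (b - b1) (d - d1 + j) (\<lambda>i. g i - k i + int (j i)) \<noteq> (0::'k)" "supp_below n j"
proof -
  have "\<exists>x. x \<in> {(b1, d1, k, j). b1 \<le> b \<and> d1 \<le> d \<and> op_term P Q b d g (b1, d1, k, j) \<noteq> 0}"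
    using nz unfolding op_comp_def by (rule contrapos_np) (simp only: ex_in_conv not_not sum.empty)
  then obtain b1 d1 k j where *: "b1 \<le> b" "d1 \<le> d" "op_term P Q b d g (b1, d1, k, j) \<noteq> 0" by auto
  have q: "Q (b - b1) (d - d1 + j) (\<lambda>i. g i - k i + int (j i)) \<noteq> 0"
    using *(3) by (auto simp: op_term_def)
  have "supp_below n j" using wf_opD(2)[OF Q, OF q] by (simp add: supp_below_def)
  thus ?thesis using that[of b1 d1 k j] * q by (auto simp: op_term_def)
qed

text \<open>A derivation that acts on the coefficient of \<open>Q\<close> uses up one \<partial> and
  one x. The two losses cancel in the degree, so degrees add in every term of the Leibniz
  formula.\<close>

lemma term_degree:
  assumes P: "wf_op m n P" and Q: "wf_op m n Q" and le: "b1 \<le> b" "d1 \<le> d"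
    and p: "P b1 d1 k \<noteq> 0" and q: "Q (b - b1) (d - d1 + j) (\<lambda>i. g i - k i + int (j i)) \<noteq> 0"
  shows "supp_below m b" "supp_below n d" "supp_below n g" "supp_below n j"
    "tdeg b d g = tdeg b1 d1 k + tdeg (b - b1) (d - d1 + j) (\<lambda>i. g i - k i + int (j i))"
proof -
  note p' = wf_opD[OF P, OF p] and q' = wf_opD[OF Q, OF q]
  show j: "supp_below n j" using q'(2) by (simp add: supp_below_def)
  have eb: "b1 + (b - b1) = b" using le(1) by (auto simp: fun_eq_iff le_fun_def)
  have ed: "d1 + (d - d1 + j) = d + j"
  proof
    fix i show "(d1 + (d - d1 + j)) i = (d + j) i" using le_funD[OF le(2), of i] by simp
  qed
  show b: "supp_below m b" using supp_below_add[OF p'(1) q'(1)] unfolding eb .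
  have "supp_below n (d + j)" using supp_below_add[OF p'(2) q'(2)] unfolding ed .
  thus d: "supp_below n d" by (simp add: supp_below_def)
  show g: "supp_below n g" using p'(3) q'(3) j unfolding supp_below_def by force
  have 1: "mdeg b = mdeg b1 + mdeg (b - b1)" using mdeg_add[OF p'(1) q'(1)] unfolding eb .
  have 2: "mdeg d + mdeg j = mdeg d1 + mdeg (d - d1 + j)"
    using mdeg_add[OF p'(2) q'(2)] mdeg_add[OF d j] unfolding ed by simp
  have 3: "ddeg (\<lambda>i. g i - k i + int (j i)) = ddeg g - ddeg k + int (mdeg j)"
    unfolding ddeg_eq[OF q'(3)] ddeg_eq[OF p'(3)] ddeg_eq[OF g] mdeg_eq[OF j]
    by (simp add: sum.distrib sum_subtractf)
  show "tdeg b d g = tdeg b1 d1 k + tdeg (b - b1) (d - d1 + j) (\<lambda>i. g i - k i + int (j i))"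
    using 1 2 3 by linarith
qed

lemma wf_op_comp:
  assumes "wf_op m n P" "wf_op m n Q" shows "wf_op m n (op_comp P Q)"
  unfolding wf_op_def
proof (intro allI impI)
  fix b d g assume nz: "op_comp P Q b d g \<noteq> 0"
  obtain b1 d1 k j where *: "b1 \<le> b" "d1 \<le> d" "P b1 d1 k \<noteq> 0" "gbin k j \<noteq> (0::'a)"
    "Q (b - b1) (d - d1 + j) (\<lambda>i. g i - k i + int (j i)) \<noteq> 0" "supp_below n j"
    using op_comp_nonzero[OF assms, OF nz] .
  have "0 \<le> g i" if "i + 1 < n" for i
    using wf_opD(4)[OF assms(2), OF *(5) that] wf_opD(4)[OF assms(1), OF *(3) that]
      gbin_nonzeroD[OF *(4,6)] by force
  thus "(\<forall>i\<ge>m. b i = 0) \<and> (\<forall>i\<ge>n. d i = 0) \<and> (\<forall>i\<ge>n. g i = 0) \<and> (\<forall>i. i + 1 < n \<longrightarrow> 0 \<le> g i)"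
    using term_degree[OF assms, OF *(1,2,3,5)] by (auto simp: supp_below_def)
qed

lemma ordle_op_comp:
  assumes "wf_op m n P" "wf_op m n Q" "ordle P c" "ordle Q c'"
  shows "ordle (op_comp P Q) (c + c')"
  unfolding ordle_def
proof (intro allI impI)
  fix b d g assume nz: "op_comp P Q b d g \<noteq> 0"
  obtain b1 d1 k j where *: "b1 \<le> b" "d1 \<le> d" "P b1 d1 k \<noteq> 0" "gbin k j \<noteq> (0::'a)"
    "Q (b - b1) (d - d1 + j) (\<lambda>i. g i - k i + int (j i)) \<noteq> 0" "supp_below n j"
    using op_comp_nonzero[OF assms(1,2), OF nz] .
  show "tdeg b d g \<le> c + c'"
    using term_degree(5)[OF assms(1,2), OF *(1,2,3,5)] ordleD[OF assms(3), OF *(3)] ordleD[OF assms(4), OF *(5)]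
    by linarith
qed

lemma Dsym_iff: "P \<in> Dsym m n \<longleftrightarrow>
   wf_op m n P \<and> (\<forall>b d k. P b d k \<noteq> 0 \<longrightarrow> k (n - 1) \<ge> 0) \<and> (\<exists>c. ordle P c)"
  unfolding Dsym_def op_ord_finite_iff by simp

lemma Pihat_iff: "P \<in> Pihat m n \<longleftrightarrow> wf_op m n P \<and> (\<exists>c. ordle P c)"
  unfolding Pihat_def op_ord_finite_iff by simp

lemma Dsym_Pihat: "P \<in> Dsym m n \<Longrightarrow> P \<in> Pihat m n"
  by (simp add: Dsym_iff Pihat_iff)

lemma Pihat_comp: "P \<in> Pihat m n \<Longrightarrow> Q \<in> Pihat m n \<Longrightarrow> op_comp P Q \<in> Pihat m n"
  unfolding Pihat_iff using wf_op_comp ordle_op_comp by blast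

lemma Dsym_nonneg:
  assumes "L \<in> Dsym m n" "L b d k \<noteq> 0" "1 \<le> n" shows "0 \<le> k i"
proof -
  have L: "wf_op m n L" "0 \<le> k (n - 1)" using assms unfolding Dsym_iff by auto
  consider "i + 1 < n" | "i = n - 1" | "n \<le> i" using assms(3) by linarith
  thus ?thesis
  proof cases
    case 3
    thus ?thesis using wf_opD(3)[OF L(1), OF assms(2)] by (simp add: supp_below_def)
  qed (use L wf_opD(4)[OF L(1), OF assms(2)] in auto)
qed

lemma Dsym_comp: 
  assumes "1 \<le> n" "L \<in> Dsym m n" "M \<in> Dsym m n" shows "op_comp L M \<in> Dsym m n"
proof -
  have wf: "wf_op m n L" "wf_op m n M" using assms by (auto simp: Dsym_iff)
  have "0 \<le> g (n - 1)" if nz: "op_comp L M b d g \<noteq> 0" for b d g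
  proof -
    obtain b1 d1 k j where *: "b1 \<le> b" "d1 \<le> d" "L b1 d1 k \<noteq> 0" "gbin k j \<noteq> (0::'a)"
      "M (b - b1) (d - d1 + j) (\<lambda>i. g i - k i + int (j i)) \<noteq> 0" "supp_below n j"
      using op_comp_nonzero[OF wf, OF nz] .
    show ?thesis
      using gbin_nonzeroD[OF *(4,6), of "n - 1"] Dsym_nonneg[OF assms(2), OF *(3) assms(1), of "n - 1"]
        Dsym_nonneg[OF assms(3), OF *(5) assms(1), of "n - 1"] by linarith
  qed
  thus ?thesis using Pihat_comp[OF assms(2,3)[THEN Dsym_Pihat]] unfolding Dsym_iff Pihat_iff by blast
qed

lemma sum_Sigma4:
  assumes "finite A" "finite B" "finite C" "\<And>z. z \<in> C \<Longrightarrow> finite (D z)"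
  shows "(\<Sum>(x, y, z, w)\<in>(SIGMA x:A. SIGMA y:B. SIGMA z:C. D z). f x y z w) =
    (\<Sum>x\<in>A. \<Sum>y\<in>B. \<Sum>z\<in>C. \<Sum>w\<in>D z. f x y z w)"
proof -
  have 1: "finite (Sigma C D)" using assms by (intro finite_SigmaI)
  have 2: "finite (SIGMA y:B. Sigma C D)" using assms 1 by (intro finite_SigmaI)
  have "(\<Sum>x\<in>A. \<Sum>y\<in>B. \<Sum>z\<in>C. \<Sum>w\<in>D z. f x y z w)
      = (\<Sum>x\<in>A. \<Sum>y\<in>B. \<Sum>(z, w)\<in>Sigma C D. f x y z w)"
    using assms by (intro sum.cong refl sum.Sigma) auto
  also have "\<dots> = (\<Sum>x\<in>A. \<Sum>(y, z, w)\<in>(SIGMA y:B. Sigma C D). f x y z w)"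
    using assms 1 by (intro sum.cong refl sum.Sigma) auto
  also have "\<dots> = (\<Sum>(x, y, z, w)\<in>(SIGMA x:A. SIGMA y:B. SIGMA z:C. D z). f x y z w)"
    using assms 2 by (intro sum.Sigma) auto
  finally show ?thesis by (rule sym)
qed

text \<open>A term of \<open>L\<close> that contributes at \<open>b\<close>, \<open>d\<close> has y-
  and x-exponents below these, so its order bound limits \<open>|l|\<close> by \<open>r\<close> and
  \<open>l\<close> lies in the box. Any larger \<open>r\<close> also works, which lets several
  products share one box. The inner sum over \<open>j\<close> is collected into
  \<open>\<partial>^l \<circ> P\<close>.\<close>

lemma op_comp_Dsym:
  assumes n: "1 \<le> n" and L: "L \<in> Dsym m n" and P: "wf_op m n P" and c: "ordle L c"
    and b: "supp_below m b" and d: "supp_below n d" and r: "c + int (mdeg b) + int (mdeg d) \<le> int r"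
  shows "op_comp L P b d g = (\<Sum>b1\<in>{..b}. \<Sum>d1\<in>{..d}. \<Sum>l\<in>{..box n r}.
     L b1 d1 (ints l) * Dpow l P (b - b1) (d - d1) g)"
proof -
  have Lw: "wf_op m n L" using L by (simp add: Dsym_iff)
  let ?t = "op_term L P b d g"
  let ?T = "{(b1, d1, k, j). b1 \<le> b \<and> d1 \<le> d \<and> ?t (b1, d1, k, j) \<noteq> 0}"
  let ?I = "SIGMA b1:{..b}. SIGMA d1:{..d}. SIGMA l:{..box n r}. {..l}"
  let ?f = "\<lambda>(b1, d1, l, j). (b1, d1, ints l, j)"
  have fl: "finite {..l}" if "l \<in> {..box n r}" for l
    using finite_below[OF supp_below_mono[OF supp_below_box]] that by auto
  have fin: "finite ?I" 
    by (intro finite_SigmaI finite_below[OF b] finite_below[OF d] finite_below[OF supp_below_box] fl)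
  have inj: "inj_on ?f ?I" by (auto simp: inj_on_def fun_eq_iff)
  have sub: "?T \<subseteq> ?f ` ?I"
  proof clarify
    fix b1 d1 k j assume *: "b1 \<le> b" "d1 \<le> d" "?t (b1, d1, k, j) \<noteq> 0"
    have l: "L b1 d1 k \<noteq> 0" and p: "P (b - b1) (d - d1 + j) (\<lambda>i. g i - k i + int (j i)) \<noteq> 0"
      and gb: "gbin k j \<noteq> (0::'a)" using *(3) by (auto simp: op_term_def)
    have k: "0 \<le> k i" for i by (rule Dsym_nonneg[OF L, OF l n])
    have ks: "supp_below n k" by (rule wf_opD(3)[OF Lw, OF l])
    define l' where "l' = (\<lambda>i. nat (k i))"
    have kl: "k = ints l'" using k by (auto simp: l'_def)
    have ls: "supp_below n l'" using ks by (simp add: supp_below_def l'_def)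
    have "supp_below n j" by (rule term_degree(4)[OF Lw P, OF *(1,2) l p])
    hence j: "j \<le> l'" using gbin_ints_nonzeroD[of l' j n] gb kl by auto
    have "tdeg b1 d1 k \<le> c" by (rule ordleD[OF c, OF l])
    hence "int (mdeg l') \<le> int r" 
      using r mdeg_mono[OF b *(1)] mdeg_mono[OF d *(2)] ddeg_ints[OF ls] kl by simp
    hence "mdeg l' \<le> r" by simp
    have "l' \<le> box n r" by (rule le_box_mdeg[OF ls \<open>mdeg l' \<le> r\<close>])
    hence "(b1, d1, l', j) \<in> ?I" using * j by simp
    thus "(b1, d1, k, j) \<in> ?f ` ?I" unfolding kl by (intro image_eqI) auto
  qed
  have "op_comp L P b d g = sum ?t (?f ` ?I)"
    unfolding op_comp_def using fin sub by (intro sum.mono_neutral_left finite_imageI) auto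
  also have "\<dots> = (\<Sum>x\<in>?I. ?t (?f x))" by (subst sum.reindex[OF inj]) simp
  also have "\<dots> = (\<Sum>(b1, d1, l, j)\<in>?I. ?t (b1, d1, ints l, j))"
    by (intro sum.cong) auto
  also have "\<dots> = (\<Sum>b1\<in>{..b}. \<Sum>d1\<in>{..d}. \<Sum>l\<in>{..box n r}. \<Sum>j\<in>{..l}. ?t (b1, d1, ints l, j))"
    by (intro sum_Sigma4 finite_below[OF b] finite_below[OF d] finite_below[OF supp_below_box] fl)
  also have "\<dots> = (\<Sum>b1\<in>{..b}. \<Sum>d1\<in>{..d}. \<Sum>l\<in>{..box n r}.
     L b1 d1 (ints l) * Dpow l P (b - b1) (d - d1) g)"
  proof (intro sum.cong refl, goal_cases)
    case (1 b1 d1 l)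
    have "supp_below n l" using 1 supp_below_mono[OF supp_below_box] by auto
    moreover have "supp_below n (d - d1)" using d by simp
    ultimately show ?case
      by (simp add: Dpow_eq[of n] op_term_def sum_distrib_left mult.assoc)
  qed
  finally show ?thesis .
qed

section \<open>Associativity\<close>

lemma not_le_add_unit:
  assumes "j \<le> l + unit_vec t" "\<not> j \<le> (l::mexp)" shows "j t = l t + 1"
proof -
  obtain i where i: "\<not> j i \<le> l i" using assms(2) by (auto simp: le_fun_def)
  thus ?thesis using le_funD[OF assms(1), of i] by (cases "i = t") (auto simp: unit_vec_def)
qed

text \<open>The product rule for the derivative by \<open>x_t\<close>, read off at
  \<open>x^d\<close>: the factor \<open>d t + 1\<close> is split into the exponent
  \<open>d1 t\<close> of the first factor and the exponent \<open>d t + 1 - d1 t\<close> of the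
  second.\<close>

lemma leibniz_sum:
  fixes x y :: "mexp \<Rightarrow> 'k::field_char_0"
  assumes t: "t < n" and d: "supp_below n d"
  shows "(of_nat (d t) + 1) * (\<Sum>d1\<in>{..d + unit_vec t}. x d1 * y (d + unit_vec t - d1)) =
    (\<Sum>d1\<in>{..d}. (of_nat (d1 t) + 1) * x (d1 + unit_vec t) * y (d - d1))
    + (\<Sum>d1\<in>{..d}. (of_nat ((d - d1) t) + 1) * x d1 * y (d - d1 + unit_vec t))"
proof -
  let ?u = "unit_vec t"
  have d': "supp_below n (d + ?u)" using assms by simp
  note fin = finite_below[OF d']
  have "(of_nat (d t) + 1) * (\<Sum>d1\<in>{..d + ?u}. x d1 * y (d + ?u - d1)) =
     (\<Sum>d1\<in>{..d + ?u}. of_nat (d1 t) * x d1 * y (d + ?u - d1)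
        + of_nat (d t + 1 - d1 t) * x d1 * y (d + ?u - d1))"
    unfolding sum_distrib_left
  proof (intro sum.cong refl, goal_cases)
    case (1 d1)
    hence "d1 t \<le> d t + 1" using le_funD[of d1 "d + ?u" t] by (simp add: unit_vec_def)
    hence "(of_nat (d t) + 1 :: 'k) = of_nat (d1 t) + of_nat (d t + 1 - d1 t)"
      by (simp add: of_nat_diff)
    thus ?case by (simp only: ring_distribs mult.assoc)
  qed
  also have "\<dots> = (\<Sum>d1\<in>{..d + ?u}. of_nat (d1 t) * x d1 * y (d + ?u - d1))
     + (\<Sum>d1\<in>{..d + ?u}. of_nat (d t + 1 - d1 t) * x d1 * y (d + ?u - d1))"
    by (rule sum.distrib)
  also have "(\<Sum>d1\<in>{..d + ?u}. of_nat (d1 t) * x d1 * y (d + ?u - d1))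
     = (\<Sum>d1\<in>{j\<in>{..d + ?u}. 0 < j t}. of_nat (d1 t) * x d1 * y (d + ?u - d1))"
    using fin by (intro sum.mono_neutral_right) auto
  also have "\<dots> = (\<Sum>d1\<in>{..d}. (of_nat (d1 t) + 1) * x (d1 + ?u) * y (d - d1))"
    unfolding sum_below_shift
  proof (intro sum.cong refl, goal_cases)
    case (1 d1)
    have "d + ?u - (d1 + ?u) = d - d1" by (rule ext) simp
    thus ?case by (simp add: unit_vec_def algebra_simps)
  qed
  also have "(\<Sum>d1\<in>{..d + ?u}. of_nat (d t + 1 - d1 t) * x d1 * y (d + ?u - d1))
     = (\<Sum>d1\<in>{..d}. of_nat (d t + 1 - d1 t) * x d1 * y (d + ?u - d1))"
  proof (rule sum.mono_neutral_right[OF fin])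
    show "{..d} \<subseteq> {..d + ?u}" by (auto simp: le_fun_def intro: trans_le_add1)
    show "\<forall>j\<in>{..d + ?u} - {..d}. of_nat (d t + 1 - j t) * x j * y (d + ?u - j) = 0"
      using not_le_add_unit by auto
  qed
  also have "\<dots> = (\<Sum>d1\<in>{..d}. (of_nat ((d - d1) t) + 1) * x d1 * y (d - d1 + ?u))"
  proof (intro sum.cong refl, goal_cases)
    case (1 d1)
    have "d + ?u - d1 = d - d1 + ?u" using 1 by (auto simp: fun_eq_iff le_fun_def)
    moreover have "d t + 1 - d1 t = Suc ((d - d1) t)" using 1 le_funD[of d1 d t] by simp
    ultimately show ?case by (simp only: of_nat_Suc add.commute)
  qed
  finally show ?thesis .
qed

lemma tdeg_shift_x:
  assumes "supp_below n d" "t < n" shows "tdeg b (d + unit_vec t) g = tdeg b d g - 1"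
  using mdeg_add[OF assms(1) supp_below_unit[OF assms(2)]] by simp

lemma supp_below_unit_shift:
  assumes "t < n" shows "supp_below n (\<lambda>i. g i - int (unit_vec t i)) = supp_below n g"
proof -
  have "unit_vec t i = 0" if "n \<le> i" for i using assms that by (simp add: unit_vec_def)
  thus ?thesis by (simp add: supp_below_def)
qed

lemma tdeg_shift_d:
  assumes "supp_below n g" "t < n" shows "tdeg b d (\<lambda>i. g i - int (unit_vec t i)) = tdeg b d g - 1"
proof -
  have "(\<Sum>i<n. int (unit_vec t i)) = 1"
    using mdeg_eq[OF supp_below_unit[OF assms(2)]] by (simp flip: of_nat_sum)
  thus ?thesis using assms supp_below_unit_shift[OF assms(2), of g]
    by (simp add: ddeg_eq[of n] sum_subtractf)
qed

lemma Dstep_nonzero: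
  assumes "wf_op m n P" "t < n" "Dstep t P b d g \<noteq> 0"
  obtains "P b (d + unit_vec t) g \<noteq> 0" "supp_below m b" "supp_below n d" "supp_below n g"
  | "P b d (\<lambda>i. g i - int (unit_vec t i)) \<noteq> 0" "supp_below m b" "supp_below n d" "supp_below n g"
proof -
  consider "P b (d + unit_vec t) g \<noteq> 0" | "P b d (\<lambda>i. g i - int (unit_vec t i)) \<noteq> 0"
    using assms(3) unfolding Dstep_def by fastforce
  thus ?thesis
  proof cases
    case 1
    note w = wf_opD[OF assms(1), OF 1]
    have "supp_below n d" using w(2) by (simp add: supp_below_def)
    thus ?thesis using that(1)[OF 1 w(1) _ w(3)] by blast
  next
    case 2
    note w = wf_opD[OF assms(1), OF 2]
    thus ?thesis using that(2)[OF 2 w(1,2)] supp_below_unit_shift[OF assms(2), of g] by blast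
  qed
qed

lemma wf_Dstep:
  assumes "wf_op m n P" "t < n" shows "wf_op m n (Dstep t P)"
  unfolding wf_op_def
proof (intro allI impI)
  fix b d g assume nz: "Dstep t P b d g \<noteq> 0"
  have "0 \<le> g i" if i: "i + 1 < n" for i
  proof (rule Dstep_nonzero[OF assms nz])
    assume "P b (d + unit_vec t) g \<noteq> 0"
    from wf_opD(4)[OF assms(1), OF this i] show ?thesis .
  next
    assume "P b d (\<lambda>i. g i - int (unit_vec t i)) \<noteq> 0"
    from wf_opD(4)[OF assms(1), OF this i] show ?thesis by simp
  qed
  thus "(\<forall>i\<ge>m. b i = 0) \<and> (\<forall>i\<ge>n. d i = 0) \<and> (\<forall>i\<ge>n. g i = 0) \<and> (\<forall>i. i + 1 < n \<longrightarrow> 0 \<le> g i)"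
    using Dstep_nonzero[OF assms nz] unfolding supp_below_def by metis
qed

lemma ordle_Dstep:
  assumes "wf_op m n P" "t < n" "ordle P c" shows "ordle (Dstep t P) (c + 1)"
  unfolding ordle_def
proof (intro allI impI)
  fix b d g assume nz: "Dstep t P b d g \<noteq> 0"
  show "tdeg b d g \<le> c + 1"
  proof (rule Dstep_nonzero[OF assms(1,2) nz])
    assume "P b (d + unit_vec t) g \<noteq> 0" "supp_below n d"
    from ordleD[OF assms(3), OF this(1)] tdeg_shift_x[OF this(2) assms(2)] show ?thesis by fastforce
  next
    assume "P b d (\<lambda>i. g i - int (unit_vec t i)) \<noteq> 0" "supp_below n g"
    from ordleD[OF assms(3), OF this(1)] tdeg_shift_d[OF this(2) assms(2)] show ?thesis by fastforce
  qed
qed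

lemma Dstep_Dsym:
  assumes "1 \<le> n" "M \<in> Dsym m n" "t < n" shows "Dstep t M \<in> Dsym m n"
proof -
  have M: "wf_op m n M" using assms by (simp add: Dsym_iff)
  have "0 \<le> g (n - 1)" if nz: "Dstep t M b d g \<noteq> 0" for b d g
  proof (rule Dstep_nonzero[OF M assms(3) nz])
    assume "M b (d + unit_vec t) g \<noteq> 0"
    from Dsym_nonneg[OF assms(2), OF this assms(1)] show ?thesis .
  next
    assume "M b d (\<lambda>i. g i - int (unit_vec t i)) \<noteq> 0"
    from Dsym_nonneg[OF assms(2), OF this assms(1), of "n - 1"] show ?thesis by simp
  qed
  thus ?thesis using assms wf_Dstep[OF M assms(3)] ordle_Dstep[OF M assms(3)] unfolding Dsym_iff by blast
qed

lemma Dpow_step_wf: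
  assumes "wf_op m n P" "t < n" "supp_below n l"
  shows "Dpow (l + unit_vec t) P = Dstep t (Dpow l P)"
proof (intro ext)
  fix b d g
  show "Dpow (l + unit_vec t) P b d g = Dstep t (Dpow l P) b d g"
  proof (cases "supp_below n d")
    case True thus ?thesis by (rule Dpow_step[OF assms(2,3)])
  next
    case False
    have *: "P b (d + j) g = 0" for j g
    proof (rule ccontr)
      assume "P b (d + j) g \<noteq> 0"
      from wf_opD(2)[OF assms(1), OF this] False show False by (simp add: supp_below_def)
    qed
    have "d + unit_vec t + j = d + (unit_vec t + j)" for j by (rule ext) simp
    thus ?thesis by (simp add: Dstep_def Dpow_def shiftsum_def * del: plus_fun_apply)
  qed
qed

text \<open>Each derivation raises the order by at most one; the three claims share one
  induction.\<close>

lemma Dpow_props: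
  assumes "supp_below n l" "wf_op m n P"
  shows "wf_op m n (Dpow l P) \<and> (ordle P c \<longrightarrow> ordle (Dpow l P) (c + int (mdeg l)))
     \<and> (1 \<le> n \<longrightarrow> P \<in> Dsym m n \<longrightarrow> Dpow l P \<in> Dsym m n)"
  using assms(1)
proof (induction rule: mexp_induct)
  case zero show ?case using assms by simp
next
  case (step l t)
  have "c + int (mdeg (l + unit_vec t)) = c + int (mdeg l) + 1"
    using mdeg_add[OF step(1), of "unit_vec t"] step by simp
  thus ?case unfolding Dpow_step_wf[OF assms(2) step(2,1)]
    using step wf_Dstep ordle_Dstep Dstep_Dsym by metis
qed

text \<open>Shifting a truncated sum leaves boundary terms on both sides, and both kinds vanish.
  Where \<open>l t = r + 1\<close> the degree exceeds \<open>c\<close>, by the strict bound on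
  \<open>r\<close>; where \<open>l t = 0\<close> the exponent would be negative, which
  \<open>Dsym\<close> excludes.\<close>

lemma shift_box_sum:
  fixes M :: "'k::field_char_0 op"
  assumes n: "1 \<le> n" and M: "M \<in> Dsym m n" and c: "ordle M c" and t: "t < n"
    and r: "c + int (mdeg b) + int (mdeg d) < int r"
  shows "(\<Sum>l\<in>{..box n r}. M b d (\<lambda>i. int (l i) - int (unit_vec t i)) * G l)
    = (\<Sum>l\<in>{..box n r}. M b d (ints l) * G (l + unit_vec t))"
proof -
  let ?u = "unit_vec t"
  have s: "supp_below n (box n r + ?u)" using t by simp
  note fin = finite_below[OF s]
  have "(\<Sum>l\<in>{..box n r}. M b d (\<lambda>i. int (l i) - int (?u i)) * G l)
    = (\<Sum>l\<in>{..box n r + ?u}. M b d (\<lambda>i. int (l i) - int (?u i)) * G l)"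
  proof (rule sum.mono_neutral_left[OF fin])
    show "{..box n r} \<subseteq> {..box n r + ?u}" by (auto simp: le_fun_def intro: trans_le_add1)
    show "\<forall>l\<in>{..box n r + ?u} - {..box n r}. M b d (\<lambda>i. int (l i) - int (?u i)) * G l = 0"
    proof (intro ballI, rule ccontr)
      fix l assume l: "l \<in> {..box n r + ?u} - {..box n r}" and "M b d (\<lambda>i. int (l i) - int (?u i)) * G l \<noteq> 0"
      hence nz: "M b d (\<lambda>i. int (l i) - int (?u i)) \<noteq> 0" by auto
      have lt: "l t = r + 1" using not_le_add_unit[of l "box n r" t] l t by (simp add: box_def)
      have ls: "supp_below n l" using supp_below_mono[OF s] l by simp
      have "l t \<le> mdeg l" unfolding mdeg_eq[OF ls] using t by (intro member_le_sum) auto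
      moreover have "tdeg b d (\<lambda>i. int (l i) - int (?u i)) = tdeg b d (ints l) - 1"
        using ls t by (intro tdeg_shift_d) auto
      ultimately show False using ordleD[OF c, OF nz] r lt ddeg_ints[OF ls] by linarith
    qed
  qed
  also have "\<dots> = (\<Sum>l\<in>{j\<in>{..box n r + ?u}. 0 < j t}. M b d (\<lambda>i. int (l i) - int (?u i)) * G l)"
  proof (rule sum.mono_neutral_right[OF fin])
    show "\<forall>l\<in>{..box n r + ?u} - {j\<in>{..box n r + ?u}. 0 < j t}. M b d (\<lambda>i. int (l i) - int (?u i)) * G l = 0"
    proof (intro ballI, rule ccontr)
      fix l assume l: "l \<in> {..box n r + ?u} - {j\<in>{..box n r + ?u}. 0 < j t}"
        and "M b d (\<lambda>i. int (l i) - int (?u i)) * G l \<noteq> 0"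
      hence nz: "M b d (\<lambda>i. int (l i) - int (?u i)) \<noteq> 0" by auto
      from Dsym_nonneg[OF M, OF nz n, of t] l show False by (simp add: unit_vec_def)
    qed
  qed auto
  also have "\<dots> = (\<Sum>l\<in>{..box n r}. M b d (ints l) * G (l + ?u))"
    unfolding sum_below_shift by simp
  finally show ?thesis .
qed

lemma op_comp_outside:
  assumes "wf_op m n P" "wf_op m n Q" "\<not> (supp_below m b \<and> supp_below n d)"
  shows "op_comp P Q b d g = 0"
  using wf_opD[OF wf_op_comp[OF assms(1,2)], of b d g] assms(3) by blast

text \<open>\<open>\<partial>_t \<circ> M\<close> differentiates the coefficients of
  \<open>M\<close> and raises the exponent of \<open>\<partial>_t\<close>. The raised exponent turns
  \<open>\<partial>^l \<circ> P\<close> into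
  \<open>\<partial>_t \<circ> (\<partial>^l \<circ> P)\<close>, whose differentiated coefficients
  join those of \<open>M\<close> by the product rule.\<close>

lemma Dstep_comp:
  assumes n: "1 \<le> n" and M: "M \<in> Dsym m n" and P: "wf_op m n P" and t: "t < n"
  shows "Dstep t (op_comp M P) = op_comp (Dstep t M) P"
proof (intro ext)
  fix b d g
  let ?u = "unit_vec t"
  have Mw: "wf_op m n M" using M by (simp add: Dsym_iff)
  have DM: "Dstep t M \<in> Dsym m n" by (rule Dstep_Dsym[OF n M t])
  have DMw: "wf_op m n (Dstep t M)" using DM by (simp add: Dsym_iff)
  show "Dstep t (op_comp M P) b d g = op_comp (Dstep t M) P b d g"
  proof (cases "supp_below m b \<and> supp_below n d")
    case False
    thus ?thesis
      using op_comp_outside[OF DMw P False] wf_opD[OF wf_Dstep[OF wf_op_comp[OF Mw P] t], of b d g]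
      by fastforce
  next
    case True
    hence b: "supp_below m b" and d: "supp_below n d" by auto
    have d': "supp_below n (d + ?u)" using d t by simp
    obtain c where c: "ordle M c" using M by (auto simp: Dsym_iff)
    have c1: "ordle (Dstep t M) (c + 1)" by (rule ordle_Dstep[OF Mw t c])
    \<comment> \<open>One radius for three expansions: evaluating at \<open>d + unit_vec t\<close>
      costs one unit more than at \<open>d\<close>, and so does the order \<open>c + 1\<close> of
      \<open>Dstep t M\<close>.\<close>
    define r where "r = nat (c + int (mdeg b) + int (mdeg d) + 2)"
    have md: "mdeg (d + ?u) = mdeg d + 1" using mdeg_add[OF d, of ?u] t by simp
    have r1: "c + int (mdeg b) + int (mdeg (d + ?u)) \<le> int r"
      and r2: "c + int (mdeg b) + int (mdeg d) \<le> int r"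
      and r3: "c + 1 + int (mdeg b) + int (mdeg d) \<le> int r" unfolding r_def md by linarith+
    let ?B = "{..box n r}"
    define E where "E = (\<lambda>b1 l e h. Dpow l P (b - b1) e h)"
    have inner: "(\<Sum>l\<in>?B. M b1 d1 (\<lambda>i. int (l i) - int (?u i)) * E b1 l (d - d1) g)
        = (\<Sum>l\<in>?B. M b1 d1 (ints l) * ((of_nat ((d - d1) t) + 1) * E b1 l (d - d1 + ?u) g
              + E b1 l (d - d1) (\<lambda>i. g i - int (?u i))))" if "b1 \<le> b" "d1 \<le> d" for b1 d1
    proof -
      have "c + int (mdeg b1) + int (mdeg d1) < int r"
        using that mdeg_mono[OF b, of b1] mdeg_mono[OF d, of d1] r3 by simp
      from shift_box_sum[OF n M c t this, of "\<lambda>l. E b1 l (d - d1) g"]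
      have "(\<Sum>l\<in>?B. M b1 d1 (\<lambda>i. int (l i) - int (?u i)) * E b1 l (d - d1) g)
         = (\<Sum>l\<in>?B. M b1 d1 (ints l) * E b1 (l + ?u) (d - d1) g)" .
      also have "\<dots> = (\<Sum>l\<in>?B. M b1 d1 (ints l) * ((of_nat ((d - d1) t) + 1) * E b1 l (d - d1 + ?u) g
              + E b1 l (d - d1) (\<lambda>i. g i - int (?u i))))"
      proof (intro sum.cong refl arg_cong2[where f = "(*)"], goal_cases)
        case (1 l)
        hence "supp_below n l" using supp_below_mono[OF supp_below_box] by auto
        from Dpow_step_wf[OF P t this] show ?case by (simp add: E_def Dstep_def)
      qed
      finally show ?thesis .
    qed
    have "op_comp (Dstep t M) P b d g = (\<Sum>b1\<in>{..b}. \<Sum>d1\<in>{..d}. \<Sum>l\<in>?B. Dstep t M b1 d1 (ints l) * E b1 l (d - d1) g)"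
      unfolding op_comp_Dsym[OF n DM P c1 b d r3] E_def ..
    also have "\<dots> = (\<Sum>b1\<in>{..b}. (\<Sum>d1\<in>{..d}. \<Sum>l\<in>?B. (of_nat (d1 t) + 1) * M b1 (d1 + ?u) (ints l) * E b1 l (d - d1) g)
        + (\<Sum>d1\<in>{..d}. \<Sum>l\<in>?B. M b1 d1 (\<lambda>i. int (l i) - int (?u i)) * E b1 l (d - d1) g))"
      by (simp add: Dstep_def ring_distribs sum.distrib)
    also have "\<dots> = (\<Sum>b1\<in>{..b}. (\<Sum>d1\<in>{..d}. \<Sum>l\<in>?B. (of_nat (d1 t) + 1) * M b1 (d1 + ?u) (ints l) * E b1 l (d - d1) g)
        + (\<Sum>d1\<in>{..d}. \<Sum>l\<in>?B. M b1 d1 (ints l) * ((of_nat ((d - d1) t) + 1) * E b1 l (d - d1 + ?u) g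
              + E b1 l (d - d1) (\<lambda>i. g i - int (?u i)))))"
      by (rule sum.cong[OF refl], rule arg_cong2[where f = "(+)", OF refl], rule sum.cong[OF refl], rule inner) auto
    also have "\<dots> = (\<Sum>b1\<in>{..b}. (\<Sum>l\<in>?B. (\<Sum>d1\<in>{..d}. (of_nat (d1 t) + 1) * M b1 (d1 + ?u) (ints l) * E b1 l (d - d1) g)
        + (\<Sum>d1\<in>{..d}. (of_nat ((d - d1) t) + 1) * M b1 d1 (ints l) * E b1 l (d - d1 + ?u) g))
        + (\<Sum>d1\<in>{..d}. \<Sum>l\<in>?B. M b1 d1 (ints l) * E b1 l (d - d1) (\<lambda>i. g i - int (?u i))))"
    proof (intro sum.cong refl, goal_cases)
      case (1 b1)
      show ?case unfolding sum.distrib ring_distribs(1) sum.swap[of _ "?B" "{..d}"]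
        by (simp only: mult.assoc mult.left_commute add.assoc)
    qed
    also have "\<dots> = (\<Sum>b1\<in>{..b}. (\<Sum>l\<in>?B. (of_nat (d t) + 1) * (\<Sum>d1\<in>{..d + ?u}. M b1 d1 (ints l) * E b1 l (d + ?u - d1) g))
        + (\<Sum>d1\<in>{..d}. \<Sum>l\<in>?B. M b1 d1 (ints l) * E b1 l (d - d1) (\<lambda>i. g i - int (?u i))))"
      by (simp only: leibniz_sum[OF t d, of "\<lambda>d1. M b1 d1 (ints l)" "\<lambda>e. E b1 l e g" for b1 l])
    also have "\<dots> = (of_nat (d t) + 1) * op_comp M P b (d + ?u) g + op_comp M P b d (\<lambda>i. g i - int (?u i))"
      unfolding op_comp_Dsym[OF n M P c b d' r1] op_comp_Dsym[OF n M P c b d r2] E_def sum.distrib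
        sum_distrib_left sum.swap[of _ "?B" "{..d + ?u}"] ..
    finally show ?thesis by (simp add: Dstep_def)
  qed
qed

text \<open>Associativity with left factor \<open>\<partial>^k\<close>. It reduces a general left
  factor to this case via \<open>op_comp_Dsym\<close>, and it relates the slices of
  \<open>M \<circ> P\<close> to those of \<open>M\<close>.\<close>

lemma Dpow_comp:
  assumes n: "1 \<le> n" and M: "M \<in> Dsym m n" and P: "wf_op m n P" and k: "supp_below n k"
  shows "Dpow k (op_comp M P) = op_comp (Dpow k M) P"
  using k
proof (induction rule: mexp_induct)
  case zero show ?case by simp
next
  case (step k t)
  have Mw: "wf_op m n M" using M by (simp add: Dsym_iff)
  have "Dpow k M \<in> Dsym m n" using Dpow_props[OF step(1) Mw] n M by blast
  thus ?case
    unfolding Dpow_step_wf[OF Mw step(2,1)] Dpow_step_wf[OF wf_op_comp[OF Mw P] step(2,1)] step.IH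
    by (rule Dstep_comp[OF n _ P step(2)])
qed

text \<open>Regroups by the total exponent \<open>c = a + e\<close>, as in a Cauchy product.\<close>

lemma sum_triangle:
  assumes "supp_below m (b::mexp)"
  shows "(\<Sum>a\<in>{..b}. \<Sum>e\<in>{..b - a}. G a e) = (\<Sum>c\<in>{..b}. \<Sum>a\<in>{..c}. G a (c - a))"
proof -
  have f: "finite {..c}" if "c \<in> {..b}" for c using finite_below[OF supp_below_mono[OF assms]] that by auto
  have f': "finite {..b - a}" for a using finite_below assms supp_below_minus by blast
  have "(\<Sum>(a, e)\<in>(SIGMA a:{..b}. {..b - a}). G a e) = (\<Sum>(c, a)\<in>(SIGMA c:{..b}. {..c}). G a (c - a))"
  proof (rule sum.reindex_bij_witness[of _ "\<lambda>(c, a). (a, c - a)" "\<lambda>(a, e). (a + e, a)"], goal_cases)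
    case (1 x) thus ?case by (auto simp: fun_eq_iff)
  next
    case (2 x)
    obtain a e where x: "x = (a, e)" by (cases x)
    have "a i + e i \<le> b i" for i using 2 le_funD[of a b i] le_funD[of e "b - a" i] x by simp
    thus ?case by (auto simp: x le_fun_def)
  next
    case (3 x) thus ?case by (auto simp: fun_eq_iff le_fun_def)
  next
    case (4 x)
    obtain c a where x: "x = (c, a)" by (cases x)
    have "a i \<le> b i \<and> c i - a i \<le> b i - a i" for i using 4 le_funD[of a c i] le_funD[of c b i] x by simp
    thus ?case by (auto simp: x le_fun_def)
  next
    case (5 x)
    obtain a e where x: "x = (a, e)" by (cases x)
    have "a + e - a = e" by (rule ext) simp
    thus ?case by (simp add: x)
  qed
  moreover have "(\<Sum>a\<in>{..b}. \<Sum>e\<in>{..b - a}. G a e) = (\<Sum>(a, e)\<in>(SIGMA a:{..b}. {..b - a}). G a e)"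
    using f' finite_below[OF assms] by (intro sum.Sigma) auto
  moreover have "(\<Sum>c\<in>{..b}. \<Sum>a\<in>{..c}. G a (c - a)) = (\<Sum>(c, a)\<in>(SIGMA c:{..b}. {..c}). G a (c - a))"
    using f finite_below[OF assms] by (intro sum.Sigma) auto
  ultimately show ?thesis by simp
qed

text \<open>Expanding \<open>L\<close> produces \<open>\<partial>^l \<circ> (M \<circ> P) =
  (\<partial>^l \<circ> M) \<circ> P\<close>. A second expansion leaves finite sums only, which are
  regrouped by the total y- and x-exponents of \<open>L\<close> and
  \<open>\<partial>^l \<circ> M\<close>.\<close>

lemma op_comp_assoc:
  assumes n: "1 \<le> n" and L: "L \<in> Dsym m n" and M: "M \<in> Dsym m n" and P: "wf_op m n P"
  shows "op_comp L (op_comp M P) = op_comp (op_comp L M) P"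
proof (intro ext)
  fix b d g
  have Lw: "wf_op m n L" and Mw: "wf_op m n M" using L M by (auto simp: Dsym_iff)
  have LM: "op_comp L M \<in> Dsym m n" by (rule Dsym_comp[OF n L M])
  have LMw: "wf_op m n (op_comp L M)" and MPw: "wf_op m n (op_comp M P)"
    using wf_op_comp Lw Mw P by blast+
  show "op_comp L (op_comp M P) b d g = op_comp (op_comp L M) P b d g"
  proof (cases "supp_below m b \<and> supp_below n d")
    case False
    thus ?thesis using op_comp_outside[OF Lw MPw False] op_comp_outside[OF LMw P False] by simp
  next
    case True
    hence b: "supp_below m b" and d: "supp_below n d" by auto
    obtain c where c: "ordle L c" using L by (auto simp: Dsym_iff)
    obtain e where e: "ordle M e" using M by (auto simp: Dsym_iff)
    define r where "r = nat (c + int (mdeg b) + int (mdeg d))"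
    define B where "B = mdeg (box n r)"
    \<comment> \<open>The inner box has to serve \<open>\<partial>^l \<circ> M\<close> for all
      \<open>l\<close> in the outer box, of order at most \<open>e + B\<close>, and also
      \<open>L \<circ> M\<close>, of order at most \<open>c + e\<close>.\<close>
    define q where "q = nat (max (e + int B) (c + e) + int (mdeg b) + int (mdeg d))"
    let ?R = "{..box n r}" and ?Q = "{..box n q}"
    define T where "T = (\<lambda>b1 b2 d1 d2. \<Sum>l\<in>?R. \<Sum>k\<in>?Q. L b1 d1 (ints l) * Dpow l M b2 d2 (ints k)
        * Dpow k P (b - (b1 + b2)) (d - (d1 + d2)) g)"
    have r: "c + int (mdeg b) + int (mdeg d) \<le> int r" by (simp add: r_def)
    have lhs: "op_comp (Dpow l M) P (b - b1) (d - d1) g = (\<Sum>b2\<in>{..b - b1}. \<Sum>d2\<in>{..d - d1}. \<Sum>k\<in>?Q.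
       Dpow l M b2 d2 (ints k) * Dpow k P (b - (b1 + b2)) (d - (d1 + d2)) g)"
      if "b1 \<le> b" "d1 \<le> d" "l \<le> box n r" for b1 d1 l
    proof -
      have l: "supp_below n l" using supp_below_mono[OF supp_below_box that(3)] .
      have DM: "Dpow l M \<in> Dsym m n" and o: "ordle (Dpow l M) (e + int (mdeg l))"
        using Dpow_props[OF l Mw] n M e by blast+
      have "mdeg l \<le> B" unfolding B_def by (rule mdeg_mono[OF supp_below_box that(3)])
      hence "e + int (mdeg l) + int (mdeg (b - b1)) + int (mdeg (d - d1)) \<le> int q"
        using mdeg_minus[OF b that(1)] mdeg_minus[OF d that(2)] unfolding q_def by linarith
      from op_comp_Dsym[OF n DM P o supp_below_minus[OF b] supp_below_minus[OF d] this]
      show ?thesis by (simp only: diff_diff_eq)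
    qed
    have "op_comp L (op_comp M P) b d g = (\<Sum>b1\<in>{..b}. \<Sum>d1\<in>{..d}. \<Sum>l\<in>?R.
       L b1 d1 (ints l) * op_comp (Dpow l M) P (b - b1) (d - d1) g)"
      unfolding op_comp_Dsym[OF n L MPw c b d r]
    proof (intro sum.cong refl, goal_cases)
      case (1 b1 d1 l)
      hence "supp_below n l" using supp_below_mono[OF supp_below_box] by auto
      thus ?case by (simp only: Dpow_comp[OF n M P])
    qed
    also have "\<dots> = (\<Sum>b1\<in>{..b}. \<Sum>d1\<in>{..d}. \<Sum>l\<in>?R. \<Sum>b2\<in>{..b - b1}. \<Sum>d2\<in>{..d - d1}. \<Sum>k\<in>?Q.
       L b1 d1 (ints l) * Dpow l M b2 d2 (ints k) * Dpow k P (b - (b1 + b2)) (d - (d1 + d2)) g)"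
      by (intro sum.cong refl) (simp add: lhs sum_distrib_left mult.assoc)
    also have "\<dots> = (\<Sum>b1\<in>{..b}. \<Sum>d1\<in>{..d}. \<Sum>b2\<in>{..b - b1}. \<Sum>d2\<in>{..d - d1}. T b1 b2 d1 d2)"
      unfolding T_def by (subst (2) sum.swap, subst (3) sum.swap) simp
    also have "\<dots> = (\<Sum>b3\<in>{..b}. \<Sum>b1\<in>{..b3}. \<Sum>d3\<in>{..d}. \<Sum>d1\<in>{..d3}. T b1 (b3 - b1) d1 (d3 - d1))"
    proof -
      have "(\<Sum>b1\<in>{..b}. \<Sum>d1\<in>{..d}. \<Sum>b2\<in>{..b - b1}. \<Sum>d2\<in>{..d - d1}. T b1 b2 d1 d2)
        = (\<Sum>b1\<in>{..b}. \<Sum>b2\<in>{..b - b1}. \<Sum>d1\<in>{..d}. \<Sum>d2\<in>{..d - d1}. T b1 b2 d1 d2)"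
        by (rule sum.cong[OF refl], rule sum.swap)
      also have "\<dots> = (\<Sum>b1\<in>{..b}. \<Sum>b2\<in>{..b - b1}. \<Sum>d3\<in>{..d}. \<Sum>d1\<in>{..d3}. T b1 b2 d1 (d3 - d1))"
        by (simp only: sum_triangle[OF d])
      also have "\<dots> = (\<Sum>b3\<in>{..b}. \<Sum>b1\<in>{..b3}. \<Sum>d3\<in>{..d}. \<Sum>d1\<in>{..d3}. T b1 (b3 - b1) d1 (d3 - d1))"
        by (rule sum_triangle[OF b])
      finally show ?thesis .
    qed
    also have "\<dots> = (\<Sum>b3\<in>{..b}. \<Sum>d3\<in>{..d}. \<Sum>b1\<in>{..b3}. \<Sum>d1\<in>{..d3}. T b1 (b3 - b1) d1 (d3 - d1))"
      by (rule sum.cong[OF refl], rule sum.swap)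
    also have "\<dots> = (\<Sum>b3\<in>{..b}. \<Sum>d3\<in>{..d}. \<Sum>k\<in>?Q. op_comp L M b3 d3 (ints k) * Dpow k P (b - b3) (d - d3) g)"
    proof (rule sum.cong[OF refl], rule sum.cong[OF refl], goal_cases)
      case (1 b3 d3)
      hence b3: "b3 \<le> b" and d3: "d3 \<le> d" by auto
      have s: "supp_below m b3" "supp_below n d3" using supp_below_mono b d b3 d3 by blast+
      have r': "c + int (mdeg b3) + int (mdeg d3) \<le> int r"
        using r mdeg_mono[OF b b3] mdeg_mono[OF d d3] by linarith
      have eq: "b1 + (b3 - b1) = b3" if "b1 \<le> b3" for b1 b3 :: mexp
        using that by (auto simp: fun_eq_iff le_fun_def)
      have "(\<Sum>b1\<in>{..b3}. \<Sum>d1\<in>{..d3}. T b1 (b3 - b1) d1 (d3 - d1)) = 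
         (\<Sum>b1\<in>{..b3}. \<Sum>d1\<in>{..d3}. \<Sum>k\<in>?Q. \<Sum>l\<in>?R. L b1 d1 (ints l) * Dpow l M (b3 - b1) (d3 - d1) (ints k)
        * Dpow k P (b - b3) (d - d3) g)"
        unfolding T_def by (subst sum.swap[of _ "?R" "?Q"], intro sum.cong refl) (simp only: eq atMost_iff)
      also have "\<dots> = (\<Sum>k\<in>?Q. \<Sum>b1\<in>{..b3}. \<Sum>d1\<in>{..d3}. \<Sum>l\<in>?R. L b1 d1 (ints l) * Dpow l M (b3 - b1) (d3 - d1) (ints k)
        * Dpow k P (b - b3) (d - d3) g)"
        by (subst sum.swap[of _ "?Q" "{..d3}"], rule sum.swap)
      also have "\<dots> = (\<Sum>k\<in>?Q. op_comp L M b3 d3 (ints k) * Dpow k P (b - b3) (d - d3) g)"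
        unfolding op_comp_Dsym[OF n L Mw c s r'] sum_distrib_right ..
      finally show ?case .
    qed
    also have "\<dots> = op_comp (op_comp L M) P b d g"
    proof (rule op_comp_Dsym[OF n LM P ordle_op_comp[OF Lw Mw c e] b d, symmetric])
      show "c + e + int (mdeg b) + int (mdeg d) \<le> int q" unfolding q_def by linarith
    qed
    finally show ?thesis .
  qed
qed

section \<open>Right factors with coefficients free of x\<close>

definition const_op :: "'k::zero op \<Rightarrow> bool" where
  "const_op f \<longleftrightarrow> (\<forall>b d k. f b d k \<noteq> 0 \<longrightarrow> d = 0)"

text \<open>The counterpart of \<open>box\<close> for integer exponents: negative powers of
  \<open>\<partial>_n\<close> must be caught as well.\<close>

definition ibox :: "nat \<Rightarrow> nat \<Rightarrow> dexp set" where
  "ibox n R = {u. \<forall>i. (i \<in> {..<n} \<longrightarrow> u i \<in> {- int R..int R}) \<and> (i \<notin> {..<n} \<longrightarrow> u i = 0)}"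

lemma finite_ibox [simp]: "finite (ibox n R)"
  unfolding ibox_def by (intro finite_set_of_finite_funs) auto

text \<open>The exponents of the other derivations are nonnegative, so that of
  \<open>\<partial>_n\<close> is at most the total degree in the derivations.\<close>

lemma exponent_bounds:
  assumes "1 \<le> n" "wf_op m n Q" "ordle Q c" "Q b d k \<noteq> 0"
  shows "k (n - 1) \<le> c + int (mdeg b) + int (mdeg d)"
proof -
  note w = wf_opD[OF assms(2), OF assms(4)]
  have "(\<Sum>i<n. k i) = (\<Sum>i<n - 1. k i) + k (n - 1)"
    using assms(1) by (metis Suc_diff_1 Suc_le_lessD One_nat_def lessThan_Suc sum.lessThan_Suc)
  moreover have "0 \<le> (\<Sum>i<n - 1. k i)" using w(4) by (intro sum_nonneg) auto
  ultimately have "k (n - 1) \<le> ddeg k" using ddeg_eq[OF w(3)] by linarith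
  thus ?thesis using ordleD[OF assms(3), OF assms(4)] by linarith
qed

text \<open>The exponents \<open>u\<close> and \<open>g - u\<close> of two factors have the fixed
  sum \<open>g\<close>. Below the last coordinate both are nonnegative, hence at most
  \<open>g\<close>. In the last one an upper bound for either is a lower bound for the
  other.\<close>

lemma factor_in_ibox:
  assumes n: "1 \<le> n" and u: "supp_below n u"
    and lo: "\<And>i. i + 1 < n \<Longrightarrow> 0 \<le> u i \<and> u i \<le> g i"
    and hi: "u (n - 1) \<le> A" "g (n - 1) - u (n - 1) \<le> A"
    and R: "\<bar>A\<bar> + (\<Sum>i<n. \<bar>g i\<bar>) \<le> int R"
  shows "u \<in> ibox n R"
  unfolding ibox_def
proof (intro CollectI allI conjI impI)
  fix i assume i: "i \<in> {..<n}"
  have g: "\<bar>g i\<bar> \<le> (\<Sum>i<n. \<bar>g i\<bar>)" using i by (intro member_le_sum) auto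
  show "u i \<in> {- int R..int R}"
  proof (cases "i + 1 < n")
    case True thus ?thesis using lo[OF True] g R by auto
  next
    case False
    hence "i = n - 1" using i by auto
    thus ?thesis using hi g R by auto
  qed
qed (use u in \<open>auto simp: supp_below_def\<close>)

lemma dfac_zero [simp]: "dfac d 0 = 1"
  by (simp add: dfac_def)

text \<open>Since \<open>f\<close> is free of x, only \<open>j = 0\<close> and \<open>d1 = d\<close>
  contribute and the product is a convolution. The sufficient radius depends on \<open>b\<close>,
  \<open>d\<close> and \<open>g\<close>; with "eventually", finitely many such expansions can be
  given a common radius.\<close>

lemma op_comp_const:
  assumes n: "1 \<le> n" and P: "P \<in> Pihat m n" and f: "f \<in> Pihat m n" "const_op f"
    and b: "supp_below m b"
  shows "\<forall>\<^sub>F R in sequentially. op_comp P f b d g =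
    (\<Sum>b2\<in>{..b}. \<Sum>u\<in>ibox n R. f b2 0 u * P (b - b2) d (\<lambda>i. g i - u i))"
proof -
  obtain c where Pw: "wf_op m n P" and c: "ordle P c" using P by (auto simp: Pihat_iff)
  obtain e where fw: "wf_op m n f" and e: "ordle f e" using f by (auto simp: Pihat_iff)
  define A where "A = \<bar>c\<bar> + \<bar>e\<bar> + int (mdeg b) + int (mdeg d)"
  define R0 where "R0 = nat (\<bar>A\<bar> + (\<Sum>i<n. \<bar>g i\<bar>))"
  let ?t = "op_term P f b d g"
  let ?T = "{(b1, d1, k, j). b1 \<le> b \<and> d1 \<le> d \<and> ?t (b1, d1, k, j) \<noteq> 0}"
  let ?f = "\<lambda>(b2, u). (b - b2, d, \<lambda>i. g i - u i, 0::mexp)"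
  have minus2: "b - (b - b2) = b2" if "b2 \<le> b" for b2
    using that by (auto simp: fun_eq_iff le_fun_def)
  have "op_comp P f b d g = (\<Sum>b2\<in>{..b}. \<Sum>u\<in>ibox n R. f b2 0 u * P (b - b2) d (\<lambda>i. g i - u i))"
    if "R0 \<le> R" for R
  proof -
    let ?I = "{..b} \<times> ibox n R"
    have inj: "inj_on ?f ?I"
    proof (rule inj_onI, clarify, goal_cases)
      case (1 b2 u b2' u')
      have "b2 = b2'" using minus2[of b2] minus2[of b2'] 1 by (metis atMost_iff)
      moreover have "u = u'"
      proof
        fix i show "u i = u' i" using fun_cong[OF 1(6), of i] by simp
      qed
      ultimately show ?case by simp
    qed
    have sub: "?T \<subseteq> ?f ` ?I"
    proof clarify
      fix b1 d1 k j assume *: "b1 \<le> b" "d1 \<le> d" "?t (b1, d1, k, j) \<noteq> 0"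
      have p: "P b1 d1 k \<noteq> 0" and q: "f (b - b1) (d - d1 + j) (\<lambda>i. g i - k i + int (j i)) \<noteq> 0"
        using *(3) by (auto simp: op_term_def)
      have z: "d - d1 + j = 0" using q f(2) unfolding const_op_def by blast
      have j: "j = 0" using z by (auto simp: fun_eq_iff)
      have d1: "d1 = d"
      proof
        fix i show "d1 i = d i" using fun_cong[OF z, of i] le_funD[OF *(2), of i] by simp
      qed
      define u where "u = (\<lambda>i. g i - k i)"
      have q': "f (b - b1) 0 u \<noteq> 0" using q unfolding z unfolding j by (simp add: u_def)
      have p': "P b1 d k \<noteq> 0" using p d1 by simp
      have "u \<in> ibox n R"
      proof (rule factor_in_ibox[OF n])
        show "supp_below n u" by (rule wf_opD(3)[OF fw, OF q'])
        show "0 \<le> u i \<and> u i \<le> g i" if "i + 1 < n" for i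
          using wf_opD(4)[OF fw, OF q' that] wf_opD(4)[OF Pw, OF p' that] by (simp add: u_def)
        show "u (n - 1) \<le> A"
          using exponent_bounds[OF n fw e, OF q'] mdeg_minus[OF b *(1)] unfolding A_def by simp
        show "g (n - 1) - u (n - 1) \<le> A"
          using exponent_bounds[OF n Pw c, OF p'] mdeg_mono[OF b *(1)] unfolding A_def u_def by simp
        show "\<bar>A\<bar> + (\<Sum>i<n. \<bar>g i\<bar>) \<le> int R" using that unfolding R0_def by linarith
      qed
      moreover have "b - b1 \<in> {..b}" by (simp add: le_fun_def)
      moreover have "(b1, d1, k, j) = ?f (b - b1, u)"
        using minus2[OF *(1)] j d1 by (simp add: u_def)
      ultimately show "(b1, d1, k, j) \<in> ?f ` ?I" by (intro image_eqI[of _ _ "(b - b1, u)"]) auto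
    qed
    have fin: "finite ?I" using finite_below[OF b] by simp
    have le: "b - b2 \<le> b" for b2 by (simp add: le_fun_def)
    have "op_comp P f b d g = sum ?t (?f ` ?I)"
      unfolding op_comp_def using fin sub le by (intro sum.mono_neutral_left finite_imageI) auto
    also have "\<dots> = (\<Sum>x\<in>?I. ?t (?f x))" by (subst sum.reindex[OF inj]) simp
    also have "\<dots> = (\<Sum>(b2, u)\<in>?I. f b2 0 u * P (b - b2) d (\<lambda>i. g i - u i))"
    proof (intro sum.cong refl, clarify, goal_cases)
      case (1 b2 u)
      have "d - d + 0 = (0::mexp)" by (rule ext) simp
      thus ?case using minus2[of b2] 1 by (simp add: op_term_def)
    qed
    also have "\<dots> = (\<Sum>b2\<in>{..b}. \<Sum>u\<in>ibox n R. f b2 0 u * P (b - b2) d (\<lambda>i. g i - u i))"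
      by (rule sum.cartesian_product[symmetric])
    finally show ?thesis .
  qed
  thus ?thesis unfolding eventually_sequentially by blast
qed

lemma const_op_comp:
  assumes "const_op f" "const_op g" shows "const_op (op_comp f g)"
  unfolding const_op_def
proof (intro allI impI, rule ccontr)
  fix b d k assume nz: "op_comp f g b d k \<noteq> 0" "d \<noteq> 0"
  have "op_term f g b d k (b1, d1, l, j) = 0" if "d1 \<le> d" for b1 d1 l j
  proof (rule ccontr)
    assume "op_term f g b d k (b1, d1, l, j) \<noteq> 0"
    hence p: "f b1 d1 l \<noteq> 0" and q: "g (b - b1) (d - d1 + j) (\<lambda>i. k i - l i + int (j i)) \<noteq> 0"
      by (auto simp: op_term_def)
    have "d1 = 0" "d - d1 + j = 0" using assms p q unfolding const_op_def by blast+
    hence "d = 0" by (auto simp: fun_eq_iff)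
    thus False using nz by simp
  qed
  hence empty: "{(b1, d1, l, j). b1 \<le> b \<and> d1 \<le> d \<and> op_term f g b d k (b1, d1, l, j) \<noteq> 0} = {}" by blast
  show False using nz(1) unfolding op_comp_def empty by simp
qed

lemma eventually_sequentially_obtain:
  assumes "\<forall>\<^sub>F R in sequentially. Q R" obtains R :: nat where "Q R"
  using assms unfolding eventually_sequentially by blast

text \<open>\<open>\<partial>^l\<close> acts by finitely many shifts of the exponents of
  \<open>P\<close>, right multiplication by \<open>f\<close> by a convolution. With one radius for
  all these shifts the two finite sums can be interchanged.\<close>

lemma Dpow_const:
  assumes n: "1 \<le> n" and P: "P \<in> Pihat m n" and f: "f \<in> Pihat m n" "const_op f"
    and b: "supp_below m b" and d: "supp_below n d" and l: "supp_below n l"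
  shows "Dpow l (op_comp P f) b d g = op_comp (Dpow l P) f b d g"
proof -
  have DP: "Dpow l P \<in> Pihat m n" using Dpow_props[OF l] P unfolding Pihat_iff by blast
  define s where "s = (\<lambda>j. \<lambda>i. g i - int (l i) + int (j i))"
  have "\<forall>\<^sub>F R in sequentially. op_comp (Dpow l P) f b d g =
    (\<Sum>b2\<in>{..b}. \<Sum>u\<in>ibox n R. f b2 0 u * Dpow l P (b - b2) d (\<lambda>i. g i - u i))"
    by (rule op_comp_const[OF n DP f b])
  moreover have "\<forall>\<^sub>F R in sequentially. \<forall>j\<in>{..l}. op_comp P f b (d + j) (s j) =
    (\<Sum>b2\<in>{..b}. \<Sum>u\<in>ibox n R. f b2 0 u * P (b - b2) (d + j) (\<lambda>i. s j i - u i))"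
    by (intro eventually_ball_finite finite_below[OF l] ballI op_comp_const[OF n P f b])
  ultimately have "\<forall>\<^sub>F R in sequentially. Dpow l (op_comp P f) b d g = op_comp (Dpow l P) f b d g"
  proof eventually_elim
    case (elim R)
    have s: "(\<lambda>i. g i - int (l i) + int (j i)) = s j" for j by (simp add: s_def)
    have sh: "(\<lambda>i. g i - u i - int (l i) + int (j i)) = (\<lambda>i. s j i - u i)" for u j
      by (rule ext) (simp add: s_def)
    have "Dpow l (op_comp P f) b d g = (\<Sum>j\<in>{..l}. gbin (ints l) j *
       (\<Sum>b2\<in>{..b}. \<Sum>u\<in>ibox n R. f b2 0 u * P (b - b2) (d + j) (\<lambda>i. s j i - u i)) * dfac (d + j) j)"
      unfolding Dpow_eq[OF l d] s using elim(2) by (intro sum.cong refl) simp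
    also have "\<dots> = (\<Sum>b2\<in>{..b}. \<Sum>u\<in>ibox n R. \<Sum>j\<in>{..l}. gbin (ints l) j *
       (f b2 0 u * P (b - b2) (d + j) (\<lambda>i. s j i - u i)) * dfac (d + j) j)"
      unfolding sum_distrib_left sum_distrib_right
      by (subst sum.swap, rule sum.cong[OF refl], rule sum.swap)
    also have "\<dots> = (\<Sum>b2\<in>{..b}. \<Sum>u\<in>ibox n R. f b2 0 u * Dpow l P (b - b2) d (\<lambda>i. g i - u i))"
      unfolding Dpow_eq[OF l d] sh sum_distrib_left by (intro sum.cong refl) (simp only: ac_simps)
    also have "\<dots> = op_comp (Dpow l P) f b d g" using elim(1) by simp
    finally show ?case .
  qed
  thus ?thesis by (rule eventually_sequentially_obtain)
qed

lemma sum_triangle_swap: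
  assumes "supp_below m (b::mexp)"
  shows "(\<Sum>a\<in>{..b}. \<Sum>e\<in>{..b - a}. G a e) = (\<Sum>e\<in>{..b}. \<Sum>a\<in>{..b - e}. G a e)"
proof -
  have *: "{..b - a} = {e. e \<in> {..b} \<and> a + e \<le> b}" if "a \<in> {..b}" for a
  proof (intro set_eqI)
    fix e
    have "a i \<le> b i" for i using that le_funD[of a b i] by simp
    hence "e i \<le> b i - a i \<longleftrightarrow> e i \<le> b i \<and> a i + e i \<le> b i" for i by (metis add.commute le_diff_conv2 add_leD1)
    thus "e \<in> {..b - a} \<longleftrightarrow> e \<in> {e. e \<in> {..b} \<and> a + e \<le> b}" by (auto simp: le_fun_def)
  qed
  have "(\<Sum>a\<in>{..b}. \<Sum>e\<in>{..b - a}. G a e) = (\<Sum>a\<in>{..b}. \<Sum>e\<in>{e. e \<in> {..b} \<and> a + e \<le> b}. G a e)"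
    by (rule sum.cong[OF refl]) (simp only: *)
  also have "\<dots> = (\<Sum>e\<in>{..b}. \<Sum>a\<in>{a. a \<in> {..b} \<and> a + e \<le> b}. G a e)"
    by (rule sum.swap_restrict[OF finite_below[OF assms] finite_below[OF assms]])
  also have "\<dots> = (\<Sum>e\<in>{..b}. \<Sum>a\<in>{..b - e}. G a e)"
    by (rule sum.cong[OF refl]) (simp only: * add.commute)
  finally show ?thesis .
qed

text \<open>\<open>L\<close> is expanded over a box fixed in advance and \<open>f\<close> over a
  radius large enough for all the resulting products
  \<open>(\<partial>^l \<circ> P) \<circ> f\<close>; what remains is an interchange of finite
  sums.\<close>

lemma op_comp_assoc_const:
  assumes n: "1 \<le> n" and L: "L \<in> Dsym m n" and P: "P \<in> Pihat m n" and f: "f \<in> Pihat m n" "const_op f"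
  shows "op_comp L (op_comp P f) = op_comp (op_comp L P) f"
proof (intro ext)
  fix b d g
  have Lw: "wf_op m n L" and Pw: "wf_op m n P" and fw: "wf_op m n f" using L P f by (auto simp: Dsym_iff Pihat_iff)
  have LP: "op_comp L P \<in> Pihat m n" by (rule Pihat_comp[OF Dsym_Pihat[OF L] P])
  have LPw: "wf_op m n (op_comp L P)" and Pfw: "wf_op m n (op_comp P f)"
    using wf_op_comp Lw Pw fw by blast+
  show "op_comp L (op_comp P f) b d g = op_comp (op_comp L P) f b d g"
  proof (cases "supp_below m b \<and> supp_below n d")
    case False
    thus ?thesis using op_comp_outside[OF Lw Pfw False] op_comp_outside[OF LPw fw False] by simp
  next
    case True
    hence b: "supp_below m b" and d: "supp_below n d" by auto
    obtain c where c: "ordle L c" using L by (auto simp: Dsym_iff)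
    define r where "r = nat (c + int (mdeg b) + int (mdeg d))"
    let ?R = "{..box n r}"
    have r: "c + int (mdeg b) + int (mdeg d) \<le> int r" by (simp add: r_def)
    have ls: "supp_below n l" if "l \<in> ?R" for l using that supp_below_mono[OF supp_below_box] by auto
    have bs: "supp_below m (b - b1)" and ds: "supp_below n (d - d1)" for b1 d1 using b d by auto
    have "\<forall>\<^sub>F Q in sequentially. op_comp (op_comp L P) f b d g =
        (\<Sum>b2\<in>{..b}. \<Sum>u\<in>ibox n Q. f b2 0 u * op_comp L P (b - b2) d (\<lambda>i. g i - u i))"
      by (rule op_comp_const[OF n LP f b])
    moreover have "\<forall>\<^sub>F Q in sequentially. \<forall>b1\<in>{..b}. \<forall>d1\<in>{..d}. \<forall>l\<in>?R. op_comp (Dpow l P) f (b - b1) (d - d1) g =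
        (\<Sum>b2\<in>{..b - b1}. \<Sum>u\<in>ibox n Q. f b2 0 u * Dpow l P (b - b1 - b2) (d - d1) (\<lambda>i. g i - u i))"
    proof (intro eventually_ball_finite ballI finite_below[OF b] finite_below[OF d] finite_below[OF supp_below_box]
        op_comp_const[OF n _ f bs], goal_cases)
      case (1 b1 d1 l)
      show ?case using Dpow_props[OF ls[OF 1(3)]] P unfolding Pihat_iff by blast
    qed
    ultimately have "\<forall>\<^sub>F Q in sequentially. op_comp L (op_comp P f) b d g = op_comp (op_comp L P) f b d g"
    proof eventually_elim
      case (elim Q)
      let ?Q = "ibox n Q"
      define G where "G = (\<lambda>b1 b2. \<Sum>d1\<in>{..d}. \<Sum>l\<in>?R. \<Sum>u\<in>?Q. L b1 d1 (ints l) *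
         (f b2 0 u * Dpow l P (b - (b1 + b2)) (d - d1) (\<lambda>i. g i - u i)))"
      have "op_comp L (op_comp P f) b d g = (\<Sum>b1\<in>{..b}. \<Sum>d1\<in>{..d}. \<Sum>l\<in>?R.
           L b1 d1 (ints l) * op_comp (Dpow l P) f (b - b1) (d - d1) g)"
        unfolding op_comp_Dsym[OF n L Pfw c b d r]
        by (intro sum.cong refl arg_cong2[where f = "(*)"] Dpow_const[OF n P f bs ds] ls)
      also have "\<dots> = (\<Sum>b1\<in>{..b}. \<Sum>d1\<in>{..d}. \<Sum>l\<in>?R. \<Sum>b2\<in>{..b - b1}. \<Sum>u\<in>?Q. L b1 d1 (ints l) *
           (f b2 0 u * Dpow l P (b - (b1 + b2)) (d - d1) (\<lambda>i. g i - u i)))"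
        using elim(2) by (intro sum.cong refl) (simp only: sum_distrib_left diff_diff_eq)
      also have "\<dots> = (\<Sum>b1\<in>{..b}. \<Sum>b2\<in>{..b - b1}. G b1 b2)"
        unfolding G_def by (subst (2) sum.swap, subst (3) sum.swap) (rule refl)
      also have "\<dots> = (\<Sum>b2\<in>{..b}. \<Sum>b1\<in>{..b - b2}. G b1 b2)" by (rule sum_triangle_swap[OF b])
      also have "\<dots> = (\<Sum>b2\<in>{..b}. \<Sum>u\<in>?Q. f b2 0 u * op_comp L P (b - b2) d (\<lambda>i. g i - u i))"
      proof (rule sum.cong[OF refl], goal_cases)
        case (1 b2)
        hence b2: "b2 \<le> b" by simp
        have r': "c + int (mdeg (b - b2)) + int (mdeg d) \<le> int r"
          using r mdeg_minus[OF b b2] by linarith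
        have "(\<Sum>b1\<in>{..b - b2}. G b1 b2) = (\<Sum>b1\<in>{..b - b2}. \<Sum>d1\<in>{..d}. \<Sum>l\<in>?R. \<Sum>u\<in>?Q. 
           f b2 0 u * (L b1 d1 (ints l) * Dpow l P (b - b2 - b1) (d - d1) (\<lambda>i. g i - u i)))"
          unfolding G_def by (simp only: diff_diff_eq add.commute mult.left_commute)
        also have "\<dots> = (\<Sum>u\<in>?Q. \<Sum>b1\<in>{..b - b2}. \<Sum>d1\<in>{..d}. \<Sum>l\<in>?R.
           f b2 0 u * (L b1 d1 (ints l) * Dpow l P (b - b2 - b1) (d - d1) (\<lambda>i. g i - u i)))"
          unfolding sum.swap[of _ ?Q ?R] sum.swap[of _ ?Q "{..d}"] sum.swap[of _ ?Q "{..b - b2}"] ..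
        also have "\<dots> = (\<Sum>u\<in>?Q. f b2 0 u * op_comp L P (b - b2) d (\<lambda>i. g i - u i))"
          unfolding op_comp_Dsym[OF n L Pw c bs d r'] sum_distrib_left ..
        finally show ?case .
      qed
      also have "\<dots> = op_comp (op_comp L P) f b d g" using elim(1) by simp
      finally show ?case .
    qed
    thus ?thesis by (rule eventually_sequentially_obtain)
  qed
qed

text \<open>Both sides are double convolutions, but with nested truncations whose inner radius
  depends on the outer one. They are compared through the set of nonzero terms, which both
  truncations contain.\<close>

lemma op_comp_const_assoc:
  assumes n: "1 \<le> n" and P: "P \<in> Pihat m n" and f: "f \<in> Pihat m n" "const_op f"
    and h: "h \<in> Pihat m n" "const_op h"
  shows "op_comp (op_comp P f) h = op_comp P (op_comp f h)"
proof (intro ext)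
  fix b d g
  have Pw: "wf_op m n P" and fw: "wf_op m n f" and hw: "wf_op m n h" using P f h by (auto simp: Pihat_iff)
  have Pf: "op_comp P f \<in> Pihat m n" and fh: "op_comp f h \<in> Pihat m n" "const_op (op_comp f h)"
    using Pihat_comp const_op_comp P f h by blast+
  have Pfw: "wf_op m n (op_comp P f)" and fhw: "wf_op m n (op_comp f h)" using Pf fh by (auto simp: Pihat_iff)
  show "op_comp (op_comp P f) h b d g = op_comp P (op_comp f h) b d g"
  proof (cases "supp_below m b \<and> supp_below n d")
    case False
    thus ?thesis using op_comp_outside[OF Pw fhw False] op_comp_outside[OF Pfw hw False] by simp
  next
    case True
    hence b: "supp_below m b" and d: "supp_below n d" by auto
    have bs: "supp_below m (b - b1)" for b1 using b by auto
    obtain c1 c2 c3 where c: "ordle P c1" "ordle f c2" "ordle h c3" using P f h by (auto simp: Pihat_iff)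
    \<comment> \<open>Bounds the exponents of \<open>\<partial>_n\<close> in \<open>v\<close>,
      \<open>u\<close>, \<open>v + u\<close> and in their complements in \<open>g\<close>. The
      factor 2 allows for sums such as \<open>g - v\<close>, which collect the exponents of two
      factors.\<close>
    define A where "A = \<bar>c1\<bar> + \<bar>c2\<bar> + \<bar>c3\<bar> + 2 * (int (mdeg b) + int (mdeg d))"
    define R0 where "R0 = nat (\<bar>A\<bar> + (\<Sum>i<n. \<bar>g i\<bar>))"
    define F where "F = (\<lambda>b3 b2 v u. h b3 0 v * (f b2 0 u * P (b - (b3 + b2)) d (\<lambda>i. g i - v i - u i)))"
    have F: "v \<in> ibox n R" "u \<in> ibox n R" "v + u \<in> ibox n R"
      if nz: "F b3 b2 v u \<noteq> 0" and le: "b3 \<le> b" "b2 \<le> b" and R: "R0 \<le> R" for b3 b2 v u R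
    proof -
      have 1: "h b3 0 v \<noteq> 0" and 2: "f b2 0 u \<noteq> 0" and 3: "P (b - (b3 + b2)) d (\<lambda>i. g i - v i - u i) \<noteq> 0"
        using nz unfolding F_def by auto
      note w1 = wf_opD[OF hw, OF 1] and w2 = wf_opD[OF fw, OF 2] and w3 = wf_opD[OF Pw, OF 3]
      have m: "mdeg b3 \<le> mdeg b" "mdeg b2 \<le> mdeg b" "mdeg (b - (b3 + b2)) \<le> mdeg b"
        using mdeg_mono[OF b le(1)] mdeg_mono[OF b le(2)] mdeg_mono[OF b, of "b - (b3 + b2)"]
        by (auto simp: le_fun_def)
      have R': "\<bar>A\<bar> + (\<Sum>i<n. \<bar>g i\<bar>) \<le> int R" using R unfolding R0_def by linarith
      have e1: "v (n - 1) \<le> \<bar>c3\<bar> + int (mdeg b)"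
        using exponent_bounds[OF n hw c(3), OF 1] m by simp
      have e2: "u (n - 1) \<le> \<bar>c2\<bar> + int (mdeg b)"
        using exponent_bounds[OF n fw c(2), OF 2] m by simp
      have e3: "g (n - 1) - v (n - 1) - u (n - 1) \<le> \<bar>c1\<bar> + int (mdeg b) + int (mdeg d)"
        using exponent_bounds[OF n Pw c(1), OF 3] m by simp
      have i: "0 \<le> v i" "0 \<le> u i" "v i + u i \<le> g i" if "i + 1 < n" for i
        using w1(4)[OF that] w2(4)[OF that] w3(4)[OF that] by auto
      have arith: "x \<le> a1 + a2 + a3 + 2 * (p + q) \<and> z - x \<le> a1 + a2 + a3 + 2 * (p + q) \<and>
          y \<le> a1 + a2 + a3 + 2 * (p + q) \<and> z - y \<le> a1 + a2 + a3 + 2 * (p + q) \<and>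
          x + y \<le> a1 + a2 + a3 + 2 * (p + q) \<and> z - (x + y) \<le> a1 + a2 + a3 + 2 * (p + q)"
        if "0 \<le> a1" "0 \<le> a2" "0 \<le> a3" "0 \<le> p" "0 \<le> q" "x \<le> a3 + p" "y \<le> a2 + p" "z - x - y \<le> a1 + p + q"
        for a1 a2 a3 p q x y z :: int using that by auto
      have A: "v (n - 1) \<le> A" "g (n - 1) - v (n - 1) \<le> A" "u (n - 1) \<le> A" "g (n - 1) - u (n - 1) \<le> A"
        "v (n - 1) + u (n - 1) \<le> A" "g (n - 1) - (v (n - 1) + u (n - 1)) \<le> A"
        using arith[OF abs_ge_zero abs_ge_zero abs_ge_zero of_nat_0_le_iff of_nat_0_le_iff e1 e2 e3] unfolding A_def
        by blast+
      show "v \<in> ibox n R"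
        by (rule factor_in_ibox[OF n w1(3) _ A(1,2) R']) (use i in force)
      show "u \<in> ibox n R"
        by (rule factor_in_ibox[OF n w2(3) _ A(3,4) R']) (use i in force)
      show "v + u \<in> ibox n R"
        by (rule factor_in_ibox[OF n supp_below_add[OF w1(3) w2(3)] _ _ _ R']) (use i A in auto)
    qed
    have "\<forall>\<^sub>F R in sequentially. R0 \<le> R \<and> op_comp (op_comp P f) h b d g =
       (\<Sum>b3\<in>{..b}. \<Sum>v\<in>ibox n R. h b3 0 v * op_comp P f (b - b3) d (\<lambda>i. g i - v i))"
      by (intro eventually_conj eventually_ge_at_top op_comp_const[OF n Pf h b])
    then obtain R where R: "R0 \<le> R" and lhs: "op_comp (op_comp P f) h b d g =
       (\<Sum>b3\<in>{..b}. \<Sum>v\<in>ibox n R. h b3 0 v * op_comp P f (b - b3) d (\<lambda>i. g i - v i))"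
      by (rule eventually_sequentially_obtain) blast
    \<comment> \<open>\<open>R'\<close> has to serve every \<open>b3\<close> and every
      \<open>v\<close> of the outer range, so it can be chosen only after \<open>R\<close>.\<close>
    have "\<forall>\<^sub>F R' in sequentially. R \<le> R' \<and> (\<forall>b3\<in>{..b}. \<forall>v\<in>ibox n R. op_comp P f (b - b3) d (\<lambda>i. g i - v i) =
        (\<Sum>b2\<in>{..b - b3}. \<Sum>u\<in>ibox n R'. f b2 0 u * P (b - b3 - b2) d (\<lambda>i. g i - v i - u i)))"
      by (intro eventually_conj eventually_ge_at_top eventually_ball_finite ballI finite_below[OF b] finite_ibox
          op_comp_const[OF n P f bs])
    then obtain R' where R': "R \<le> R'" and lhs': "\<And>b3 v. b3 \<in> {..b} \<Longrightarrow> v \<in> ibox n R \<Longrightarrow> op_comp P f (b - b3) d (\<lambda>i. g i - v i) =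
        (\<Sum>b2\<in>{..b - b3}. \<Sum>u\<in>ibox n R'. f b2 0 u * P (b - b3 - b2) d (\<lambda>i. g i - v i - u i))"
      by (rule eventually_sequentially_obtain) blast
    have "\<forall>\<^sub>F Q in sequentially. R0 \<le> Q \<and> op_comp P (op_comp f h) b d g =
       (\<Sum>e\<in>{..b}. \<Sum>w\<in>ibox n Q. op_comp f h e 0 w * P (b - e) d (\<lambda>i. g i - w i))"
      by (intro eventually_conj eventually_ge_at_top op_comp_const[OF n P fh b])
    then obtain Q where Q: "R0 \<le> Q" and rhs: "op_comp P (op_comp f h) b d g =
       (\<Sum>e\<in>{..b}. \<Sum>w\<in>ibox n Q. op_comp f h e 0 w * P (b - e) d (\<lambda>i. g i - w i))"
      by (rule eventually_sequentially_obtain) blast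
    have "\<forall>\<^sub>F Q' in sequentially. R0 \<le> Q' \<and> (\<forall>e\<in>{..b}. \<forall>w\<in>ibox n Q. op_comp f h e 0 w =
        (\<Sum>b3\<in>{..e}. \<Sum>v\<in>ibox n Q'. h b3 0 v * f (e - b3) 0 (\<lambda>i. w i - v i)))"
      by (intro eventually_conj eventually_ge_at_top eventually_ball_finite ballI finite_below[OF b] finite_ibox
          op_comp_const[OF n f(1) h]) (use supp_below_mono[OF b] in auto)
    then obtain Q' where Q': "R0 \<le> Q'" and rhs': "\<And>e w. e \<in> {..b} \<Longrightarrow> w \<in> ibox n Q \<Longrightarrow> op_comp f h e 0 w =
        (\<Sum>b3\<in>{..e}. \<Sum>v\<in>ibox n Q'. h b3 0 v * f (e - b3) 0 (\<lambda>i. w i - v i))"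
      by (rule eventually_sequentially_obtain) blast
    \<comment> \<open>Each range contains all nonzero terms of \<open>F\<close>, so both sums reduce
      to those, matched by \<open>w = v + u\<close>.\<close>
    have key: "(\<Sum>v\<in>ibox n R. \<Sum>u\<in>ibox n R'. F b3 b2 v u) = (\<Sum>w\<in>ibox n Q. \<Sum>v\<in>ibox n Q'. F b3 b2 v (\<lambda>i. w i - v i))"
      if le: "b3 \<le> b" "b2 \<le> b" for b3 b2
    proof -
      let ?N = "{(v, u). F b3 b2 v u \<noteq> 0}"
      have "(\<Sum>v\<in>ibox n R. \<Sum>u\<in>ibox n R'. F b3 b2 v u) = (\<Sum>(v, u)\<in>ibox n R \<times> ibox n R'. F b3 b2 v u)"
        by (rule sum.cartesian_product)
      also have "\<dots> = (\<Sum>(v, u)\<in>?N. F b3 b2 v u)"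
        using F[OF _ le] R R' by (intro sum.mono_neutral_right) auto
      also have "\<dots> = (\<Sum>(w, v)\<in>{(w, v). F b3 b2 v (\<lambda>i. w i - v i) \<noteq> 0}. F b3 b2 v (\<lambda>i. w i - v i))"
        by (rule sum.reindex_bij_witness[of _ "\<lambda>(w, v). (v, \<lambda>i. w i - v i)" "\<lambda>(v, u). (v + u, v)"])
          (auto simp: fun_eq_iff)
      also have "\<dots> = (\<Sum>(w, v)\<in>ibox n Q \<times> ibox n Q'. F b3 b2 v (\<lambda>i. w i - v i))"
      proof (rule sum.mono_neutral_left)
        show "{(w, v). F b3 b2 v (\<lambda>i. w i - v i) \<noteq> 0} \<subseteq> ibox n Q \<times> ibox n Q'"
        proof clarify
          fix w v assume nz: "F b3 b2 v (\<lambda>i. w i - v i) \<noteq> 0"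
          have "v + (\<lambda>i. w i - v i) = w" by (rule ext) simp
          thus "w \<in> ibox n Q \<and> v \<in> ibox n Q'" using F(3)[OF nz le Q] F(1)[OF nz le Q'] by simp
        qed
      qed auto
      also have "\<dots> = (\<Sum>w\<in>ibox n Q. \<Sum>v\<in>ibox n Q'. F b3 b2 v (\<lambda>i. w i - v i))"
        by (rule sum.cartesian_product[symmetric])
      finally show ?thesis .
    qed
    have "op_comp (op_comp P f) h b d g = (\<Sum>b3\<in>{..b}. \<Sum>v\<in>ibox n R. \<Sum>b2\<in>{..b - b3}. \<Sum>u\<in>ibox n R'. F b3 b2 v u)"
      unfolding lhs F_def by (intro sum.cong refl) (simp only: lhs' sum_distrib_left diff_diff_eq)
    also have "\<dots> = (\<Sum>b3\<in>{..b}. \<Sum>b2\<in>{..b - b3}. \<Sum>v\<in>ibox n R. \<Sum>u\<in>ibox n R'. F b3 b2 v u)"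
      by (rule sum.cong[OF refl], rule sum.swap)
    also have "\<dots> = (\<Sum>b3\<in>{..b}. \<Sum>b2\<in>{..b - b3}. \<Sum>w\<in>ibox n Q. \<Sum>v\<in>ibox n Q'. F b3 b2 v (\<lambda>i. w i - v i))"
    proof (rule sum.cong[OF refl], rule sum.cong[OF refl], rule key)
      fix b3 b2 assume "b3 \<in> {..b}" "b2 \<in> {..b - b3}"
      thus "b3 \<le> b" "b2 \<le> b" by (auto simp: le_fun_def) (meson diff_le_self order_trans)
    qed
    also have "\<dots> = (\<Sum>e\<in>{..b}. \<Sum>b3\<in>{..e}. \<Sum>w\<in>ibox n Q. \<Sum>v\<in>ibox n Q'. F b3 (e - b3) v (\<lambda>i. w i - v i))"
      by (rule sum_triangle[OF b])
    also have "\<dots> = (\<Sum>e\<in>{..b}. \<Sum>w\<in>ibox n Q. \<Sum>b3\<in>{..e}. \<Sum>v\<in>ibox n Q'. F b3 (e - b3) v (\<lambda>i. w i - v i))"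
      by (rule sum.cong[OF refl], rule sum.swap)
    also have "\<dots> = op_comp P (op_comp f h) b d g"
      unfolding rhs
    proof (rule sum.cong[OF refl], rule sum.cong[OF refl], goal_cases)
      case (1 e w)
      have "b3 + (e - b3) = e" if "b3 \<le> e" for b3 :: mexp
        using that by (auto simp: fun_eq_iff le_fun_def)
      thus ?case unfolding rhs'[OF 1] F_def sum_distrib_right
        by (intro sum.cong refl) (simp add: mult.assoc)
    qed
    finally show ?thesis .
  qed
qed

section \<open>Bilinearity of the composition\<close>

lemma op_comp_add_right:
  assumes n: "1 \<le> n" and P: "P \<in> Pihat m n" and f: "f \<in> Pihat m n" "const_op f"
    and h: "h \<in> Pihat m n" "const_op h" and fh: "f + h \<in> Pihat m n" "const_op (f + h)"
  shows "op_comp P (f + h) = op_comp P f + op_comp P h"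
proof (intro ext)
  fix b d g
  have Pw: "wf_op m n P" and fw: "wf_op m n f" and hw: "wf_op m n h" and fhw: "wf_op m n (f + h)"
    using P f h fh by (auto simp: Pihat_iff)
  show "op_comp P (f + h) b d g = (op_comp P f + op_comp P h) b d g"
  proof (cases "supp_below m b \<and> supp_below n d")
    case False
    thus ?thesis
      using op_comp_outside[OF Pw fhw False] op_comp_outside[OF Pw hw False] op_comp_outside[OF Pw fw False] by simp
  next
    case True
    hence b: "supp_below m b" by simp
    have "\<forall>\<^sub>F R in sequentially. op_comp P (f + h) b d g = (op_comp P f + op_comp P h) b d g"
      using op_comp_const[OF n P f b, of d g] op_comp_const[OF n P h b, of d g] op_comp_const[OF n P fh b, of d g]
      by eventually_elim (simp add: ring_distribs sum.distrib)
    thus ?thesis by (rule eventually_sequentially_obtain)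
  qed
qed

text \<open>A nonzero scalar leaves the set of nonzero contributions unchanged, so even the
  convention for infinite sums agrees on both sides. The scalar 0 empties this set and is treated
  apart.\<close>

lemma op_comp_scale_right: "op_comp P (scaleK c f) = scaleK c (op_comp P f)"
proof (cases "c = 0")
  case True
  thus ?thesis by (simp add: op_comp_def op_term_def scaleK_def fun_eq_iff)
next
  case False
  have "op_term P (scaleK c f) b d g x = c * op_term P f b d g x" for b d g x
    by (simp add: op_term_def scaleK_def case_prod_unfold)
  thus ?thesis using False by (simp add: op_comp_def scaleK_def sum_distrib_left fun_eq_iff)
qed

lemma op_comp_scale_left: "op_comp (scaleK c P) f = scaleK c (op_comp P f)"
proof (cases "c = 0")
  case True
  thus ?thesis by (simp add: op_comp_def op_term_def scaleK_def fun_eq_iff)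
next
  case False
  have "op_term (scaleK c P) f b d g x = c * op_term P f b d g x" for b d g x
    by (simp add: op_term_def scaleK_def case_prod_unfold)
  thus ?thesis using False by (simp add: op_comp_def scaleK_def sum_distrib_left fun_eq_iff)
qed

lemma add_nonzeroD: "(P + Q) b d k \<noteq> 0 \<Longrightarrow> P b d k \<noteq> 0 \<or> Q b d k \<noteq> (0 :: 'k::field_char_0)"
  by auto

lemma wf_op_add:
  fixes P Q :: "'k::field_char_0 op"
  assumes "wf_op m n P" "wf_op m n Q" shows "wf_op m n (P + Q)"
  unfolding wf_op_def
proof (intro allI impI)
  fix b d k assume "(P + Q) b d k \<noteq> 0"
  hence "P b d k \<noteq> 0 \<or> Q b d k \<noteq> 0" by (rule add_nonzeroD)
  thus "(\<forall>i\<ge>m. b i = 0) \<and> (\<forall>i\<ge>n. d i = 0) \<and> (\<forall>i\<ge>n. k i = 0) \<and> (\<forall>i. i + 1 < n \<longrightarrow> 0 \<le> k i)"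
    using assms unfolding wf_op_def by blast
qed

lemma ordle_add:
  fixes P Q :: "'k::field_char_0 op"
  assumes "ordle P c" "ordle Q c" shows "ordle (P + Q) c"
  unfolding ordle_def
proof (intro allI impI)
  fix b d k assume "(P + Q) b d k \<noteq> 0"
  hence "P b d k \<noteq> 0 \<or> Q b d k \<noteq> 0" by (rule add_nonzeroD)
  thus "tdeg b d k \<le> c" using ordleD[OF assms(1)] ordleD[OF assms(2)] by blast
qed

lemma Dsym_add:
  fixes L M :: "'k::field_char_0 op"
  assumes "L \<in> Dsym m n" "M \<in> Dsym m n" shows "L + M \<in> Dsym m n"
proof -
  obtain c e where "ordle L c" "ordle M e" using assms unfolding Dsym_iff by blast
  hence "ordle (L + M) (max c e)" by (intro ordle_add) (auto elim: ordle_mono)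
  moreover have "0 \<le> k (n - 1)" if "(L + M) b d k \<noteq> 0" for b d k
  proof -
    have "L b d k \<noteq> 0 \<or> M b d k \<noteq> 0" using that by auto
    thus ?thesis using assms unfolding Dsym_iff by blast
  qed
  ultimately show ?thesis using assms wf_op_add unfolding Dsym_iff by blast
qed

lemma Dsym_scale:
  fixes L :: "'k::field_char_0 op"
  assumes "L \<in> Dsym m n" shows "scaleK a L \<in> Dsym m n"
proof -
  have *: "L b d k \<noteq> 0" if "scaleK a L b d k \<noteq> 0" for b d k using that by (auto simp: scaleK_def)
  show ?thesis using assms * unfolding Dsym_iff wf_op_def ordle_def by blast
qed

lemma op_comp_add_left:
  assumes n: "1 \<le> n" and L: "L \<in> Dsym m n" and M: "M \<in> Dsym m n" and P: "wf_op m n P"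
  shows "op_comp (L + M) P = op_comp L P + op_comp M P"
proof (intro ext)
  fix b d g
  have LM: "L + M \<in> Dsym m n" by (rule Dsym_add[OF L M])
  have Lw: "wf_op m n L" and Mw: "wf_op m n M" and LMw: "wf_op m n (L + M)" using L M LM by (auto simp: Dsym_iff)
  show "op_comp (L + M) P b d g = (op_comp L P + op_comp M P) b d g"
  proof (cases "supp_below m b \<and> supp_below n d")
    case False
    thus ?thesis
      using op_comp_outside[OF LMw P False] op_comp_outside[OF Lw P False] op_comp_outside[OF Mw P False] by simp
  next
    case True
    hence b: "supp_below m b" and d: "supp_below n d" by auto
    obtain c e where "ordle L c" "ordle M e" using L M unfolding Dsym_iff by blast
    hence o: "ordle L (max c e)" "ordle M (max c e)"
      by (auto elim: ordle_mono)
    define r where "r = nat (max c e + int (mdeg b) + int (mdeg d))"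
    have r: "max c e + int (mdeg b) + int (mdeg d) \<le> int r" by (simp add: r_def)
    show ?thesis
      by (simp add: op_comp_Dsym[OF n L P o(1) b d r] op_comp_Dsym[OF n M P o(2) b d r]
          op_comp_Dsym[OF n LM P ordle_add[OF o] b d r] ring_distribs sum.distrib)
  qed
qed

section \<open>Slices\<close>

definition restr :: "'k::zero op \<Rightarrow> 'k op" where
  "restr P = (\<lambda>b d g. if d = 0 then P b d g else 0)"

text \<open>At \<open>x = 0\<close> the left factor supplies no x, so all of \<open>x^j\<close> in
  \<open>P\<close> must be differentiated away. The resulting \<open>dfac j j\<close> is the
  factorial in the slice \<open>P_(j)\<close>.\<close>

lemma diamond_eq: "diamond h P = restr (op_comp h P)"
proof (intro ext)
  fix b d g
  show "diamond h P b d g = restr (op_comp h P) b d g"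
  proof (cases "d = 0")
    case True
    have t: "op_term h P b 0 g (b1, 0, k, j) = dia_term h P b g (b1, k, j)" for b1 k j
    proof -
      have z: "(0::mexp) - 0 + j = j" by (rule ext) simp
      show ?thesis unfolding op_term_def dia_term_def prod.case z by (simp add: dfac_self)
    qed
    have "sum (dia_term h P b g) {(b1, k, i). b1 \<le> b \<and> dia_term h P b g (b1, k, i) \<noteq> 0}
      = sum (op_term h P b 0 g) {(b1, d1, k, j). b1 \<le> b \<and> d1 \<le> 0 \<and> op_term h P b 0 g (b1, d1, k, j) \<noteq> 0}"
    proof (rule sum.reindex_bij_witness[of _ "\<lambda>(b1, d1, k, j). (b1, k, j)" "\<lambda>(b1, k, j). (b1, 0, k, j)"], goal_cases)
      case (3 x)
      obtain b1 d1 k j where x: "x = (b1, d1, k, j)" by (cases x) auto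
      have "d1 = 0" using 3 x by (auto simp: le_fun_def fun_eq_iff)
      thus ?case by (simp add: x)
    next
      case (4 x)
      obtain b1 d1 k j where x: "x = (b1, d1, k, j)" by (cases x) auto
      have "d1 = 0" using 4 x by (auto simp: le_fun_def fun_eq_iff)
      thus ?case using 4 t by (simp add: x)
    qed (auto simp: t)
    thus ?thesis unfolding diamond_def restr_def op_comp_def using True by simp
  qed (simp add: diamond_def restr_def)
qed

lemma diamond_cong:
  assumes "\<And>b k. f b 0 k = h b 0 k" shows "diamond f P = diamond h P"
proof -
  have "dia_term f P = dia_term h P" by (simp add: fun_eq_iff dia_term_def assms)
  thus ?thesis by (simp only: diamond_def)
qed

text \<open>In every term of \<open>P \<circ> f\<close> the power of x is the one from
  \<open>P\<close>. This turns \<open>(h \<diamond> S) \<circ> f\<close>, which stays in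
  \<open>W\<close>, into the value of \<open>(h \<circ> S) \<circ> f\<close> at
  \<open>x = 0\<close>.\<close>

lemma op_comp_restr_const:
  assumes f: "const_op f" shows "op_comp (restr P) f = restr (op_comp P f)"
proof (intro ext)
  fix b d g
  have 1: "d1 = d" if "d1 \<le> d" "f b' (d - d1 + j) k \<noteq> 0" for d1 j b' k
  proof
    fix i
    have "d - d1 + j = 0" using that f unfolding const_op_def by blast
    from fun_cong[OF this, of i] le_funD[OF that(1), of i] show "d1 i = d i" by simp
  qed
  show "op_comp (restr P) f b d g = restr (op_comp P f) b d g"
  proof (cases "d = 0")
    case True
    have "op_term (restr P) f b d g (b1, d1, k, j) = op_term P f b d g (b1, d1, k, j)" if "d1 \<le> d" for b1 d1 k j
      using that True by (auto simp: op_term_def restr_def le_fun_def fun_eq_iff)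
    hence "op_comp (restr P) f b d g = op_comp P f b d g"
      unfolding op_comp_def by (intro sum.cong) auto
    thus ?thesis using True by (simp add: restr_def)
  next
    case False
    have "op_term (restr P) f b d g (b1, d1, k, j) = 0" if "d1 \<le> d" for b1 d1 k j
    proof (rule ccontr)
      assume "op_term (restr P) f b d g (b1, d1, k, j) \<noteq> 0"
      hence a: "restr P b1 d1 k \<noteq> 0" and c: "f (b - b1) (d - d1 + j) (\<lambda>i. g i - k i + int (j i)) \<noteq> 0"
        by (auto simp: op_term_def)
      have "d1 = 0" using a by (auto simp: restr_def split: if_splits)
      thus False using 1[OF that c] False by simp
    qed
    hence e: "{(b1, d1, k, j). b1 \<le> b \<and> d1 \<le> d \<and> op_term (restr P) f b d g (b1, d1, k, j) \<noteq> 0} = {}" by blast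
    show ?thesis unfolding op_comp_def e using False by (simp add: restr_def)
  qed
qed

lemma shiftsum_cong:
  assumes "\<And>j g. j \<le> l \<Longrightarrow> H (k + j) g = H' (k + j) g"
  shows "shiftsum e l H k g = shiftsum e l H' k g"
  unfolding shiftsum_def using assms by (intro sum.cong refl) simp

text \<open>The slices are the sequence \<open>d! P_d\<close> acted on by
  \<open>\<Prod>_t (T_t + G_t)^(k_t)\<close> and read at 0, so binomial inversion with
  \<open>e = -1\<close> recovers the coefficients.\<close>

lemma op_from_restr:
  assumes "supp_below n k"
  shows "mfact k * P b k g = shiftsum (-1) k (\<lambda>d. Dpow d P b 0) 0 g"
proof -
  have E: "(\<lambda>d. Dpow d P b 0) = (\<lambda>d. shiftsum (- (-1)) d (\<lambda>d g. mfact d * P b d g) 0)"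
    by (intro ext) (simp add: Dpow_def)
  have "shiftsum (-1) k (\<lambda>d. Dpow d P b 0) 0 g = shiftsum (- (-1)) 0 (\<lambda>d g. mfact d * P b d g) k g"
    unfolding E by (rule shiftsum_inversion[OF assms supp_below_zero])
  also have "\<dots> = mfact k * P b k g" by (rule shiftsum_zero)
  finally show ?thesis by simp
qed

lemma op_eqI_restr:
  fixes P Q :: "'k::field_char_0 op"
  assumes P: "wf_op m n P" and Q: "wf_op m n Q"
    and eq: "\<And>k b g. supp_below n k \<Longrightarrow> Dpow k P b 0 g = Dpow k Q b 0 g"
  shows "P = Q"
proof (intro ext)
  fix b d g
  show "P b d g = Q b d g"
  proof (cases "supp_below n d")
    case True
    have "mfact d * P b d g = mfact d * Q b d g"
      unfolding op_from_restr[OF True]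
      by (rule shiftsum_cong) (use eq supp_below_mono[OF True] in \<open>simp\<close>)
    thus ?thesis by simp
  next
    case False
    hence "P b d g = 0" "Q b d g = 0" using wf_opD(2)[OF P, of b d g] wf_opD(2)[OF Q, of b d g] by blast+
    thus ?thesis by simp
  qed
qed

text \<open>The inversion formula used as a construction: the coefficient of \<open>x^d\<close> is
  \<open>1/d!\<close> times the sum over \<open>k \<le> d\<close> of
  \<open>(-1)^|d - k| binom(d, k) h_k \<partial>^(d - k)\<close>.\<close>

definition from_restr :: "nat \<Rightarrow> (mexp \<Rightarrow> 'k::field_char_0 op) \<Rightarrow> 'k op" where
  "from_restr n h = (\<lambda>b d g. if supp_below n d then shiftsum (-1) d (\<lambda>k. h k b 0) 0 g / mfact d else 0)"

lemma Dpow_from_restr: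
  assumes "supp_below n k" shows "Dpow k (from_restr n h) b 0 g = h k b 0 g"
proof -
  have "Dpow k (from_restr n h) b 0 g = shiftsum 1 k (\<lambda>d. shiftsum (-1) d (\<lambda>k. h k b 0) 0) 0 g"
    unfolding Dpow_def mfact_zero div_by_1
    by (rule shiftsum_cong) (use supp_below_mono[OF assms] in \<open>simp add: from_restr_def\<close>)
  also have "\<dots> = shiftsum (-1) 0 (\<lambda>k. h k b 0) k g"
    by (rule shiftsum_inversion[OF assms supp_below_zero])
  also have "\<dots> = h k b 0 g" by (rule shiftsum_zero)
  finally show ?thesis .
qed

lemma from_restr_nonzero:
  assumes "from_restr n h b d g \<noteq> 0"
  obtains j where "supp_below n d" "j \<le> d" "h j b 0 (\<lambda>i. g i - int (d i) + int (j i)) \<noteq> 0"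
proof -
  have d: "supp_below n d" using assms by (auto simp: from_restr_def split: if_splits)
  have "shiftsum (-1) d (\<lambda>k. h k b 0) 0 g \<noteq> 0" using assms d by (auto simp: from_restr_def)
  then obtain j where "j \<in> {..d}" "(-1) ^ mdeg (d - j) * gbin (ints d) j * h (0 + j) b 0 (\<lambda>i. g i - int (d i) + int (j i)) \<noteq> 0"
    unfolding shiftsum_def by (rule sum.not_neutral_contains_not_neutral)
  hence j: "j \<in> {..d}" "h (0 + j) b 0 (\<lambda>i. g i - int (d i) + int (j i)) \<noteq> 0" by auto
  have "0 + j = j" by (rule ext) simp
  thus ?thesis using that[OF d, of j] j by simp
qed

lemma Fn_Dsym:
  assumes "h \<in> Fn m n" shows "h \<in> Dsym m n" "const_op h"
  using assms unfolding Fn_def Pin_def Pihat_iff Dsym_iff const_op_def by blast+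

text \<open>A term of \<open>h_j\<close> enters at \<open>x^d\<close> multiplied by
  \<open>\<partial>^(d - j)\<close>, so its degree changes by \<open>|d - j| - |d| = -|j|\<close>.
  Slices of order at most \<open>c + |j|\<close> therefore give an operator of order at most
  \<open>c\<close>.\<close>

lemma from_restr_Dsym:
  assumes n: "1 \<le> n" and h: "\<And>k. supp_below n k \<Longrightarrow> h k \<in> Dsym m n"
  shows "wf_op m n (from_restr n h)" "from_restr n h b d g \<noteq> 0 \<Longrightarrow> 0 \<le> g (n - 1)"
    "(\<And>k. supp_below n k \<Longrightarrow> ordle (h k) (c + int (mdeg k))) \<Longrightarrow> ordle (from_restr n h) c"
proof -
  have *: "supp_below m b \<and> supp_below n d \<and> supp_below n g \<and> (\<forall>i. 0 \<le> g i) \<and>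
     (\<exists>j. supp_below n j \<and> h j b 0 (\<lambda>i. g i - int (d i) + int (j i)) \<noteq> 0
       \<and> ddeg (\<lambda>i. g i - int (d i) + int (j i)) = ddeg g - int (mdeg d) + int (mdeg j))"
    if nz: "from_restr n h b d g \<noteq> 0" for b d g
  proof -
    obtain j where d: "supp_below n d" and j: "j \<le> d" and hj: "h j b 0 (\<lambda>i. g i - int (d i) + int (j i)) \<noteq> 0"
      using from_restr_nonzero[OF nz] .
    have js: "supp_below n j" using supp_below_mono[OF d j] .
    have hw: "wf_op m n (h j)" using h[OF js] by (simp add: Dsym_iff)
    note w = wf_opD[OF hw, OF hj]
    have g: "supp_below n g" using w(3) d js unfolding supp_below_def by force
    have pos: "0 \<le> g i" for i
      using Dsym_nonneg[OF h[OF js], OF hj n, of i] le_funD[OF j, of i] by linarith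
    have "ddeg (\<lambda>i. g i - int (d i) + int (j i)) = ddeg g - int (mdeg d) + int (mdeg j)"
      unfolding ddeg_eq[OF w(3)] ddeg_eq[OF g] mdeg_eq[OF d] mdeg_eq[OF js] by (simp add: sum.distrib sum_subtractf)
    thus ?thesis using w(1) d g pos js hj by blast
  qed
  show "wf_op m n (from_restr n h)" unfolding wf_op_def using * unfolding supp_below_def by blast
  show "from_restr n h b d g \<noteq> 0 \<Longrightarrow> 0 \<le> g (n - 1)" using * by blast
  show "ordle (from_restr n h) c" if o: "\<And>k. supp_below n k \<Longrightarrow> ordle (h k) (c + int (mdeg k))"
    unfolding ordle_def
  proof (intro allI impI)
    fix b d g assume nz: "from_restr n h b d g \<noteq> 0"
    from *[OF nz] obtain j where js: "supp_below n j" and hj: "h j b 0 (\<lambda>i. g i - int (d i) + int (j i)) \<noteq> 0"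
      and e: "ddeg (\<lambda>i. g i - int (d i) + int (j i)) = ddeg g - int (mdeg d) + int (mdeg j)" by blast
    from ordleD[OF o[OF js], OF hj] e show "tdeg b d g \<le> c" by simp
  qed
qed

section \<open>Monomials in the derivations as operators\<close>

definition dmono :: "mexp \<Rightarrow> 'k::field_char_0 op" where
  "dmono k = (\<lambda>b d g. if b = 0 \<and> d = 0 \<and> g = ints k then 1 else 0)"

lemma dmono_Fn:
  assumes k: "supp_below n k" shows "(dmono k :: 'k::field_char_0 op) \<in> Fn m n"
proof -
  have 1: "ordle (dmono k :: 'k op) (ddeg (ints k))" by (simp add: ordle_def dmono_def)
  have 2: "wf_op m n (dmono k :: 'k op)" using k by (auto simp: wf_op_def dmono_def supp_below_def split: if_splits)
  have 3: "d = 0 \<and> g = ints k" if "dmono k b d g \<noteq> (0::'k)" for b d g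
    using that by (auto simp: dmono_def split: if_splits)
  hence "\<forall>b d g. dmono k b d g \<noteq> (0::'k) \<longrightarrow> g (n - 1) \<le> int (k (n - 1))" by fastforce
  moreover have "\<forall>b d g. dmono k b d g \<noteq> (0::'k) \<longrightarrow> d = 0 \<and> (\<forall>i. 0 \<le> g i)" using 3 by fastforce
  ultimately show ?thesis unfolding Fn_def Pin_def Pihat_iff using 1 2 by blast
qed

text \<open>Identifies the shift formula with a genuine composition, so that the slice
  \<open>\<partial>^k \<diamond> S\<close> is seen to lie in \<open>F \<diamond> S\<close>.\<close>

lemma op_comp_dmono:
  fixes P :: "'k::field_char_0 op"
  assumes n: "1 \<le> n" and P: "wf_op m n P" and k: "supp_below n k"
  shows "op_comp (dmono k) P = Dpow k P"
proof (intro ext)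
  fix b d g
  have D: "(dmono k :: 'k op) \<in> Dsym m n" using Fn_Dsym[OF dmono_Fn[OF k]] by blast
  have Dw: "wf_op m n (dmono k :: 'k op)" using D by (simp add: Dsym_iff)
  show "op_comp (dmono k) P b d g = Dpow k P b d g"
  proof (cases "supp_below m b \<and> supp_below n d")
    case False
    thus ?thesis using op_comp_outside[OF Dw P False] wf_opD[of m n "Dpow k P" b d g] Dpow_props[OF k P] by metis
  next
    case True
    hence b: "supp_below m b" and d: "supp_below n d" by auto
    define r where "r = mdeg k + mdeg b + mdeg d"
    have o: "ordle (dmono k :: 'k op) (int (mdeg k))" using ddeg_ints[OF k] by (auto simp: ordle_def dmono_def)
    have r: "int (mdeg k) + int (mdeg b) + int (mdeg d) \<le> int r" by (simp add: r_def)
    have kb: "k \<in> {..box n r}" using le_box_mdeg[OF k, of r] by (simp add: r_def)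
    have ii: "ints l = ints k \<longleftrightarrow> l = k" for l by (auto simp: fun_eq_iff)
    have z: "(0::mexp) \<in> {..b}" "(0::mexp) \<in> {..d}" by (auto simp: le_fun_def)
    have m0: "b - 0 = b" "d - 0 = d" by (auto simp: fun_eq_iff)
    have "op_comp (dmono k) P b d g = (\<Sum>b1\<in>{..b}. \<Sum>d1\<in>{..d}. \<Sum>l\<in>{..box n r}.
       if l = k then (if b1 = 0 \<and> d1 = 0 then Dpow k P (b - b1) (d - d1) g else 0) else 0)"
      unfolding op_comp_Dsym[OF n D P o b d r] by (intro sum.cong refl) (auto simp: dmono_def ii)
    also have "\<dots> = (\<Sum>b1\<in>{..b}. \<Sum>d1\<in>{..d}. if d1 = 0 then (if b1 = 0 then Dpow k P (b - b1) (d - d1) g else 0) else 0)"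
      using kb finite_below[OF supp_below_box, of n r] by (intro sum.cong refl) (simp add: sum.delta)
    also have "\<dots> = (\<Sum>b1\<in>{..b}. if b1 = 0 then Dpow k P (b - b1) (d - 0) g else 0)"
      using z(2) finite_below[OF d] by (intro sum.cong refl) (simp add: sum.delta)
    also have "\<dots> = Dpow k P b d g"
      using z(1) finite_below[OF b] m0 by (simp add: sum.delta)
    finally show ?thesis .
  qed
qed

section \<open>Order and cancellation\<close>

lemma op_ord_attained:
  assumes "op_ord P = ereal (of_int \<mu>)"
  obtains b d k where "ordle P \<mu>" "P b d k \<noteq> 0" "tdeg b d k = \<mu>"
proof -
  have le: "ordle P \<mu>" unfolding op_ord_le_iff[symmetric] assms by simp
  have "\<exists>b d k. P b d k \<noteq> 0"
  proof (rule ccontr)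
    assume "\<not> (\<exists>b d k. P b d k \<noteq> 0)"
    hence "ordle P (\<mu> - 1)" by (simp add: ordle_def)
    hence "ereal (of_int \<mu>) \<le> ereal (of_int (\<mu> - 1))" unfolding op_ord_le_iff[symmetric] assms .
    thus False by simp
  qed
  then obtain b d k where "P b d k \<noteq> 0" by blast
  from ordle_max_attained[OF le, OF this] obtain r b d k where
    r: "ordle P r" "P b d k \<noteq> 0" "tdeg b d k = r" by blast
  have "r \<le> \<mu>" using ordleD[OF le, OF r(2)] r(3) by simp
  moreover have "\<mu> \<le> r"
  proof -
    have "ereal (of_int \<mu>) \<le> ereal (of_int r)" using r(1) unfolding op_ord_le_iff[symmetric] assms .
    thus ?thesis by simp
  qed
  ultimately have "r = \<mu>" by simp
  thus ?thesis using that[of b d k] le r by simp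
qed

lemma op_ord_eqI:
  assumes "ordle P r" "P b d k \<noteq> 0" "tdeg b d k = r" shows "op_ord P = ereal (of_int r)"
proof (rule antisym)
  show "op_ord P \<le> ereal (of_int r)" unfolding op_ord_le_iff by (rule assms(1))
  show "ereal (of_int r) \<le> op_ord P" unfolding op_ord_def using assms(2,3) by (intro Sup_upper) blast
qed

lemma Fn_subset:
  assumes "h \<in> Fn m n" "\<And>b d k. P b d k \<noteq> 0 \<Longrightarrow> h b d k \<noteq> 0" shows "P \<in> Fn m n"
proof -
  have h: "wf_op m n h" "\<exists>c. ordle h c" "\<exists>N. \<forall>b d k. h b d k \<noteq> 0 \<longrightarrow> k (n - 1) \<le> N"
    "\<forall>b d k. h b d k \<noteq> 0 \<longrightarrow> d = 0 \<and> (\<forall>i. 0 \<le> k i)"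
    using assms(1) unfolding Fn_def Pin_def Pihat_iff by blast+
  have "wf_op m n P" using h(1) assms(2) unfolding wf_op_def by blast
  moreover have "\<exists>c. ordle P c" using h(2) assms(2) unfolding ordle_def by blast
  moreover have "\<exists>N. \<forall>b d k. P b d k \<noteq> 0 \<longrightarrow> k (n - 1) \<le> N" using h(3) assms(2) by blast
  moreover have "\<forall>b d k. P b d k \<noteq> 0 \<longrightarrow> d = 0 \<and> (\<forall>i. 0 \<le> k i)" using h(4) assms(2) by blast
  ultimately show ?thesis unfolding Fn_def Pin_def Pihat_iff by blast
qed

lemma diamond_zero [simp]: "diamond 0 P = 0"
  by (simp add: diamond_def dia_term_def fun_eq_iff)

lemma dia_term_degree:
  assumes h: "wf_op m n h" and S: "wf_op m n S" and le: "b1 \<le> b"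
    and p: "h b1 0 k \<noteq> 0" and q: "S (b - b1) i (\<lambda>t. g t - k t + int (i t)) \<noteq> 0"
  shows "tdeg b 0 g = tdeg b1 0 k + tdeg (b - b1) i (\<lambda>t. g t - k t + int (i t))"
proof -
  have z: "(0::mexp) - 0 + i = i" by (rule ext) simp
  have q': "S (b - b1) (0 - 0 + i) (\<lambda>t. g t - k t + int (i t)) \<noteq> 0" unfolding z by (rule q)
  from term_degree(5)[OF h S, OF le order_refl p q'] show ?thesis unfolding z .
qed

text \<open>If \<open>h\<close> has order \<open>r\<close>, regularity gives
  \<open>sigma h \<diamond> sigma S \<noteq> 0\<close>. This is the part of
  \<open>h \<diamond> S\<close> of degree \<open>r + \<mu>\<close>, hence
  \<open>r + \<mu> \<le> c + \<mu>\<close>.\<close>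

lemma ordle_diamond_cancel:
  assumes S: "S \<in> Pihat m n" and reg: "regular m n S" and os: "op_ord S = ereal (of_int \<mu>)"
    and h: "h \<in> Fn m n" and o: "ordle (diamond h S) (c + \<mu>)"
  shows "ordle h c"
proof (cases "\<exists>b d k. h b d k \<noteq> 0")
  case False thus ?thesis by (simp add: ordle_def)
next
  case True
  have Sw: "wf_op m n S" using S by (simp add: Pihat_iff)
  have hw: "wf_op m n h" using Fn_Dsym[OF h] by (simp add: Dsym_iff)
  obtain c0 where "ordle h c0" using Fn_Dsym[OF h] by (auto simp: Dsym_iff)
  with True obtain r b0 d0 k0 where r: "ordle h r" "h b0 d0 k0 \<noteq> 0" "tdeg b0 d0 k0 = r"
    using ordle_max_attained[of h c0] by blast
  have oh: "op_ord h = ereal (of_int r)" by (rule op_ord_eqI[OF r])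
  have sh: "sigma h = (\<lambda>b d k. if tdeg b d k = r then h b d k else 0)"
    unfolding sigma_def oh by (simp del: of_int_diff)
  have sS: "sigma S = (\<lambda>b d k. if tdeg b d k = \<mu> then S b d k else 0)"
    unfolding sigma_def os by (simp del: of_int_diff)
  have oS: "ordle S \<mu>" unfolding op_ord_le_iff[symmetric] os by simp
  have shF: "sigma h \<in> Fn m n" by (rule Fn_subset[OF h]) (auto simp: sh split: if_splits)
  have zF: "0 \<in> Fn m n" by (rule Fn_subset[OF h]) simp
  have "sigma h b0 d0 k0 \<noteq> 0" using r by (simp add: sh)
  hence ne: "sigma h \<noteq> 0" by (intro notI) simp
  have "diamond (sigma h) (sigma S) \<noteq> 0"
  proof
    assume "diamond (sigma h) (sigma S) = 0"
    hence "diamond (sigma h) (sigma S) = diamond 0 (sigma S)" by simp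
    from inj_onD[OF reg[unfolded regular_def] this shF zF] ne show False by contradiction
  qed
  then obtain b d g where nz0: "diamond (sigma h) (sigma S) b d g \<noteq> 0" by (auto simp: fun_eq_iff)
  have d: "d = 0" using nz0 by (auto simp: diamond_def split: if_splits)
  have nz: "diamond (sigma h) (sigma S) b 0 g \<noteq> 0" using nz0 d by simp
  have "{(b1, k, i). b1 \<le> b \<and> dia_term (sigma h) (sigma S) b g (b1, k, i) \<noteq> 0} \<noteq> {}"
  proof
    assume e: "{(b1, k, i). b1 \<le> b \<and> dia_term (sigma h) (sigma S) b g (b1, k, i) \<noteq> 0} = {}"
    show False using nz unfolding diamond_def e by simp
  qed
  then obtain b1 k i where *: "b1 \<le> b" "dia_term (sigma h) (sigma S) b g (b1, k, i) \<noteq> 0" by blast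
  have s1: "sigma h b1 0 k \<noteq> 0" and s2: "sigma S (b - b1) i (\<lambda>t. g t - k t + int (i t)) \<noteq> 0"
    using *(2) by (auto simp: dia_term_def)
  have t: "tdeg b1 0 k = r" "h b1 0 k \<noteq> 0" using s1 unfolding sh by (auto split: if_splits)
  have t': "tdeg (b - b1) i (\<lambda>t. g t - k t + int (i t)) = \<mu>" "S (b - b1) i (\<lambda>t. g t - k t + int (i t)) \<noteq> 0"
    using s2 unfolding sS by (auto split: if_splits)
  have deg: "tdeg b 0 g = r + \<mu>"
    using dia_term_degree[OF hw Sw, OF *(1) t(2) t'(2)] t(1) t'(1) by linarith
  \<comment> \<open>The two degrees are at most \<open>r\<close> and \<open>\<mu>\<close> and add up
    to \<open>r + \<mu>\<close>, so both are extremal and only terms of the symbols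
    contribute.\<close>
  have eq: "dia_term h S b g (b1, k, i) = dia_term (sigma h) (sigma S) b g (b1, k, i)" if "b1 \<le> b" for b1 k i
  proof (cases "h b1 0 k \<noteq> 0 \<and> S (b - b1) i (\<lambda>t. g t - k t + int (i t)) \<noteq> 0")
    case True
    hence a: "h b1 0 k \<noteq> 0" and c: "S (b - b1) i (\<lambda>t. g t - k t + int (i t)) \<noteq> 0" by auto
    have "tdeg b1 0 k = r" "tdeg (b - b1) i (\<lambda>t. g t - k t + int (i t)) = \<mu>"
      using dia_term_degree[OF hw Sw, OF that a c] deg ordleD[OF r(1), OF a] ordleD[OF oS, OF c] by linarith+
    thus ?thesis unfolding dia_term_def sh sS by simp
  next
    case False
    hence "h b1 0 k = 0 \<or> S (b - b1) i (\<lambda>t. g t - k t + int (i t)) = 0" by blast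
    thus ?thesis unfolding dia_term_def sh sS prod.case by (elim disjE) simp_all
  qed
  have "diamond h S b 0 g = diamond (sigma h) (sigma S) b 0 g"
    unfolding diamond_def using eq by (auto intro!: sum.cong)
  hence "diamond h S b 0 g \<noteq> 0" using nz by simp
  from ordleD[OF o, OF this] deg have "r \<le> c" by simp
  thus ?thesis by (rule ordle_mono[OF r(1)])
qed

section \<open>Lexicographic minima and the absence of zero divisors\<close>

definition lex_le :: "nat \<Rightarrow> mexp \<Rightarrow> mexp \<Rightarrow> bool" where
  "lex_le N x y \<longleftrightarrow> (\<forall>i<N. y i = x i) \<or> (\<exists>i<N. x i < y i \<and> (\<forall>j<i. x j = y j))"

text \<open>The coordinates are minimised one after the other, each among the minimisers of the
  earlier ones. The minimum is determined on the first \<open>N\<close> coordinates only.\<close>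

lemma lex_min_exists:
  assumes "X \<noteq> {}" shows "\<exists>x\<in>X. \<forall>y\<in>X. lex_le N x y"
  unfolding lex_le_def
proof (induction N)
  case 0
  show ?case using assms by auto
next
  case (Suc N)
  then obtain x0 where x0: "x0 \<in> X" "\<And>y. y \<in> X \<Longrightarrow> (\<forall>i<N. y i = x0 i) \<or> (\<exists>i<N. x0 i < y i \<and> (\<forall>j<i. x0 j = y j))"
    by blast
  define Y where "Y = {y \<in> X. \<forall>i<N. y i = x0 i}"
  have "x0 \<in> Y" using x0 by (simp add: Y_def)
  from ex_has_least_nat[of "\<lambda>y. y \<in> Y", OF this, of "\<lambda>y. y N"]
  obtain x where x: "x \<in> Y" "\<And>y. y \<in> Y \<Longrightarrow> x N \<le> y N" by blast
  have xX: "x \<in> X" and xx: "\<And>i. i < N \<Longrightarrow> x i = x0 i" using x(1) by (auto simp: Y_def)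
  have "(\<forall>i<Suc N. y i = x i) \<or> (\<exists>i<Suc N. x i < y i \<and> (\<forall>j<i. x j = y j))" if "y \<in> X" for y
    using x0(2)[OF that]
  proof
    assume a: "\<forall>i<N. y i = x0 i"
    hence "x N \<le> y N" using x(2) that by (simp add: Y_def)
    thus ?thesis using a xx by (cases "x N = y N") (auto simp: less_Suc_eq intro!: exI[of _ N])
  next
    assume "\<exists>i<N. x0 i < y i \<and> (\<forall>j<i. x0 j = y j)"
    then obtain i where "i < N" "x0 i < y i" "\<forall>j<i. x0 j = y j" by blast
    thus ?thesis using xx by (intro disjI2 exI[of _ i]) auto
  qed
  thus ?case using xX by blast
qed

text \<open>If \<open>x'\<close> differed from \<open>x\<close>, the earlier of the first
  differences in the two pairs would be a coordinate where \<open>x' + y'\<close> strictly exceeds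
  \<open>x + y\<close>.\<close>

lemma lex_sum_eq:
  fixes x x' y y' :: mexp
  assumes x: "lex_le N x x'" and y: "lex_le N y y'"
    and s: "\<And>i. i < N \<Longrightarrow> x i + y i = x' i + y' i"
  shows "\<forall>i<N. x' i = x i"
proof (rule ccontr)
  assume n: "\<not> (\<forall>i<N. x' i = x i)"
  from x[unfolded lex_le_def] have "\<exists>i<N. x i < x' i \<and> (\<forall>j<i. x j = x' j)"
  proof
    assume "\<forall>i<N. x' i = x i" with n show ?thesis by contradiction
  qed
  then obtain i where i: "i < N" "x i < x' i" "\<forall>j<i. x j = x' j" by auto
  show False using y unfolding lex_le_def
  proof
    assume "\<forall>i<N. y' i = y i"
    thus False using i s[of i] by simp
  next
    assume "\<exists>i<N. y i < y' i \<and> (\<forall>j<i. y j = y' j)"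
    then obtain k where k: "k < N" "y k < y' k" "\<forall>j<k. y j = y' j" by blast
    consider "i < k" | "i = k" | "k < i" by linarith
    thus False
    proof cases
      case 1 thus False using i(2) k(3) s[OF i(1)] by auto
    next
      case 2 thus False using i(2) k(2) s[OF i(1)] by auto
    next
      case 3 thus False using i(3) k(2) s[OF k(1)] by auto
    qed
  qed
qed

text \<open>The exponent of \<open>\<partial>_n\<close> is omitted: it may be negative, so
  minimising it need not succeed, and within one degree the other entries determine it.\<close>

definition lex_key :: "nat \<Rightarrow> nat \<Rightarrow> mexp \<Rightarrow> dexp \<Rightarrow> mexp" where
  "lex_key m n b k = (\<lambda>i. if i < m then b i else if i < m + (n - 1) then nat (k (i - m)) else 0)"

lemma lex_key_inject:
  assumes n: "1 \<le> n" and P: "wf_op m n P" and "P b d k \<noteq> 0" "P b' d k' \<noteq> 0"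
    and deg: "tdeg b d k = tdeg b' d k'"
    and key: "\<forall>i<m + (n - 1). lex_key m n b' k' i = lex_key m n b k i"
  shows "b' = b" "k' = k"
proof -
  note w = wf_opD[OF P, OF assms(3)] and w' = wf_opD[OF P, OF assms(4)]
  show bb: "b' = b"
  proof
    fix i show "b' i = b i"
    proof (cases "i < m")
      case True
      hence "i < m + (n - 1)" by simp
      from key[rule_format, OF this] True show ?thesis by (simp add: lex_key_def)
    qed (use w(1) w'(1) in \<open>simp add: supp_below_def\<close>)
  qed
  have kk: "k' i = k i" if i: "i < n - 1" for i
  proof -
    have "m + i < m + (n - 1)" using i by simp
    note c = this
    have "lex_key m n x y (m + i) = nat (y i)" for x y
      by (simp only: lex_key_def c if_True add_diff_cancel_left' not_add_less1 if_False)
    with key[rule_format, OF c] have "nat (k' i) = nat (k i)" by simp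
    moreover have "0 \<le> k i" "0 \<le> k' i" using w(4) w'(4) i by auto
    ultimately show ?thesis by simp
  qed
  have split: "(\<Sum>i<n. f i) = (\<Sum>i<n - 1. f i) + f (n - 1)" for f :: dexp
  proof -
    have "n = Suc (n - 1)" using n by simp
    thus ?thesis using sum.lessThan_Suc[of f "n - 1"] by simp
  qed
  have "ddeg k' = ddeg k" using deg bb by simp
  moreover have "(\<Sum>i<n - 1. k' i) = (\<Sum>i<n - 1. k i)" using kk by (intro sum.cong) auto
  ultimately have last: "k' (n - 1) = k (n - 1)"
    unfolding ddeg_eq[OF w(3)] ddeg_eq[OF w'(3)] split by simp
  show "k' = k"
  proof
    fix i
    consider "i < n - 1" | "i = n - 1" | "n \<le> i" by linarith
    thus "k' i = k i" using kk last w(3) w'(3) by cases (auto simp: supp_below_def)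
  qed
qed

text \<open>The top-degree parts of \<open>S\<close> and \<open>f\<close> are power series in
  \<open>y\<^sub>1, \<dots>, y\<^sub>m, \<partial>\<^sub>1, \<dots>, \<partial>\<^bsub>n-1\<^esub>\<close> (the exponent of \<open>\<partial>\<^sub>n\<close> is determined by the degree), so
  their lexicographically least terms multiply to a term that nothing can cancel.\<close>

lemma ordle_comp_const_cancel:
  fixes S f :: "'k::field_char_0 op"
  assumes n: "1 \<le> n" and S: "S \<in> Pihat m n" and os: "op_ord S = ereal (of_int \<mu>)"
    and f: "f \<in> Pihat m n" "const_op f" and o: "ordle (op_comp S f) (c + \<mu>)"
  shows "ordle f c"
proof (cases "\<exists>b d k. f b d k \<noteq> 0")
  case False thus ?thesis by (simp add: ordle_def)
next
  case True
  have Sw: "wf_op m n S" and fw: "wf_op m n f" using S f by (auto simp: Pihat_iff)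
  obtain c0 where c0: "ordle f c0" using f by (auto simp: Pihat_iff)
  from True obtain b d k where "f b d k \<noteq> 0" by blast
  from ordle_max_attained[OF c0, OF this] obtain r bf df kf where r: "ordle f r" "f bf df kf \<noteq> 0" "tdeg bf df kf = r"
    by blast
  have "df = 0" using r(2) f(2) unfolding const_op_def by blast
  hence r2: "f bf 0 kf \<noteq> 0" "tdeg bf 0 kf = r" using r by auto
  obtain bs d0 ks where oS: "ordle S \<mu>" and s: "S bs d0 ks \<noteq> 0" "tdeg bs d0 ks = \<mu>"
    using op_ord_attained[OF os] .
  let ?e = "\<lambda>(b, k). lex_key m n b k" and ?N = "m + (n - 1)"
  \<comment> \<open>\<open>d0\<close> stays fixed: \<open>f\<close> contributes no power of x, so
    only terms of \<open>S\<close> with this \<open>x^d0\<close> can meet in the coefficient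
    examined.\<close>
  define XS where "XS = {(b, k). S b d0 k \<noteq> 0 \<and> tdeg b d0 k = \<mu>}"
  define XF where "XF = {(b, k). f b 0 k \<noteq> 0 \<and> tdeg b 0 k = r}"
  have "?e ` XS \<noteq> {}" using s by (auto simp: XS_def)
  from lex_min_exists[OF this, of ?N] have "\<exists>z\<in>XS. \<forall>y\<in>XS. lex_le ?N (?e z) (?e y)" by blast
  then obtain z1 where z1: "z1 \<in> XS" "\<And>y. y \<in> XS \<Longrightarrow> lex_le ?N (?e z1) (?e y)" by blast
  obtain b1 k1 where z1': "z1 = (b1, k1)" by (cases z1)
  have m1: "(b1, k1) \<in> XS" using z1(1) unfolding z1' .
  have l1: "lex_le ?N (lex_key m n b1 k1) (lex_key m n b k)" if "(b, k) \<in> XS" for b k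
    using z1(2)[OF that] unfolding z1' prod.case .
  have "?e ` XF \<noteq> {}" using r2 by (auto simp: XF_def)
  from lex_min_exists[OF this, of ?N] have "\<exists>z\<in>XF. \<forall>y\<in>XF. lex_le ?N (?e z) (?e y)" by blast
  then obtain z2 where z2: "z2 \<in> XF" "\<And>y. y \<in> XF \<Longrightarrow> lex_le ?N (?e z2) (?e y)" by blast
  obtain b2 k2 where z2': "z2 = (b2, k2)" by (cases z2)
  have m2: "(b2, k2) \<in> XF" using z2(1) unfolding z2' .
  have l2: "lex_le ?N (lex_key m n b2 k2) (lex_key m n b k)" if "(b, k) \<in> XF" for b k
    using z2(2)[OF that] unfolding z2' prod.case .
  have S1: "S b1 d0 k1 \<noteq> 0" "tdeg b1 d0 k1 = \<mu>" using m1 by (auto simp: XS_def)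
  have f2: "f b2 0 k2 \<noteq> 0" "tdeg b2 0 k2 = r" using m2 by (auto simp: XF_def)
  note w1 = wf_opD[OF Sw, OF S1(1)] and w2 = wf_opD[OF fw, OF f2(1)]
  define B where "B = b1 + b2"
  define G where "G = (\<lambda>i. k1 i + k2 i)"
  have B: "b1 \<le> B" "B - b1 = b2" by (auto simp: B_def le_fun_def fun_eq_iff)
  have dz: "d0 - d0 + 0 = (0::mexp)" by (rule ext) simp
  have Gk: "(\<lambda>i. G i - k1 i + int ((0::mexp) i)) = k2" by (rule ext) (simp add: G_def)
  have "f (B - b1) (d0 - d0 + 0) (\<lambda>i. G i - k1 i + int ((0::mexp) i)) \<noteq> 0"
    unfolding B(2) dz Gk by (rule f2(1))
  from term_degree(5)[OF Sw fw, OF B(1) order_refl S1(1) this]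
  have deg: "tdeg B d0 G = \<mu> + r" unfolding B(2) dz Gk S1(2) f2(2) .
  let ?t = "op_term S f B d0 G"
  have tv: "?t (b1, d0, k1, 0) = S b1 d0 k1 * f b2 0 k2"
    unfolding op_term_def prod.case B(2) dz Gk by simp
  have uniq: "(b', d', k', j) = (b1, d0, k1, 0)" if le: "b' \<le> B" "d' \<le> d0" and nz: "?t (b', d', k', j) \<noteq> 0" for b' d' k' j
  proof -
    have p: "S b' d' k' \<noteq> 0" and q: "f (B - b') (d0 - d' + j) (\<lambda>i. G i - k' i + int (j i)) \<noteq> 0"
      using nz by (auto simp: op_term_def)
    have z: "d0 - d' + j = 0" using q f(2) unfolding const_op_def by blast
    have j: "j = 0" using z by (auto simp: fun_eq_iff)
    have d': "d' = d0"
    proof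
      fix i show "d' i = d0 i" using fun_cong[OF z, of i] le_funD[OF le(2), of i] by simp
    qed
    have jj: "(\<lambda>i. G i - k' i + int (j i)) = (\<lambda>i. G i - k' i)" by (rule ext) (simp add: j)
    have p': "S b' d0 k' \<noteq> 0" using p d' by simp
    have q': "f (B - b') 0 (\<lambda>i. G i - k' i) \<noteq> 0" using q unfolding z jj .
    have "tdeg B d0 G = tdeg b' d0 k' + tdeg (B - b') 0 (\<lambda>i. G i - k' i)"
      using term_degree(5)[OF Sw fw, OF le p q] unfolding z jj unfolding d' .
    hence dd: "tdeg b' d0 k' = \<mu>" "tdeg (B - b') 0 (\<lambda>i. G i - k' i) = r"
      using deg ordleD[OF oS, OF p'] ordleD[OF r(1), OF q'] by linarith+
    have "(b', k') \<in> XS" "(B - b', \<lambda>i. G i - k' i) \<in> XF" using p' q' dd by (auto simp: XS_def XF_def)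
    note ll = l1[OF this(1)] l2[OF this(2)]
    note w3 = wf_opD[OF Sw, OF p'] and w4 = wf_opD[OF fw, OF q']
    have "\<forall>i<?N. lex_key m n b' k' i = lex_key m n b1 k1 i"
    proof (rule lex_sum_eq[OF ll])
      fix i assume i: "i < ?N"
      show "lex_key m n b1 k1 i + lex_key m n b2 k2 i = lex_key m n b' k' i + lex_key m n (B - b') (\<lambda>i. G i - k' i) i"
      proof (cases "i < m")
        case True
        thus ?thesis using le_funD[OF le(1), of i] by (simp add: lex_key_def B_def)
      next
        case False
        hence "i - m + 1 < n" using i by linarith
        note pos = w1(4)[OF this] w2(4)[OF this] w3(4)[OF this] w4(4)[OF this]
        have "nat (k1 (i - m)) + nat (k2 (i - m)) = nat (k' (i - m)) + nat (G (i - m) - k' (i - m))"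
          using pos by (simp add: G_def flip: nat_add_distrib)
        thus ?thesis using False i by (simp add: lex_key_def)
      qed
    qed
    from lex_key_inject[OF n Sw, OF S1(1) p' _ this] dd S1 j d' show ?thesis by simp
  qed
  have "{(b', d', k', j). b' \<le> B \<and> d' \<le> d0 \<and> ?t (b', d', k', j) \<noteq> 0} = {(b1, d0, k1, 0)}"
  proof (intro set_eqI iffI)
    fix x assume "x \<in> {(b', d', k', j). b' \<le> B \<and> d' \<le> d0 \<and> ?t (b', d', k', j) \<noteq> 0}"
    thus "x \<in> {(b1, d0, k1, 0)}" using uniq by auto
  qed (use tv S1(1) f2(1) B(1) in auto)
  hence "op_comp S f B d0 G = S b1 d0 k1 * f b2 0 k2" unfolding op_comp_def using tv by simp
  hence "op_comp S f B d0 G \<noteq> 0" using S1(1) f2(1) by simp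
  from ordleD[OF o, OF this] deg have "r \<le> c" by simp
  thus ?thesis by (rule ordle_mono[OF r(1)])
qed

section \<open>Prerequisites of the dimension count\<close>

lemma vector_space_scaleK: "vector_space (scaleK :: 'k::field \<Rightarrow> 'k op \<Rightarrow> 'k op)"
  by unfold_locales (simp_all add: scaleK_def fun_eq_iff algebra_simps)

text \<open>Stars and bars: appending the slack \<open>K - |l|\<close> to the entries of
  \<open>l\<close> gives \<open>n + 1\<close> natural numbers with sum \<open>K\<close>.\<close>

lemma card_simplex: "finite {l. supp_below n l \<and> mdeg l \<le> K}" "card {l. supp_below n l \<and> mdeg l \<le> K} \<le> (n + K) choose n"
proof -
  let ?A = "{l. supp_below n l \<and> mdeg l \<le> K}" and ?B = "{xs::nat list. length xs = n + 1 \<and> sum_list xs = K}"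
  define e where "e = (\<lambda>l::mexp. map l [0..<n] @ [K - mdeg l])"
  have fin: "finite ?B" by (rule finite_subset[OF _ finite_lists_length_eq[of "{..K}" "n + 1"]])
      (auto simp: member_le_sum_list)
  have inj: "inj_on e ?A"
  proof (rule inj_onI, rule ext)
    fix l l' i assume a: "l \<in> ?A" "l' \<in> ?A" "e l = e l'"
    show "l i = l' i"
    proof (cases "i < n")
      case True
      have "map l [0..<n] = map l' [0..<n]" using a(3) by (simp add: e_def)
      thus ?thesis using True by (simp add: list_eq_iff_nth_eq)
    qed (use a in \<open>auto simp: supp_below_def\<close>)
  qed
  have sub: "e ` ?A \<subseteq> ?B"
  proof
    fix xs assume "xs \<in> e ` ?A"
    then obtain l where l: "supp_below n l" "mdeg l \<le> K" "xs = e l" by auto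
    have "sum_list (map l [0..<n]) = mdeg l"
      unfolding mdeg_eq[OF l(1)] by (simp add: interv_sum_list_conv_sum_set_nat lessThan_atLeast0)
    thus "xs \<in> ?B" using l by (simp add: e_def)
  qed
  show "finite ?A" using finite_imageD[OF finite_subset[OF sub fin] inj] .
  have "card ?A \<le> card ?B" by (rule card_inj_on_le[OF inj sub fin])
  also have "\<dots> = (K + n) choose K" using card_length_sum_list[of "n + 1" K] by simp
  also have "\<dots> = (n + K) choose n" using binomial_symmetric[of K "K + n"] by (simp add: add.commute)
  finally show "card ?A \<le> (n + K) choose n" .
qed

section \<open>Sato operators\<close>

lemma diamond_Dsym:
  assumes n: "1 \<le> n" and h: "h \<in> Dsym m n" and P: "wf_op m n P" and c: "ordle h c"
    and b: "supp_below m b" and r: "c + int (mdeg b) \<le> int r"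
  shows "diamond h P b 0 g = (\<Sum>b1\<in>{..b}. \<Sum>l\<in>{..box n r}. h b1 0 (ints l) * Dpow l P (b - b1) 0 g)"
proof -
  have z: "(0::mexp) - 0 = 0" by (rule ext) simp
  have r': "c + int (mdeg b) + int (mdeg 0) \<le> int r" using r by simp
  show ?thesis
    unfolding diamond_eq restr_def using op_comp_Dsym[OF n h P c b supp_below_zero r', of g]
    by (simp add: atMost_zero_mexp z)
qed

text \<open>Otherwise the space \<open>bar W\<^sub>k\<close> would be spanned by fewer than \<open>binom(n + k - \<mu>, n)\<close> elements.\<close>

lemma sato_bar_independent:
  fixes S :: "'k::field_char_0 op"
  assumes n: "1 \<le> n" and sato: "is_sato m n \<mu> W S"
    and rel: "\<And>g. (\<Sum>l\<in>{..box n r}. p l * Dpow l S 0 0 g) = 0" and l0: "l0 \<le> box n r"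
  shows "p l0 = 0"
proof (rule ccontr)
  assume nz: "p l0 \<noteq> 0"
  have S: "S \<in> Pihat m n" and reg: "regular m n S" and os: "op_ord S = ereal (of_int \<mu>)"
    and W: "W = (\<lambda>f. diamond f S) ` Fn m n" and Gr: "W \<in> Gr m n \<mu>"
    using sato unfolding is_sato_def by blast+
  have Sw: "wf_op m n S" using S by (simp add: Pihat_iff)
  interpret vs: vector_space "scaleK :: 'k \<Rightarrow> 'k op \<Rightarrow> 'k op" by (rule vector_space_scaleK)
  \<comment> \<open>The largest degree in the box, so that the whole relation lies among the
    exponents of degree at most \<open>K\<close>.\<close>
  define K where "K = mdeg (box n r)"
  define \<Lambda> where "\<Lambda> = {l. supp_below n l \<and> mdeg l \<le> K}"
  define v where "v = (\<lambda>l b d g. if b = (0::mexp) \<and> d = (0::mexp) then Dpow l S 0 0 g else 0)"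
  have fin: "finite \<Lambda>" and card: "card \<Lambda> \<le> (n + K) choose n" unfolding \<Lambda>_def by (rule card_simplex)+
  have box: "{..box n r} \<subseteq> \<Lambda>"
  proof
    fix l assume "l \<in> {..box n r}"
    hence "l \<le> box n r" by simp
    from supp_below_mono[OF supp_below_box this] mdeg_mono[OF supp_below_box this]
    show "l \<in> \<Lambda>" by (simp add: \<Lambda>_def K_def)
  qed
  have fbox: "finite {..box n r}" by (rule finite_below[OF supp_below_box])
  define X where "X = v ` (\<Lambda> - {l0})"
  have vl: "v l \<in> vs.span X" if "l \<in> \<Lambda>" "l \<noteq> l0" for l
    using that by (intro vs.span_base) (auto simp: X_def)
  have "v l0 = (\<Sum>l\<in>{..box n r} - {l0}. scaleK (- p l / p l0) (v l))"
  proof (intro ext)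
    fix b d g
    have "p l0 * Dpow l0 S 0 0 g + (\<Sum>l\<in>{..box n r} - {l0}. p l * Dpow l S 0 0 g) = 0"
      using rel[of g] l0 sum.remove[OF fbox, of l0 "\<lambda>l. p l * Dpow l S 0 0 g"] by simp
    hence "Dpow l0 S 0 0 g = - (\<Sum>l\<in>{..box n r} - {l0}. p l * Dpow l S 0 0 g) / p l0"
      using nz by (simp add: field_simps eq_neg_iff_add_eq_0)
    also have "\<dots> = (\<Sum>l\<in>{..box n r} - {l0}. (- p l / p l0) * Dpow l S 0 0 g)"
      by (simp add: sum_divide_distrib sum_negf)
    finally have "Dpow l0 S 0 0 g = (\<Sum>l\<in>{..box n r} - {l0}. (- p l / p l0) * Dpow l S 0 0 g)" .
    moreover have app: "(\<Sum>l\<in>I. F l) b d g = (\<Sum>l\<in>I. F l b d g)" for I :: "mexp set" and F :: "mexp \<Rightarrow> 'k op"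
      by (induction I rule: infinite_finite_induct) auto
    ultimately show "v l0 b d g = (\<Sum>l\<in>{..box n r} - {l0}. scaleK (- p l / p l0) (v l)) b d g"
      unfolding app by (cases "b = 0"; cases "d = 0") (simp_all add: v_def scaleK_def)
  qed
  also have "\<dots> \<in> vs.span X" using box by (intro vs.span_sum vs.span_scale vl) auto
  finally have v_span: "v l \<in> vs.span X" if "l \<in> \<Lambda>" for l using vl that by (cases "l = l0") auto
  have "bar ` Wk W (\<mu> + int K) \<subseteq> vs.span X"
  proof
    fix x assume "x \<in> bar ` Wk W (\<mu> + int K)"
    then obtain f where f: "f \<in> Fn m n" and x: "x = bar (diamond f S)"
      and "op_ord (diamond f S) \<le> ereal (of_int (\<mu> + int K))" unfolding Wk_def W by blast
    hence "ordle (diamond f S) (int K + \<mu>)" unfolding op_ord_le_iff by (simp add: add.commute)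
    \<comment> \<open>Regularity turns the order bound on the element of \<open>W\<close> into one
      on \<open>f\<close>, so only \<open>\<partial>^l\<close> with \<open>|l| \<le> K\<close>
      enter.\<close>
    hence o: "ordle f (int K)" by (rule ordle_diamond_cancel[OF S reg os f])
    have fD: "f \<in> Dsym m n" by (rule Fn_Dsym[OF f])
    have K0: "int K + int (mdeg 0) \<le> int K" by simp
    have z: "(0::mexp) - 0 = 0" by (rule ext) simp
    have "diamond f S 0 0 g = (\<Sum>l\<in>{..box n K}. f 0 0 (ints l) * Dpow l S 0 0 g)" for g
      using diamond_Dsym[OF n fD Sw o supp_below_zero K0] by (simp add: atMost_zero_mexp z)
    also have "\<dots> g = (\<Sum>l\<in>\<Lambda>. f 0 0 (ints l) * Dpow l S 0 0 g)" for g
    proof (rule sum.mono_neutral_right)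
      show "finite {..box n K}" by (rule finite_below[OF supp_below_box])
      show "\<Lambda> \<subseteq> {..box n K}" using le_box_mdeg by (auto simp: \<Lambda>_def)
      show "\<forall>l\<in>{..box n K} - \<Lambda>. f 0 0 (ints l) * Dpow l S 0 0 g = 0"
      proof (intro ballI, rule ccontr)
        fix l assume l: "l \<in> {..box n K} - \<Lambda>" and "f 0 0 (ints l) * Dpow l S 0 0 g \<noteq> 0"
        hence nz: "f 0 0 (ints l) \<noteq> 0" by auto
        have ls: "supp_below n l" using supp_below_mono[OF supp_below_box] l by auto
        from ordleD[OF o, OF nz] ddeg_ints[OF ls] have "mdeg l \<le> K" by simp
        thus False using l ls by (simp add: \<Lambda>_def)
      qed
    qed
    finally have dia: "diamond f S 0 0 g = (\<Sum>l\<in>\<Lambda>. f 0 0 (ints l) * Dpow l S 0 0 g)" for g .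
    have "x = (\<Sum>l\<in>\<Lambda>. scaleK (f 0 0 (ints l)) (v l))"
    proof (intro ext)
      fix b d g
      have app: "(\<Sum>l\<in>I. F l) b d g = (\<Sum>l\<in>I. F l b d g)" for I :: "mexp set" and F :: "mexp \<Rightarrow> 'k op"
        by (induction I rule: infinite_finite_induct) auto
      have d0: "diamond f S 0 d g = 0" if "d \<noteq> 0" using that by (simp add: diamond_def)
      show "x b d g = (\<Sum>l\<in>\<Lambda>. scaleK (f 0 0 (ints l)) (v l)) b d g"
        unfolding app x by (cases "b = 0"; cases "d = 0") (simp_all add: v_def scaleK_def bar_def dia d0)
    qed
    thus "x \<in> vs.span X" using v_span by (simp add: vs.span_sum vs.span_scale)
  qed
  moreover have "finite X" using fin by (simp add: X_def)
  ultimately have "HW W (\<mu> + int K) \<le> card X" unfolding HW_def by (rule vs.dim_le_card)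
  also have "\<dots> \<le> card (\<Lambda> - {l0})" unfolding X_def using fin by (intro card_image_le) simp
  also have "\<dots> < card \<Lambda>" using fin l0 box by (intro card_Diff1_less) auto
  also have "\<dots> \<le> (n + K) choose n" by (rule card)
  also have "\<dots> = HW W (\<mu> + int K)" using Gr unfolding Gr_def binomZ_def by simp
  finally show False by simp
qed

text \<open>Regularity does not give this: it concerns \<open>F\<close>, whose elements are bounded in \<open>\<partial>\<^sub>n\<close>, while the
  slices of an element of \<open>Dsym\<close> need not be. Comparing coefficients of lowest \<open>y\<close>-degree reduces
  the claim to polynomials in \<open>\<partial>\<close> acting on \<open>bar S\<close>.\<close>

lemma sato_diamond_inject:
  fixes S :: "'k::field_char_0 op"
  assumes n: "1 \<le> n" and sato: "is_sato m n \<mu> W S" and h: "h \<in> Dsym m n" and z: "diamond h S = 0"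
  shows "h b 0 g = 0"
proof (rule ccontr)
  assume nz: "h b 0 g \<noteq> 0"
  have Sw: "wf_op m n S" using sato unfolding is_sato_def Pihat_iff by blast
  have hw: "wf_op m n h" using h by (simp add: Dsym_iff)
  define Y where "Y = {b. \<exists>g. h b 0 g \<noteq> 0}"
  have "b \<in> Y" using nz by (auto simp: Y_def)
  from ex_has_least_nat[of "\<lambda>b. b \<in> Y", OF this, of mdeg]
  obtain b0 where b0: "b0 \<in> Y" and min: "\<And>b. b \<in> Y \<Longrightarrow> mdeg b0 \<le> mdeg b" by blast
  obtain g0 where g0: "h b0 0 g0 \<noteq> 0" using b0 by (auto simp: Y_def)
  have bs: "supp_below m b0" by (rule wf_opD(1)[OF hw, OF g0])
  have low: "h b1 0 k = 0" if "b1 \<le> b0" "b1 \<noteq> b0" for b1 k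
  proof (rule ccontr)
    assume "h b1 0 k \<noteq> 0"
    hence "b1 \<in> Y" by (auto simp: Y_def)
    from min[OF this] mdeg_strict_mono[OF bs that] show False by simp
  qed
  obtain c where c: "ordle h c" using h by (auto simp: Dsym_iff)
  define r where "r = nat (c + int (mdeg b0))"
  have r: "c + int (mdeg b0) \<le> int r" by (simp add: r_def)
  have bb: "b0 - b0 = 0" by (rule ext) simp
  have "(\<Sum>l\<in>{..box n r}. h b0 0 (ints l) * Dpow l S 0 0 g) = 0" for g
  proof -
    have "0 = diamond h S b0 0 g" using z by simp
    also have "\<dots> = (\<Sum>b1\<in>{..b0}. \<Sum>l\<in>{..box n r}. h b1 0 (ints l) * Dpow l S (b0 - b1) 0 g)"
      by (rule diamond_Dsym[OF n h Sw c bs r])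
    also have "\<dots> = (\<Sum>b1\<in>{b0}. \<Sum>l\<in>{..box n r}. h b1 0 (ints l) * Dpow l S (b0 - b1) 0 g)"
      using low finite_below[OF bs] by (intro sum.mono_neutral_right) auto
    finally show ?thesis by (simp add: bb)
  qed
  note ind = sato_bar_independent[OF n sato, where r = r and p = "\<lambda>l. h b0 0 (ints l)", OF this]
  define l where "l = (\<lambda>i. nat (g0 i))"
  have gl: "g0 = ints l" using Dsym_nonneg[OF h, OF g0 n] by (auto simp: l_def)
  have ls: "supp_below n l" using wf_opD(3)[OF hw, OF g0] by (simp add: supp_below_def l_def)
  have "mdeg l \<le> r" using ordleD[OF c, OF g0] ddeg_ints[OF ls] unfolding gl[symmetric] r_def by simp
  from ind[OF le_box_mdeg[OF ls this]] g0 gl show False by simp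
qed

lemma Dpow_0 [simp]: "Dpow k 0 = 0"
  by (simp add: Dpow_def shiftsum_def fun_eq_iff)

text \<open>Put \<open>D = L - M\<close>. Since \<open>\<partial>^k\<close> passes through the
  product, \<open>(\<partial>^k \<circ> D) \<diamond> S\<close> is
  \<open>\<partial>^k \<circ> (D \<circ> S)\<close> at \<open>x = 0\<close>, hence 0. So every slice
  of \<open>D\<close> vanishes, and with them \<open>D\<close>.\<close>

lemma sato_left_cancel:
  fixes S :: "'k::field_char_0 op"
  assumes n: "1 \<le> n" and sato: "is_sato m n \<mu> W S" and L: "L \<in> Dsym m n" and M: "M \<in> Dsym m n"
    and eq: "op_comp L S = op_comp M S"
  shows "L = M"
proof -
  have Sw: "wf_op m n S" using sato unfolding is_sato_def Pihat_iff by blast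
  define D where "D = L + scaleK (-1) M"
  have D: "D \<in> Dsym m n" unfolding D_def by (rule Dsym_add[OF L Dsym_scale[OF M]])
  have Dw: "wf_op m n D" using D by (simp add: Dsym_iff)
  have DS: "op_comp D S = 0"
    unfolding D_def op_comp_add_left[OF n L Dsym_scale[OF M] Sw] op_comp_scale_left eq
    by (simp add: scaleK_def fun_eq_iff)
  have D0: "D = 0"
  proof (rule op_eqI_restr[OF Dw])
    show "wf_op m n (0 :: 'k op)" by (simp add: wf_op_def)
    fix k :: mexp and b g assume k: "supp_below n k"
    have DkD: "Dpow k D \<in> Dsym m n" using Dpow_props[OF k Dw] n D by blast
    have "diamond (Dpow k D) S = restr (Dpow k (op_comp D S))"
      unfolding diamond_eq Dpow_comp[OF n D Sw k] ..
    also have "\<dots> = 0" unfolding DS by (simp add: restr_def fun_eq_iff)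
    finally show "Dpow k D b 0 g = Dpow k 0 b 0 g"
      using sato_diamond_inject[OF n sato DkD] by simp
  qed
  show ?thesis
  proof (intro ext)
    fix b d k
    have "L b d k - M b d k = D b d k" by (simp add: D_def scaleK_def)
    thus "L b d k = M b d k" unfolding D0 by simp
  qed
qed

lemma ordle_restr:
  assumes "ordle P c" shows "ordle (restr P) c"
  unfolding ordle_def
proof (intro allI impI)
  fix b d k assume "restr P b d k \<noteq> 0"
  hence "P b d k \<noteq> 0" by (auto simp: restr_def split: if_splits)
  from ordleD[OF assms, OF this] show "tdeg b d k \<le> c" .
qed

text \<open>The order bound comes from the construction: for \<open>f\<close> of order at most
  \<open>c\<close>, \<open>(\<partial>^k \<circ> S) \<circ> f\<close> has order at most
  \<open>\<mu> + |k| + c\<close>, and cancelling \<open>S\<close> leaves \<open>c + |k|\<close> for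
  \<open>h k\<close>, exactly the growth that \<open>from_restr_Dsym\<close> converts into the bound
  \<open>c\<close> for \<open>L\<close>.\<close>

lemma schur_operator_exists:
  fixes S :: "'k::field_char_0 op"
  assumes n: "1 \<le> n" and sato: "is_sato m n \<mu> W S" and f: "f \<in> Pihat m n" "const_op f"
    and WA: "\<And>w. w \<in> W \<Longrightarrow> op_comp w f \<in> W"
  shows "\<exists>L\<in>Dsym m n. op_comp S f = op_comp L S \<and> (\<forall>c. ordle f c \<longrightarrow> ordle L c)"
proof -
  have S: "S \<in> Pihat m n" and reg: "regular m n S" and os: "op_ord S = ereal (of_int \<mu>)"
    and W: "W = (\<lambda>f. diamond f S) ` Fn m n"
    using sato unfolding is_sato_def by blast+
  have Sw: "wf_op m n S" and fw: "wf_op m n f" using S f by (auto simp: Pihat_iff)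
  have oS: "ordle S \<mu>" unfolding op_ord_le_iff[symmetric] os by simp
  have "\<exists>h. h \<in> Fn m n \<and> diamond h S = restr (op_comp (Dpow k S) f)" if k: "supp_below n k" for k :: mexp
  proof -
    have "diamond (dmono k) S \<in> W" unfolding W using dmono_Fn[OF k] by blast
    hence "restr (Dpow k S) \<in> W" unfolding diamond_eq op_comp_dmono[OF n Sw k] .
    from WA[OF this] have "restr (op_comp (Dpow k S) f) \<in> W" unfolding op_comp_restr_const[OF f(2)] .
    thus ?thesis unfolding W by force
  qed
  then obtain h where h: "\<And>k. supp_below n k \<Longrightarrow> h k \<in> Fn m n"
    and hS: "\<And>k. supp_below n k \<Longrightarrow> diamond (h k) S = restr (op_comp (Dpow k S) f)" by metis
  define L where "L = from_restr n h"
  have hD: "h k \<in> Dsym m n" if "supp_below n k" for k using Fn_Dsym h that by blast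
  have ord: "ordle L c" if c: "ordle f c" for c
    unfolding L_def
  proof (rule from_restr_Dsym(3)[OF n hD])
    fix k :: mexp assume k: "supp_below n k"
    have "ordle (Dpow k S) (\<mu> + int (mdeg k))" "wf_op m n (Dpow k S)"
      using Dpow_props[OF k Sw] oS by blast+
    hence "ordle (op_comp (Dpow k S) f) (\<mu> + int (mdeg k) + c)"
      using ordle_op_comp[OF _ fw _ c] by blast
    hence "ordle (diamond (h k) S) (\<mu> + int (mdeg k) + c)"
      unfolding hS[OF k] by (rule ordle_restr)
    moreover have "\<mu> + int (mdeg k) + c = c + int (mdeg k) + \<mu>" by simp
    ultimately have "ordle (diamond (h k) S) (c + int (mdeg k) + \<mu>)" by simp
    thus "ordle (h k) (c + int (mdeg k))" by (rule ordle_diamond_cancel[OF S reg os h[OF k]])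
  qed
  obtain c where c: "ordle f c" using f by (auto simp: Pihat_iff)
  have L: "L \<in> Dsym m n"
    unfolding Dsym_iff using from_restr_Dsym(1,2)[of n h m, OF n hD] ord[OF c] unfolding L_def by blast
  have Lw: "wf_op m n L" using L by (simp add: Dsym_iff)
  have "op_comp S f = op_comp L S"
  proof (rule op_eqI_restr[OF wf_op_comp[OF Sw fw] wf_op_comp[OF Lw Sw]])
    fix k :: mexp and b g assume k: "supp_below n k"
    have "Dpow k (op_comp L S) b 0 g = diamond (Dpow k L) S b 0 g"
      unfolding diamond_eq Dpow_comp[OF n L Sw k] by (simp add: restr_def)
    \<comment> \<open>\<open>\<diamond>\<close> sees its left argument only at \<open>x = 0\<close>,
      where \<open>\<partial>^k \<circ> L\<close> equals \<open>h k\<close> by construction.\<close>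
    also have "diamond (Dpow k L) S = diamond (h k) S"
      by (rule diamond_cong) (simp add: L_def Dpow_from_restr[OF k])
    also have "diamond (h k) S b 0 g = op_comp (Dpow k S) f b 0 g"
      unfolding hS[OF k] by (simp add: restr_def)
    also have "\<dots> = Dpow k (op_comp S f) b 0 g"
    proof (cases "supp_below m b")
      case True
      from Dpow_const[OF n S f True supp_below_zero k] show ?thesis by simp
    next
      case False
      have w: "wf_op m n (op_comp (Dpow k S) f)" "wf_op m n (Dpow k (op_comp S f))"
        using Dpow_props[OF k Sw] Dpow_props[OF k wf_op_comp[OF Sw fw]] wf_op_comp[OF _ fw] by blast+
      have "op_comp (Dpow k S) f b 0 g = 0" using wf_opD(1)[OF w(1), of b 0 g] False by blast
      moreover have "Dpow k (op_comp S f) b 0 g = 0" using wf_opD(1)[OF w(2), of b 0 g] False by blast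
      ultimately show ?thesis by simp
    qed
    finally show "Dpow k (op_comp S f) b 0 g = Dpow k (op_comp L S) b 0 g" by (rule sym)
  qed
  thus ?thesis using L ord by blast
qed

lemma one_op_dmono: "one_op = dmono 0"
  by (auto simp: one_op_def dmono_def fun_eq_iff)

lemma op_comp_one_right:
  fixes P :: "'k::field_char_0 op"
  shows "op_comp P one_op = P"
proof (intro ext)
  fix b d g
  let ?t = "op_term P one_op b d g"
  have uniq: "(b1, d1, k, j) = (b, d, g, 0)" if le: "b1 \<le> b" "d1 \<le> d" and nz: "?t (b1, d1, k, j) \<noteq> 0" for b1 d1 k j
  proof -
    have q: "one_op (b - b1) (d - d1 + j) (\<lambda>i. g i - k i + int (j i)) \<noteq> (0::'k)" using nz by (auto simp: op_term_def)
    hence z: "b - b1 = 0" "d - d1 + j = 0" "(\<lambda>i. g i - k i + int (j i)) = 0"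
      by (auto simp: one_op_def split: if_splits)
    have j: "j = 0" using z(2) by (auto simp: fun_eq_iff)
    moreover have "b1 = b"
    proof
      fix i show "b1 i = b i" using fun_cong[OF z(1), of i] le_funD[OF le(1), of i] by simp
    qed
    moreover have "d1 = d"
    proof
      fix i show "d1 i = d i" using fun_cong[OF z(2), of i] le_funD[OF le(2), of i] by simp
    qed
    moreover have "k = g"
    proof
      fix i show "k i = g i" using fun_cong[OF z(3), of i] j by simp
    qed
    ultimately show ?thesis by simp
  qed
  have z: "b - b = 0" "d - d + 0 = 0" "(\<lambda>i. g i - g i + int ((0::mexp) i)) = 0" by (rule ext, simp)+
  have tv: "?t (b, d, g, 0) = P b d g"
    unfolding op_term_def prod.case z by (simp add: one_op_def)
  have "sum ?t {(b1, d1, k, j). b1 \<le> b \<and> d1 \<le> d \<and> ?t (b1, d1, k, j) \<noteq> 0} = sum ?t {(b, d, g, 0)}"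
    by (rule sum.mono_neutral_left) (use uniq in auto)
  thus "op_comp P one_op b d g = P b d g" unfolding op_comp_def by (simp add: tv)
qed

theorem mainTheorem12:
  fixes A W :: "'k::field_char_0 op set" and S :: "'k op" and m n :: nat and \<mu> :: int
  assumes "n \<ge> 1"
    and "one_schur_pair m n A W"
    and "is_sato m n \<mu> W S"
  shows "(\<forall>f\<in>A. \<exists>!L. L \<in> Dsym m n \<and> op_comp S f = op_comp L S)
       \<and> (\<forall>f\<in>A. op_ord (L_S m n S f) = op_ord f)
       \<and> (\<forall>f\<in>A. \<forall>g\<in>A. L_S m n S (f + g) = L_S m n S f + L_S m n S g)
       \<and> (\<forall>c. \<forall>f\<in>A. L_S m n S (scaleK c f) = scaleK c (L_S m n S f))
       \<and> (\<forall>f\<in>A. \<forall>g\<in>A. L_S m n S (op_comp f g) = op_comp (L_S m n S f) (L_S m n S g))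
       \<and> L_S m n S one_op = one_op
       \<and> inj_on (L_S m n S) A"
proof -
  note n = assms(1) and sato = assms(3)
  have S: "S \<in> Pihat m n" and os: "op_ord S = ereal (of_int \<mu>)"
    using sato unfolding is_sato_def by blast+
  have Sw: "wf_op m n S" using S by (simp add: Pihat_iff)
  have oS: "ordle S \<mu>" unfolding op_ord_le_iff[symmetric] os by simp
  have AV: "A \<subseteq> Vn m n \<inter> Pin m n" and one: "one_op \<in> A"
    and add: "\<And>f g. f \<in> A \<Longrightarrow> g \<in> A \<Longrightarrow> f + g \<in> A" and comp: "\<And>f g. f \<in> A \<Longrightarrow> g \<in> A \<Longrightarrow> op_comp f g \<in> A"
    and scale: "\<And>c f. f \<in> A \<Longrightarrow> scaleK c f \<in> A"
    and WA: "\<And>w f. w \<in> W \<Longrightarrow> f \<in> A \<Longrightarrow> op_comp w f \<in> W"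
    using assms(2) unfolding one_schur_pair_def one_space_def by blast+
  have AP: "f \<in> Pihat m n" and Ac: "const_op f" if "f \<in> A" for f
    using AV that unfolding Vn_def Pin_def const_op_def by blast+
  let ?L = "L_S m n S"
  have ex1: "\<exists>!L. L \<in> Dsym m n \<and> op_comp S f = op_comp L S" if f: "f \<in> A" for f
  proof -
    obtain L where L: "L \<in> Dsym m n" "op_comp S f = op_comp L S"
      using schur_operator_exists[OF n sato AP[OF f] Ac[OF f] WA[OF _ f]] by blast
    show ?thesis
    proof (rule ex1I[of _ L])
      fix M assume "M \<in> Dsym m n \<and> op_comp S f = op_comp M S"
      thus "M = L" using sato_left_cancel[OF n sato _ L(1)] L(2) by metis
    qed (use L in blast)
  qed
  have LD: "?L f \<in> Dsym m n" and LS: "op_comp S f = op_comp (?L f) S" if "f \<in> A" for f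
    using theI'[OF ex1[OF that]] unfolding L_S_def by blast+
  \<comment> \<open>Each algebraic law below then amounts to exhibiting an element of
    \<open>Dsym\<close> that satisfies the defining equation.\<close>
  have Leq: "?L f = M" if "f \<in> A" "M \<in> Dsym m n" "op_comp S f = op_comp M S" for f M
    using sato_left_cancel[OF n sato LD[OF that(1)] that(2)] LS[OF that(1)] that(3) by simp
  \<comment> \<open>Agreement of all integer bounds fixes the order, including -\<infinity>; this
    also yields injectivity.\<close>
  have ord_iff: "ordle (?L f) c \<longleftrightarrow> ordle f c" if f: "f \<in> A" for f c
  proof
    assume "ordle f c"
    moreover obtain M where M: "M \<in> Dsym m n" "op_comp S f = op_comp M S" "\<forall>c. ordle f c \<longrightarrow> ordle M c"
      using schur_operator_exists[OF n sato AP[OF f] Ac[OF f] WA[OF _ f]] by blast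
    ultimately show "ordle (?L f) c" using Leq[OF f M(1,2)] by simp
  next
    assume c: "ordle (?L f) c"
    have "wf_op m n (?L f)" using LD[OF f] by (simp add: Dsym_iff)
    from ordle_op_comp[OF this Sw c oS] have "ordle (op_comp S f) (c + \<mu>)" unfolding LS[OF f] .
    thus "ordle f c" by (rule ordle_comp_const_cancel[OF n S os AP[OF f] Ac[OF f]])
  qed
  have ord: "op_ord (?L f) = op_ord f" if f: "f \<in> A" for f
  proof -
    obtain c where c: "ordle f c" using AP[OF f] by (auto simp: Pihat_iff)
    hence c': "ordle (?L f) c" using ord_iff[OF f] by simp
    show ?thesis
    proof (rule antisym)
      show "op_ord (?L f) \<le> op_ord f" by (rule op_ord_mono[OF c]) (simp add: ord_iff[OF f])
      show "op_ord f \<le> op_ord (?L f)" by (rule op_ord_mono[OF c']) (simp add: ord_iff[OF f])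
    qed
  qed
  have L_add: "?L (f + g) = ?L f + ?L g" if f: "f \<in> A" and g: "g \<in> A" for f g
  proof (rule Leq[OF add[OF f g] Dsym_add[OF LD[OF f] LD[OF g]]])
    show "op_comp S (f + g) = op_comp (?L f + ?L g) S"
      unfolding op_comp_add_left[OF n LD[OF f] LD[OF g] Sw] LS[OF f, symmetric] LS[OF g, symmetric]
      by (rule op_comp_add_right[OF n S AP[OF f] Ac[OF f] AP[OF g] Ac[OF g] AP[OF add[OF f g]] Ac[OF add[OF f g]]])
  qed
  have L_scale: "?L (scaleK c f) = scaleK c (?L f)" if f: "f \<in> A" for c f
    by (rule Leq[OF scale[OF f] Dsym_scale[OF LD[OF f]]])
      (simp only: op_comp_scale_right op_comp_scale_left LS[OF f])
  have L_comp: "?L (op_comp f g) = op_comp (?L f) (?L g)" if f: "f \<in> A" and g: "g \<in> A" for f g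
  proof (rule Leq[OF comp[OF f g] Dsym_comp[OF n LD[OF f] LD[OF g]]])
    \<comment> \<open>The three associativity laws are used once each.\<close>
    have "op_comp S (op_comp f g) = op_comp (op_comp S f) g"
      by (rule op_comp_const_assoc[OF n S AP[OF f] Ac[OF f] AP[OF g] Ac[OF g], symmetric])
    also have "\<dots> = op_comp (?L f) (op_comp S g)"
      unfolding LS[OF f] by (rule op_comp_assoc_const[OF n LD[OF f] S AP[OF g] Ac[OF g], symmetric])
    also have "\<dots> = op_comp (op_comp (?L f) (?L g)) S"
      unfolding LS[OF g] by (rule op_comp_assoc[OF n LD[OF f] LD[OF g] Sw])
    finally show "op_comp S (op_comp f g) = op_comp (op_comp (?L f) (?L g)) S" .
  qed
  have L_one: "?L one_op = one_op"
  proof (rule Leq[OF one])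
    show "(one_op :: 'k op) \<in> Dsym m n" unfolding one_op_dmono by (rule Fn_Dsym(1)[OF dmono_Fn]) simp
    show "op_comp S one_op = op_comp one_op S"
      unfolding op_comp_one_right unfolding one_op_dmono op_comp_dmono[OF n Sw supp_below_zero] by simp
  qed
  have inj: "inj_on ?L A"
  proof (rule inj_onI)
    fix f g assume f: "f \<in> A" and g: "g \<in> A" and eq: "?L f = ?L g"
    let ?d = "f + scaleK (- 1) g"
    have d: "?d \<in> A" by (intro add scale f g)
    have "?L ?d = 0"
      unfolding L_add[OF f scale[OF g]] L_scale[OF g] eq by (simp add: scaleK_def fun_eq_iff)
    \<comment> \<open>The image 0 obeys every integer bound, hence so does \<open>f - g\<close>,
      which leaves it no nonzero term.\<close>
    hence od: "ordle ?d c" for c unfolding ord_iff[OF d, symmetric] by (simp add: ordle_def)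
    have "?d b e k = 0" for b e k
    proof (rule ccontr)
      assume nz: "?d b e k \<noteq> 0"
      from ordleD[OF od[of "tdeg b e k - 1"], OF nz] show False by simp
    qed
    thus "f = g" by (intro ext) (simp add: scaleK_def)
  qed
  show ?thesis
    by (intro conjI ballI allI ex1 ord L_add L_scale L_comp L_one inj)
qed

end
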